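(* Let $\hat\Omega\subset\mathbb{R}^3$ be a domain, and let $\hat\Gamma\subset\partial\hat\Omega$ be a (relatively open) part of its boundary of class $C^{1,1}$ with outward unit normal $\boldsymbol n$. Let $\hat\phi\in H^3(\mathbb{R}^3)$ satisfy $\partial_{\boldsymbol n}\hat\phi=\boldsymbol n\cdot\nabla\hat\phi=0$ on $\hat\Gamma$. Let $\kappa_1,\kappa_2$ be the principal curvatures of $\hat\Gamma$ and $\boldsymbol d_1,\boldsymbol d_2$ corresponding orthonormal principal directions. Then, (almost everywhere) on $\hat\Gamma$, $$(\nabla_\Gamma\hat\phi)^T\,[\nabla_\Gamma\boldsymbol n]\,\nabla_\Gamma\hat\phi=\kappa_1(\boldsymbol d_1\cdot\nabla_\Gamma\hat\phi)^2+\kappa_2(\boldsymbol d_2\cdot\nabla_\Gamma\hat\phi)^2,$$ and consequently $$\partial_{\boldsymbol n}\left(|\nabla\hat\phi|^2\right)=-2\kappa_1(\boldsymbol d_1\cdot\nabla_\Gamma\hat\phi)^2-2\kappa_2(\boldsymbol d_2\cdot\nabla_\Gamma\hat\phi)^2 .$$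
   Context: $\partial_{\boldsymbol n}(\cdot)=\boldsymbol n\cdot\nabla(\cdot)$ is the normal derivative. The tangential gradient on $\hat\Gamma$ is $\nabla_\Gamma(\cdot)=\nabla(\cdot)-\partial_{\boldsymbol n}(\cdot)\,\boldsymbol n$, with components denoted $\bar D_\alpha$. The symmetric $3\times 3$ matrix $[\nabla_\Gamma\boldsymbol n]$ (extended Weingarten map) has entries $[\nabla_\Gamma\boldsymbol n]_{\alpha i}=\bar D_\alpha n_i$. It annihilates $\boldsymbol n$; its two remaining eigenvalues, with eigenvectors in the tangent plane, are by definition the principal curvatures $\kappa_1,\kappa_2$, and $\boldsymbol d_1,\boldsymbol d_2$ are the corresponding orthonormal tangential eigenvectors. Functions and derivatives on $\hat\Gamma$ are understood in the sense of traces. *)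

theory Defs
  imports "HOL-Analysis.Analysis"
begin

section \<open>Smooth functions, weak derivatives and Sobolev spaces on three-dimensional space\<close>

definition partial :: "3 \<Rightarrow> (real^3 \<Rightarrow> real) \<Rightarrow> real^3 \<Rightarrow> real" where
  "partial i f x = frechet_derivative f (at x) (axis i 1)"

primrec Ck :: "nat \<Rightarrow> (real^3 \<Rightarrow> real) \<Rightarrow> bool" where
  "Ck 0 f \<longleftrightarrow> continuous_on UNIV f"
| "Ck (Suc m) f \<longleftrightarrow> (\<forall>x. f differentiable (at x)) \<and> (\<forall>i. Ck m (partial i f))"

definition smooth :: "(real^3 \<Rightarrow> real) \<Rightarrow> bool" where
  "smooth f \<longleftrightarrow> (\<forall>m. Ck m f)"

definition test_function :: "(real^3 \<Rightarrow> real) \<Rightarrow> bool" where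
  "test_function \<eta> \<longleftrightarrow> smooth \<eta> \<and> (\<exists>K. compact K \<and> (\<forall>x. x \<notin> K \<longrightarrow> \<eta> x = 0))"

definition locally_L1 :: "(real^3 \<Rightarrow> real) \<Rightarrow> bool" where
  "locally_L1 u \<longleftrightarrow> (\<forall>K. compact K \<longrightarrow> set_integrable lborel K u)"

definition weak_partial :: "3 \<Rightarrow> (real^3 \<Rightarrow> real) \<Rightarrow> (real^3 \<Rightarrow> real) \<Rightarrow> bool" where
  "weak_partial i u w \<longleftrightarrow> locally_L1 u \<and> locally_L1 w \<and>
     (\<forall>\<eta>. test_function \<eta> \<longrightarrow>
        (LINT x|lborel. u x * partial i \<eta> x) = - (LINT x|lborel. w x * \<eta> x))"

text \<open>Weak derivatives are determined only up to Lebesgue null sets; \<open>wpartial i u\<close> is an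
  arbitrary representative. It is only used below in ways that do not depend on the choice.\<close>

definition wpartial :: "3 \<Rightarrow> (real^3 \<Rightarrow> real) \<Rightarrow> real^3 \<Rightarrow> real" where
  "wpartial i u = (SOME w. weak_partial i u w)"

definition wgrad :: "(real^3 \<Rightarrow> real) \<Rightarrow> real^3 \<Rightarrow> real^3" where
  "wgrad u x = (\<chi> i. wpartial i u x)"

definition L2 :: "(real^3 \<Rightarrow> real) set" where
  "L2 = {u. u \<in> borel_measurable lborel \<and> integrable lborel (\<lambda>x. (u x)\<^sup>2)}"

primrec sobolev_H :: "nat \<Rightarrow> (real^3 \<Rightarrow> real) set" where
  "sobolev_H 0 = L2"
| "sobolev_H (Suc m) = {u \<in> L2. \<forall>i. \<exists>w \<in> sobolev_H m. weak_partial i u w}"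

definition L1_loc_tendsto ::
    "'a::euclidean_space set \<Rightarrow> (nat \<Rightarrow> 'a \<Rightarrow> real) \<Rightarrow> ('a \<Rightarrow> real) \<Rightarrow> bool" where
  "L1_loc_tendsto S f u \<longleftrightarrow>
     (\<forall>K. compact K \<and> K \<subseteq> S \<longrightarrow>
        set_integrable lborel K u \<and> (\<forall>k. set_integrable lborel K (f k)) \<and>
        (\<lambda>k. LINT x:K|lborel. \<bar>f k x - u x\<bar>) \<longlonglongrightarrow> 0)"

section \<open>Boundary parts of class C^{1,1}\<close>

definition C11_on :: "(real^2) set \<Rightarrow> (real^2 \<Rightarrow> real) \<Rightarrow> bool" where
  "C11_on S g \<longleftrightarrow>
     (\<exists>G L. (\<forall>y\<in>S. GDERIV g y :> G y) \<and> L-lipschitz_on S G)"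

definition lift :: "real^2 \<Rightarrow> real \<Rightarrow> real^3" where
  "lift y t = vector [y $ 1, y $ 2, t]"

text \<open>After the Euclidean change of coordinates \<open>(y, t) \<mapsto> p + R (y, t)\<close>, the set \<open>\<Omega>\<close> is, inside
  the cylinder \<open>\<bar>y\<bar> < r, \<bar>t\<bar> < h\<close>, the strict subgraph of the \<open>C^{1,1}\<close> function \<open>g\<close>, and
  its boundary is the graph of \<open>g\<close>. The condition at the origin says that \<open>p\<close> is on the boundary
  if and only if \<open>g 0 = 0\<close>.\<close>

definition local_graph ::
    "(real^3) set \<Rightarrow> real^3 \<Rightarrow> (real^3 \<Rightarrow> real^3) \<Rightarrow> (real^2 \<Rightarrow> real) \<Rightarrow> real \<Rightarrow> real \<Rightarrow> bool" where
  "local_graph \<Omega> p R g r h \<longleftrightarrow>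
     orthogonal_transformation R \<and> 0 < r \<and> 0 < h \<and> C11_on (ball 0 r) g \<and>
     (\<forall>y\<in>ball 0 r. \<bar>g y\<bar> < h) \<and>
     (\<forall>y\<in>ball 0 r. \<forall>t. \<bar>t\<bar> < h \<longrightarrow>
        (p + R (lift y t) \<in> \<Omega> \<longleftrightarrow> t < g y) \<and>
        (p + R (lift y t) \<in> frontier \<Omega> \<longleftrightarrow> t = g y))"

definition C11_boundary_part :: "(real^3) set \<Rightarrow> (real^3) set \<Rightarrow> bool" where
  "C11_boundary_part \<Omega> \<Gamma> \<longleftrightarrow>
     openin (top_of_set (frontier \<Omega>)) \<Gamma> \<and> (\<forall>x\<in>\<Gamma>. \<exists>R g r h. local_graph \<Omega> x R g r h)"

definition graph_point ::
    "real^3 \<Rightarrow> (real^3 \<Rightarrow> real^3) \<Rightarrow> (real^2 \<Rightarrow> real) \<Rightarrow> real^2 \<Rightarrow> real^3" where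
  "graph_point p R g y = p + R (lift y (g y))"

definition graph_chart ::
    "(real^3) set \<Rightarrow> (real^3) set \<Rightarrow>
     real^3 \<Rightarrow> (real^3 \<Rightarrow> real^3) \<Rightarrow> (real^2 \<Rightarrow> real) \<Rightarrow> real \<Rightarrow> real \<Rightarrow> bool" where
  "graph_chart \<Omega> \<Gamma> p R g r h \<longleftrightarrow>
     local_graph \<Omega> p R g r h \<and> (\<forall>y\<in>ball 0 r. graph_point p R g y \<in> \<Gamma>)"

text \<open>In a graph chart the surface measure has the density \<open>sqrt (1 + \<bar>\<nabla>g\<bar>\<^sup>2)\<close>, which lies
  between positive constants. Surface null sets and \<open>L\<^sup>1\<close> convergence with respect to
  the surface measure on compact parts of \<open>\<Gamma>\<close> are therefore those of Lebesgue measure in the charts.\<close>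

definition AE_surface :: "(real^3) set \<Rightarrow> (real^3) set \<Rightarrow> (real^3 \<Rightarrow> bool) \<Rightarrow> bool" where
  "AE_surface \<Omega> \<Gamma> P \<longleftrightarrow>
     (\<forall>p R g r h. graph_chart \<Omega> \<Gamma> p R g r h \<longrightarrow>
        (AE y in lborel. y \<in> ball 0 r \<longrightarrow> P (graph_point p R g y)))"

definition surface_L1_loc_tendsto ::
    "(real^3) set \<Rightarrow> (real^3) set \<Rightarrow> (nat \<Rightarrow> real^3 \<Rightarrow> real) \<Rightarrow> (real^3 \<Rightarrow> real) \<Rightarrow> bool" where
  "surface_L1_loc_tendsto \<Omega> \<Gamma> f v \<longleftrightarrow>
     (\<forall>p R g r h. graph_chart \<Omega> \<Gamma> p R g r h \<longrightarrow>
        L1_loc_tendsto (ball 0 r)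
          (\<lambda>k y. f k (graph_point p R g y)) (\<lambda>y. v (graph_point p R g y)))"

text \<open>The first condition says that \<open>\<nu>\<close> is orthogonal to the tangent plane at \<open>x\<close>.\<close>

definition outward_unit_normal :: "(real^3) set \<Rightarrow> real^3 \<Rightarrow> real^3 \<Rightarrow> bool" where
  "outward_unit_normal \<Omega> x \<nu> \<longleftrightarrow>
     ((\<lambda>y. \<nu> \<bullet> y) has_derivative (\<lambda>_. 0)) (at x within frontier \<Omega>) \<and>
     norm \<nu> = 1 \<and>
     (\<forall>\<^sub>F t in at_right 0. x + t *\<^sub>R \<nu> \<notin> \<Omega> \<and> x - t *\<^sub>R \<nu> \<in> \<Omega>)"

section \<open>Traces, normal derivative and tangential gradient\<close>

text \<open>The trace operator on \<open>W^{1,1}_loc\<close>, the continuous extension of the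
  restriction of smooth functions to \<open>\<Gamma>\<close>. On \<open>H\<^sup>1\<close> it is the usual \<open>L\<^sup>2\<close>
  trace; the larger space is needed because the derivatives of \<open>\<bar>\<nabla>\<phi>\<bar>\<^sup>2\<close>, for \<open>\<phi>\<close> in
  \<open>H\<^sup>3\<close>, are directly seen to be in \<open>W^{1,1}\<close>. The trace is determined up to
  surface null sets.\<close>

definition has_trace ::
    "(real^3) set \<Rightarrow> (real^3) set \<Rightarrow> (real^3 \<Rightarrow> real) \<Rightarrow> (real^3 \<Rightarrow> real) \<Rightarrow> bool" where
  "has_trace \<Omega> \<Gamma> u v \<longleftrightarrow>
     (\<exists>f. (\<forall>k. smooth (f k)) \<and> L1_loc_tendsto UNIV f u \<and>
          (\<forall>i. L1_loc_tendsto UNIV (\<lambda>k. partial i (f k)) (wpartial i u)) \<and>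
          surface_L1_loc_tendsto \<Omega> \<Gamma> f v)"

definition trace :: "(real^3) set \<Rightarrow> (real^3) set \<Rightarrow> (real^3 \<Rightarrow> real) \<Rightarrow> real^3 \<Rightarrow> real" where
  "trace \<Omega> \<Gamma> u = (SOME v. has_trace \<Omega> \<Gamma> u v)"

definition grad_trace ::
    "(real^3) set \<Rightarrow> (real^3) set \<Rightarrow> (real^3 \<Rightarrow> real) \<Rightarrow> real^3 \<Rightarrow> real^3" where
  "grad_trace \<Omega> \<Gamma> u x = (\<chi> i. trace \<Omega> \<Gamma> (wpartial i u) x)"

definition normal_deriv ::
    "(real^3) set \<Rightarrow> (real^3) set \<Rightarrow> (real^3 \<Rightarrow> real^3) \<Rightarrow> (real^3 \<Rightarrow> real) \<Rightarrow> real^3 \<Rightarrow> real" where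
  "normal_deriv \<Omega> \<Gamma> n u x = n x \<bullet> grad_trace \<Omega> \<Gamma> u x"

definition tangential_grad ::
    "(real^3) set \<Rightarrow> (real^3) set \<Rightarrow> (real^3 \<Rightarrow> real^3) \<Rightarrow> (real^3 \<Rightarrow> real) \<Rightarrow> real^3 \<Rightarrow> real^3" where
  "tangential_grad \<Omega> \<Gamma> n u x = grad_trace \<Omega> \<Gamma> u x - normal_deriv \<Omega> \<Gamma> n u x *\<^sub>R n x"

section \<open>Weingarten map and principal curvatures\<close>

text \<open>The entry at \<open>\<alpha>\<close>, \<open>i\<close> is the \<open>\<alpha>\<close>-th component \<open>\<partial>\<^sub>\<alpha> n\<^sub>i - n\<^sub>\<alpha> \<partial>\<^sub>n n\<^sub>i\<close> of the tangential
  gradient of \<open>n\<^sub>i\<close>. The derivative within \<open>\<Gamma>\<close> is determined only on tangent vectors, and it is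
  applied only to the tangent vector \<open>e\<^sub>\<alpha> - n\<^sub>\<alpha> n\<close>, so no extension of \<open>n\<close> off \<open>\<Gamma>\<close> is involved.\<close>

definition weingarten :: "(real^3) set \<Rightarrow> (real^3 \<Rightarrow> real^3) \<Rightarrow> real^3 \<Rightarrow> real^3^3" where
  "weingarten \<Gamma> n x =
     (\<chi> \<alpha> i. frechet_derivative n (at x within \<Gamma>) (axis \<alpha> 1 - (n x $ \<alpha>) *\<^sub>R n x) $ i)"

text \<open>The normal of a \<open>C^{1,1}\<close> surface is Lipschitz, hence differentiable along the
  surface at almost every point; the principal curvatures are defined at those points.\<close>

definition principal_frame ::
    "(real^3) set \<Rightarrow> (real^3 \<Rightarrow> real^3) \<Rightarrow> real^3 \<Rightarrow> real \<Rightarrow> real \<Rightarrow> real^3 \<Rightarrow> real^3 \<Rightarrow> bool" where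
  "principal_frame \<Gamma> n x k1 k2 e1 e2 \<longleftrightarrow>
     n differentiable (at x within \<Gamma>) \<and>
     norm e1 = 1 \<and> norm e2 = 1 \<and> e1 \<bullet> e2 = 0 \<and> e1 \<bullet> n x = 0 \<and> e2 \<bullet> n x = 0 \<and>
     weingarten \<Gamma> n x *v e1 = k1 *\<^sub>R e1 \<and> weingarten \<Gamma> n x *v e2 = k2 *\<^sub>R e2"

end

theory Submission
  imports Defs
begin

text \<open>
  For smooth data the theorem is one tangential differentiation. Write \<open>G\<close> for the gradient and \<open>H\<close>
  for the Hessian of \<open>\<phi>\<close>. Since \<open>n \<bullet> G = 0\<close> on \<open>\<Gamma>\<close>, the derivative of this relation in a tangential
  direction \<open>\<tau>\<close> vanishes: \<open>D\<^sub>\<tau> n \<bullet> G + n \<bullet> H \<tau> = 0\<close>. The vector \<open>G\<close> itself is tangential, and \<open>\<tau> = G\<close>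
  gives \<open>n \<bullet> H G = - (D\<^sub>G n \<bullet> G)\<close>. The left side is half the normal derivative of \<open>\<bar>G\<bar>\<^sup>2\<close>, and
  \<open>D\<^sub>G n \<bullet> G\<close> is the quadratic form of the Weingarten map at \<open>G\<close>, which an orthonormal eigenbasis of the
  tangent plane turns into the sum over the principal curvatures.

  For \<open>\<phi>\<close> in \<open>H\<^sup>3\<close> all derivatives are weak and all boundary values are traces, so the derivative of
  the boundary relation must be taken weakly in a chart. The work is to connect the three notions.

  Mollifications \<open>\<psi>\<^sub>k\<close> of \<open>\<phi>\<close> converge in \<open>L\<^sup>2\<close> with all derivatives up to order three, hence products of
  two derivatives converge in \<open>L\<^sup>1\<close> (lemma \<open>sobolev_H3_approximation\<close>). Smooth bumps show that weak
  derivatives are unique, so these limits are the chosen representatives \<open>wpartial\<close> of \<open>\<phi>\<close> and of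
  \<open>\<bar>\<nabla>\<phi>\<bar>\<^sup>2\<close> up to null sets.

  In a graph chart, integration along the fibres bounds the \<open>L\<^sup>1\<close> norm of the restriction of a
  smooth function to the graph by its \<open>W\<^sup>1\<^sup>,\<^sup>1\<close> norm near the graph (\<open>trace_inequality\<close>). Therefore
  traces exist, and the restrictions of every smooth approximating sequence converge to the trace
  (\<open>surface_L1_loc_tendsto_trace\<close>).

  The pulled back relation is differentiated with the unnormalised normal \<open>N = R (-\<nabla>g, 1)\<close> instead of
  \<open>n\<close>. It is Lipschitz because \<open>g\<close> is \<open>C\<^sup>1\<^sup>,\<^sup>1\<close>, and it is a scalar multiple of \<open>n\<close>, so it is differentiable
  wherever \<open>n\<close> is. Translation invariance of the integral gives the weak product rule for \<open>N\<close> and the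
  restricted derivatives of \<open>\<psi>\<^sub>k\<close>; letting \<open>k\<close> tend to infinity yields the differentiated relation
  almost everywhere (\<open>differentiated_orthogonality\<close>, \<open>differentiated_neumann_condition\<close>). The scalar factor
  between \<open>N\<close> and \<open>n\<close> does no harm, since its derivative is multiplied by \<open>n \<bullet> G = 0\<close>.
\<close>

section \<open>Translations, box integrals and directional derivatives\<close>

lemma integral_translation:
  fixes f :: "'a::euclidean_space \<Rightarrow> real"
  assumes "f \<in> borel_measurable borel"
  shows "(LINT x|lborel. f (x + c)) = (LINT x|lborel. f x)"
proof -
  have "(LINT x|lborel. f x) = (LINT x|distr lborel borel ((+) c). f x)"
    by (simp add: lborel_distr_plus)
  also have "\<dots> = (LINT x|lborel. f (c + x))"
    using assms by (subst integral_distr) auto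
  finally show ?thesis by (simp add: add.commute)
qed

lemma nn_integral_translation:
  fixes f :: "'a::euclidean_space \<Rightarrow> ennreal"
  assumes "f \<in> borel_measurable borel"
  shows "(\<integral>\<^sup>+ x. f (x + c) \<partial>lborel) = (\<integral>\<^sup>+ x. f x \<partial>lborel)"
proof -
  have "(\<integral>\<^sup>+ x. f x \<partial>lborel) = (\<integral>\<^sup>+ x. f x \<partial>distr lborel borel ((+) c))"
    by (simp add: lborel_distr_plus)
  also have "\<dots> = (\<integral>\<^sup>+ x. f (c + x) \<partial>lborel)"
    using assms by (subst nn_integral_distr) auto
  finally show ?thesis by (simp add: add.commute)
qed

lemma integrable_translation:
  fixes f :: "'a::euclidean_space \<Rightarrow> real"
  assumes "integrable lborel f"
  shows "integrable lborel (\<lambda>x. f (x + c))"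
proof -
  have "integrable (distr lborel borel ((+) c)) f"
    using assms by (simp add: lborel_distr_plus)
  then have "integrable lborel (\<lambda>x. f (c + x))"
    by (subst (asm) integrable_distr_eq) (use assms in auto)
  then show ?thesis by (simp add: add.commute)
qed

text \<open>For an open set \<open>U\<close> the product of the indicator with its translate converges pointwise to the
  indicator, so the measure of the intersection of \<open>U\<close> with its translates tends to that of \<open>U\<close>, by
  dominated convergence. The integral is twice the defect.\<close>

lemma translation_continuous_L1_open:
  fixes U :: "'a::euclidean_space set"
  assumes U: "open U" and fin: "emeasure lborel U < \<infinity>" and z: "z \<longlonglongrightarrow> 0"
  shows "(\<lambda>n. LINT x|lborel. \<bar>indicator U (x + z n) - indicator U x\<bar>) \<longlonglongrightarrow> (0::real)"
proof -
  have [measurable]: "U \<in> sets borel" using U by simp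
  have iU: "integrable lborel (indicator U :: 'a \<Rightarrow> real)"
    using fin U by (intro integrable_real_indicator) auto
  have iUn: "integrable lborel (\<lambda>x. indicator U (x + z n) :: real)" for n
    by (rule integrable_translation[OF iU])
  have iP: "integrable lborel (\<lambda>x. indicator U (x + z n) * indicator U x :: real)" for n
    by (rule Bochner_Integration.integrable_bound[OF iU]) (auto simp: indicator_def)
  have lim: "(\<lambda>n. LINT x|lborel. indicator U (x + z n) * indicator U x :: real)
      \<longlonglongrightarrow> (LINT x|lborel. indicator U x)"
  proof (rule integral_dominated_convergence[where w = "indicator U"])
    show "AE x in lborel. (\<lambda>n. indicator U (x + z n) * indicator U x :: real) \<longlonglongrightarrow> indicator U x"
    proof (rule AE_I2)
      fix x :: 'a
      show "(\<lambda>n. indicator U (x + z n) * indicator U x :: real) \<longlonglongrightarrow> indicator U x"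
      proof (cases "x \<in> U")
        case True
        have "(\<lambda>n. x + z n) \<longlonglongrightarrow> x + 0" by (intro tendsto_intros z)
        then have "\<forall>\<^sub>F n in sequentially. x + z n \<in> U"
          using U True by (auto intro: topological_tendstoD)
        then have "\<forall>\<^sub>F n in sequentially. (indicator U (x + z n) * indicator U x :: real) = indicator U x"
          by eventually_elim (use True in auto)
        then show ?thesis by (rule tendsto_eventually)
      qed auto
    qed
  qed (use iU in \<open>auto simp: indicator_def\<close>)
  have eq: "(LINT x|lborel. \<bar>indicator U (x + z n) - indicator U x\<bar>)
     = 2 * (LINT x|lborel. indicator U x) - 2 * (LINT x|lborel. indicator U (x + z n) * indicator U x :: real)" for n
  proof -
    have "(LINT x|lborel. \<bar>indicator U (x + z n) - indicator U x\<bar>)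
       = (LINT x|lborel. indicator U (x + z n) + indicator U x - 2 * (indicator U (x + z n) * indicator U x :: real))"
      by (intro Bochner_Integration.integral_cong) (auto simp: indicator_def)
    also have "\<dots> = (LINT x|lborel. indicator U (x + z n)) + (LINT x|lborel. indicator U x)
        - 2 * (LINT x|lborel. indicator U (x + z n) * indicator U x :: real)"
      using iUn iU iP by simp
    also have "(LINT x|lborel. indicator U (x + z n) :: real) = (LINT x|lborel. indicator U x)"
      by (rule integral_translation) simp
    finally show ?thesis by simp
  qed
  have "(\<lambda>n. 2 * (LINT x|lborel. indicator U x) - 2 * (LINT x|lborel. indicator U (x + z n) * indicator U x :: real))
     \<longlonglongrightarrow> 2 * (LINT x|lborel. indicator U x) - 2 * (LINT x|lborel. indicator U x)"
    by (intro tendsto_intros lim)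
  then show ?thesis by (simp add: eq)
qed

lemma translation_L1_approx:
  fixes f g :: "'a::euclidean_space \<Rightarrow> real"
  assumes f: "integrable lborel f" and g: "integrable lborel g"
  shows "(LINT x|lborel. \<bar>f (x + c) - f x\<bar>)
     \<le> (LINT x|lborel. \<bar>g (x + c) - g x\<bar>) + 2 * (LINT x|lborel. \<bar>f x - g x\<bar>)"
proof -
  have fg: "integrable lborel (\<lambda>x. \<bar>f x - g x\<bar>)" using f g by auto
  have [measurable]: "f \<in> borel_measurable borel" "g \<in> borel_measurable borel"
    using f g by auto
  have fc: "integrable lborel (\<lambda>x. f (x + c))" "integrable lborel (\<lambda>x. g (x + c))"
    using f g by (auto intro: integrable_translation)
  have "(LINT x|lborel. \<bar>f (x + c) - f x\<bar>)
     \<le> (LINT x|lborel. \<bar>g (x + c) - g x\<bar> + (\<bar>f (x + c) - g (x + c)\<bar> + \<bar>f x - g x\<bar>))"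
    using f g fc by (intro integral_mono) auto
  also have "\<dots> = (LINT x|lborel. \<bar>g (x + c) - g x\<bar>)
      + ((LINT x|lborel. \<bar>f (x + c) - g (x + c)\<bar>) + (LINT x|lborel. \<bar>f x - g x\<bar>))"
    using f g fc by simp
  also have "(LINT x|lborel. \<bar>f (x + c) - g (x + c)\<bar>) = (LINT x|lborel. \<bar>f x - g x\<bar>)"
    by (rule integral_translation[of "\<lambda>x. \<bar>f x - g x\<bar>"]) simp
  finally show ?thesis by simp
qed

lemma translation_continuous_L1_closed:
  fixes f :: "'a::euclidean_space \<Rightarrow> real"
  assumes f: "integrable lborel f"
    and approx: "\<And>e. e > 0 \<Longrightarrow> \<exists>g. integrable lborel g \<and> (LINT x|lborel. \<bar>f x - g x\<bar>) < e
        \<and> (\<lambda>n. LINT x|lborel. \<bar>g (x + z n) - g x\<bar>) \<longlonglongrightarrow> 0"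
  shows "(\<lambda>n. LINT x|lborel. \<bar>f (x + z n) - f x\<bar>) \<longlonglongrightarrow> 0"
proof (rule LIMSEQ_I)
  fix e :: real assume e: "e > 0"
  obtain g where g: "integrable lborel g" "(LINT x|lborel. \<bar>f x - g x\<bar>) < e / 4"
    and lim: "(\<lambda>n. LINT x|lborel. \<bar>g (x + z n) - g x\<bar>) \<longlonglongrightarrow> 0"
    using approx[of "e / 4"] e by auto
  obtain N where N: "\<And>n. n \<ge> N \<Longrightarrow> norm ((LINT x|lborel. \<bar>g (x + z n) - g x\<bar>) - 0) < e / 2"
    using LIMSEQ_D[OF lim, of "e / 2"] e by auto
  show "\<exists>N. \<forall>n\<ge>N. norm ((LINT x|lborel. \<bar>f (x + z n) - f x\<bar>) - 0) < e"
  proof (intro exI allI impI)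
    fix n assume n: "N \<le> n"
    have "(LINT x|lborel. \<bar>f (x + z n) - f x\<bar>) < e"
      using translation_L1_approx[OF f g(1), of "z n"] N[OF n] g(2) by auto
    then show "norm ((LINT x|lborel. \<bar>f (x + z n) - f x\<bar>) - 0) < e"
      by simp
  qed
qed

text \<open>Indicators of sets of finite measure are approximated by those of open sets (outer regularity),
  and general integrable functions by simple ones; both steps survive because translation is an
  isometry.\<close>

lemma translation_continuous_L1:
  fixes f :: "'a::euclidean_space \<Rightarrow> real"
  assumes f: "integrable lborel f" and z: "z \<longlonglongrightarrow> 0"
  shows "(\<lambda>n. LINT x|lborel. \<bar>f (x + z n) - f x\<bar>) \<longlonglongrightarrow> 0"
  using f
proof (induction rule: integrable_induct)
  case (base A c)
  have A: "A \<in> sets borel" using base by simp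
  have [measurable]: "A \<in> sets borel" by fact
  have ind: "(\<lambda>n. LINT x|lborel. \<bar>indicator A (x + z n) - indicator A x\<bar>) \<longlonglongrightarrow> (0::real)"
  proof (rule translation_continuous_L1_closed)
    show "integrable lborel (indicator A :: 'a \<Rightarrow> real)"
      using base by (intro integrable_real_indicator) auto
    fix e :: real assume e: "e > 0"
    obtain U where U: "open U" "A \<subseteq> U" "emeasure lborel (U - A) < e"
      using outer_regular_lborel[OF A e] by blast
    have [measurable]: "U \<in> sets borel" using U by simp
    have "emeasure lborel U = emeasure lborel A + emeasure lborel (U - A)"
      using U by (subst plus_emeasure) (auto intro!: arg_cong[where f = "emeasure lborel"])
    also have "\<dots> < \<infinity>"
      using base U(3) by (auto simp: less_top[symmetric])
    finally have fin: "emeasure lborel U < \<infinity>" .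
    have "(LINT x|lborel. \<bar>indicator A x - indicator U x\<bar>) = (LINT x|lborel. indicator (U - A) x :: real)"
      using U(2) by (intro Bochner_Integration.integral_cong) (auto simp: indicator_def)
    also have "\<dots> = measure lborel (U - A)" by simp
    also have "\<dots> < e"
      using U(3) order.strict_trans[OF U(3) ennreal_less_top] by (simp add: measure_def)
    finally have "(LINT x|lborel. \<bar>indicator A x - indicator U x :: real\<bar>) < e" .
    then show "\<exists>g. integrable lborel g \<and> (LINT x|lborel. \<bar>indicator A x - g x\<bar>) < e
        \<and> (\<lambda>n. LINT x|lborel. \<bar>g (x + z n) - g x\<bar>) \<longlonglongrightarrow> 0"
      using translation_continuous_L1_open[OF U(1) fin z] fin
      by (intro exI[of _ "indicator U"] conjI integrable_real_indicator) auto
  qed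
  have "(\<lambda>n. \<bar>c\<bar> * (LINT x|lborel. \<bar>indicator A (x + z n) - indicator A x :: real\<bar>)) \<longlonglongrightarrow> \<bar>c\<bar> * 0"
    by (intro tendsto_intros ind)
  moreover have "(LINT x|lborel. \<bar>indicator A (x + z n) *\<^sub>R c - indicator A x *\<^sub>R c\<bar>)
      = \<bar>c\<bar> * (LINT x|lborel. \<bar>indicator A (x + z n) - indicator A x :: real\<bar>)" for n
    by (subst integral_mult_right_zero[symmetric], intro Bochner_Integration.integral_cong)
      (auto simp: indicator_def)
  ultimately show ?case by simp
next
  case (add f g)
  have fc: "integrable lborel (\<lambda>x. f (x + c))" "integrable lborel (\<lambda>x. g (x + c))" for c
    using add by (auto intro: integrable_translation)
  have "(\<lambda>n. (LINT x|lborel. \<bar>f (x + z n) - f x\<bar>) + (LINT x|lborel. \<bar>g (x + z n) - g x\<bar>)) \<longlonglongrightarrow> 0 + 0"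
    by (intro tendsto_intros add.IH)
  then have lim: "(\<lambda>n. (LINT x|lborel. \<bar>f (x + z n) - f x\<bar> + \<bar>g (x + z n) - g x\<bar>)) \<longlonglongrightarrow> 0"
    using add fc by (simp add: Bochner_Integration.integral_add)
  show ?case
  proof (rule tendsto_sandwich[OF _ _ tendsto_const lim])
    show "\<forall>\<^sub>F n in sequentially. (LINT x|lborel. \<bar>f (x + z n) + g (x + z n) - (f x + g x)\<bar>)
       \<le> (LINT x|lborel. \<bar>f (x + z n) - f x\<bar> + \<bar>g (x + z n) - g x\<bar>)"
      using add fc by (intro always_eventually allI integral_mono) auto
  qed simp
next
  case (lim f s)
  show ?case
  proof (rule translation_continuous_L1_closed)
    show "integrable lborel f" by fact
    fix e :: real assume e: "e > 0"
    have [measurable]: "s i \<in> borel_measurable lborel" "f \<in> borel_measurable lborel" for i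
      using lim by auto
    have "(\<lambda>i. LINT x|lborel. \<bar>f x - s i x\<bar>) \<longlonglongrightarrow> (LINT x|(lborel::'a measure). (0::real))"
    proof (rule integral_dominated_convergence[where w = "\<lambda>x. 3 * norm (f x)"])
      show "AE x in lborel. (\<lambda>i. \<bar>f x - s i x\<bar>) \<longlonglongrightarrow> 0"
      proof (rule AE_I2)
        fix x :: 'a
        have "(\<lambda>i. \<bar>f x - s i x\<bar>) \<longlonglongrightarrow> \<bar>f x - f x\<bar>"
          using lim by (intro tendsto_intros) auto
        then show "(\<lambda>i. \<bar>f x - s i x\<bar>) \<longlonglongrightarrow> 0" by simp
      qed
      show "AE x in lborel. norm \<bar>f x - s i x\<bar> \<le> 3 * norm (f x)" for i
      proof (rule AE_I2)
        fix x :: 'a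
        have "norm (s i x) \<le> 2 * norm (f x)" using lim(3) by simp
        then show "norm \<bar>f x - s i x\<bar> \<le> 3 * norm (f x)" by simp
      qed
    qed (use lim in auto)
    then have "(\<lambda>i. LINT x|lborel. \<bar>f x - s i x\<bar>) \<longlonglongrightarrow> 0" by simp
    then have "\<forall>\<^sub>F i in sequentially. (LINT x|lborel. \<bar>f x - s i x\<bar>) < e"
      using e by (rule order_tendstoD)
    then obtain i where "(LINT x|lborel. \<bar>f x - s i x\<bar>) < e"
      by (auto simp: eventually_sequentially)
    then show "\<exists>g. integrable lborel g \<and> (LINT x|lborel. \<bar>f x - g x\<bar>) < e
        \<and> (\<lambda>n. LINT x|lborel. \<bar>g (x + z n) - g x\<bar>) \<longlonglongrightarrow> 0"
      using lim by (intro exI[of _ "s i"]) auto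
  qed
qed

text \<open>Boxes form an intersection stable generator of the Borel sets, so inside a fixed box the integral
  vanishes over every Borel set. Countably many boxes exhaust \<open>U\<close>.\<close>

lemma AE_zero_if_box_integrals_zero:
  fixes f :: "'a::euclidean_space \<Rightarrow> real"
  assumes U: "open U"
    and int: "\<And>a b. cbox a b \<subseteq> U \<Longrightarrow> set_integrable lborel (cbox a b) f"
    and zero: "\<And>a b. cbox a b \<subseteq> U \<Longrightarrow> (LINT x:box a b|lborel. f x) = 0"
  shows "AE x in lborel. x \<in> U \<longrightarrow> f x = 0"
proof -
  have loc: "AE x in lborel. x \<in> box a b \<longrightarrow> f x = 0" if ab: "cbox a b \<subseteq> U" for a b
  proof -
    have iF: "set_integrable lborel (box a b) f"
      by (rule set_integrable_subset[OF int[OF ab]]) (auto simp: box_subset_cbox)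
    define F where "F = (\<lambda>x. indicator (box a b) x * f x)"
    have F: "integrable lborel F" using iF by (simp add: F_def set_integrable_def)
    have intA: "set_integrable lborel A F" if "A \<in> sets borel" for A
      unfolding set_integrable_def using F that by (intro integrable_mult_indicator) auto
    have "AE x in lborel. F x = 0"
    proof (rule density_unique_real[OF F])
      fix A :: "'a set" assume A: "A \<in> sets lborel"
      have St: "Int_stable (range (\<lambda>(a, b). box a b :: 'a set))"
        by (auto simp: Int_stable_def box_Int_box)
      have Po: "range (\<lambda>(a, b). box a b :: 'a set) \<subseteq> Pow UNIV" by auto
      have "A \<in> sigma_sets UNIV (range (\<lambda>(a, b). box a b :: 'a set))"
        using A by (simp add: borel_eq_box)
      with St Po have "(LINT x:A|lborel. F x) = 0"
      proof (induction rule: sigma_sets_induct_disjoint)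
        case (basic A)
        then obtain c d where A: "A = box c d" by auto
        obtain c' d' where cd: "box c d \<inter> box a b = box c' d'"
          unfolding box_Int_box by blast
        have "(LINT x:A|lborel. F x) = (LINT x:box c' d'|lborel. f x)"
          unfolding set_lebesgue_integral_def F_def A cd[symmetric]
          by (intro Bochner_Integration.integral_cong) (auto simp: indicator_def)
        also have "\<dots> = 0"
        proof (cases "box c' d' = {}")
          case False
          then have "cbox c' d' \<subseteq> cbox a b"
            using closure_box[of c' d'] closure_minimal[of "box c' d'" "cbox a b"] box_subset_cbox[of a b] cd
            by (auto simp del: closure_box)
          then show ?thesis using ab by (intro zero) auto
        qed (auto simp: set_lebesgue_integral_def)
        finally show ?case .
      next
        case empty
        show "(LINT x:{}|lborel. F x) = 0" by (simp add: set_lebesgue_integral_def)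
      next
        case (compl A)
        note A = compl(1) and 0 = compl(2)
        have A': "A \<in> sets borel" using A by (simp add: borel_eq_box)
        have "(LINT x:UNIV|lborel. F x) = (LINT x:A|lborel. F x) + (LINT x:UNIV - A|lborel. F x)"
          using A' intA[of A] intA[of "UNIV - A"]
          by (subst set_integral_Un[symmetric]) (auto intro!: arg_cong2[where f = "\<lambda>A. set_lebesgue_integral lborel A"])
        moreover have "(LINT x:UNIV|lborel. F x) = (LINT x:box a b|lborel. f x)"
          by (simp add: set_lebesgue_integral_def F_def)
        ultimately show "(LINT x:UNIV - A|lborel. F x) = 0" using 0 zero[OF ab] by simp
      next
        case (union A)
        note A = union(1,2) and 0 = union(3)
        have A': "A i \<in> sets borel" for i using A(2) by (auto simp: borel_eq_box)
        have "(LINT x:(\<Union>i. A i)|lborel. F x) = (\<Sum>i. LINT x:A i|lborel. F x)"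
          using A(1) A' by (intro lebesgue_integral_countable_add intA) (auto simp: disjoint_family_on_def)
        then show "(LINT x:(\<Union>i. A i)|lborel. F x) = 0" using 0 by simp
      qed
      then show "(LINT x:A|lborel. F x) = (LINT x:A|lborel. 0)"
        by (simp add: set_lebesgue_integral_def)
    qed simp
    then show ?thesis by eventually_elim (auto simp: F_def)
  qed
  obtain D where D: "countable D" "D \<subseteq> Pow U" "\<And>X. X \<in> D \<Longrightarrow> \<exists>a b. X = cbox a b" "\<Union>D = U"
    using open_countable_Union_open_cbox[OF U] by blast
  have "AE x in lborel. \<forall>X\<in>D. x \<in> X \<longrightarrow> f x = 0"
  proof (subst AE_ball_countable[OF D(1)], intro ballI)
    fix X assume X: "X \<in> D"
    obtain a b where ab: "X = cbox a b" using D(3)[OF X] by auto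
    have "AE x in lborel. x \<in> box a b \<longrightarrow> f x = 0"
      using loc X ab D(2) by auto
    moreover have "AE x in lborel. x \<notin> cbox a b - box a b"
      by (intro AE_not_in null_setsI) (auto simp: emeasure_lborel_cbox_eq emeasure_lborel_box_eq emeasure_Diff box_subset_cbox)
    ultimately show "AE x in lborel. x \<in> X \<longrightarrow> f x = 0"
      by eventually_elim (auto simp: ab)
  qed
  then show ?thesis by eventually_elim (use D(4) in auto)
qed

text \<open>Integration by parts without boundary terms for Lipschitz functions: by translation invariance every
  difference quotient has integral zero, and the Lipschitz bound dominates the passage to the limit.
  Asking for the derivative almost everywhere makes the lemma applicable to the normal of a \<open>C\<^sup>1\<^sup>,\<^sup>1\<close> surface.\<close>

lemma integral_directional_derivative_eq_0:
  fixes F :: "'a::euclidean_space \<Rightarrow> real"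
  assumes F: "integrable lborel F" and F': "F' \<in> borel_measurable lborel"
    and supp: "\<And>x. norm x > B \<Longrightarrow> F x = 0"
    and \<delta>: "\<delta> > 0"
    and lip: "\<And>x t. \<bar>t\<bar> < \<delta> \<Longrightarrow> \<bar>F (x + t *\<^sub>R e) - F x\<bar> \<le> L * \<bar>t\<bar>"
    and deriv: "AE x in lborel. ((\<lambda>t. F (x + t *\<^sub>R e)) has_real_derivative F' x) (at 0)"
  shows "integrable lborel F'" and "(LINT x|lborel. F' x) = 0"
proof -
  define t where "t n = \<delta> / (real n + 2)" for n
  have t: "t n > 0" "t n < \<delta>" for n
    using \<delta> by (auto simp: t_def field_simps intro!: add_pos_nonneg)
  have t0: "t \<longlonglongrightarrow> 0"
    unfolding t_def using LIMSEQ_ignore_initial_segment[OF lim_const_over_n[of \<delta>], of 2] by (simp add: add.commute)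
  have [measurable]: "F \<in> borel_measurable borel" using F by auto
  have iFt: "integrable lborel (\<lambda>x. F (x + t n *\<^sub>R e))" for n
    by (rule integrable_translation[OF F])
  let ?w = "\<lambda>x. \<bar>L\<bar> * indicator (cball 0 (B + \<delta> * norm e)) x :: real"
  have w: "integrable lborel ?w"
    by (intro integrable_mult_right integrable_real_indicator emeasure_bounded_finite) auto
  have lim: "AE x in lborel. (\<lambda>n. (F (x + t n *\<^sub>R e) - F x) / t n) \<longlonglongrightarrow> F' x"
    using deriv
  proof eventually_elim
    case (elim x)
    then have "((\<lambda>h. (F (x + h *\<^sub>R e) - F x) / h) \<longlongrightarrow> F' x) (at 0)"
      by (simp add: has_field_derivative_iff)
    moreover have "filterlim t (at 0) sequentially"
      using t0 t(1) by (auto simp: filterlim_at intro!: always_eventually) (metis less_irrefl)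
    ultimately show ?case by (rule filterlim_compose)
  qed
  have bd: "AE x in lborel. norm ((F (x + t n *\<^sub>R e) - F x) / t n) \<le> ?w x" for n
  proof (rule AE_I2)
    fix x
    show "norm ((F (x + t n *\<^sub>R e) - F x) / t n) \<le> ?w x"
    proof (cases "x \<in> cball 0 (B + \<delta> * norm e)")
      case True
      have "\<bar>F (x + t n *\<^sub>R e) - F x\<bar> \<le> \<bar>L\<bar> * t n"
        using lip[of "t n" x] t[of n] by (intro order_trans[OF lip]) (auto intro: mult_right_mono)
      then show ?thesis using True t[of n] by (simp add: field_simps)
    next
      case False
      have "norm (t n *\<^sub>R e) \<le> \<delta> * norm e"
        using t[of n] by (auto intro: mult_right_mono)
      moreover have "norm x \<le> norm (x + t n *\<^sub>R e) + norm (t n *\<^sub>R e)"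
        by (metis add_diff_cancel norm_triangle_ineq4)
      ultimately have 1: "norm (x + t n *\<^sub>R e) > B" using False by auto
      have "\<delta> * norm e \<ge> 0" using \<delta> by auto
      then have "norm x > B" using False by auto
      then show ?thesis using 1 supp False by simp
    qed
  qed
  have m: "(\<lambda>x. (F (x + t n *\<^sub>R e) - F x) / t n) \<in> borel_measurable lborel" for n by measurable
  show "integrable lborel F'"
    by (rule integrable_dominated_convergence[OF F' m w lim bd])
  have "(\<lambda>n. LINT x|lborel. (F (x + t n *\<^sub>R e) - F x) / t n) \<longlonglongrightarrow> (LINT x|lborel. F' x)"
    by (rule integral_dominated_convergence[OF F' m w lim bd])
  moreover have "(LINT x|lborel. (F (x + t n *\<^sub>R e) - F x) / t n) = 0" for n
    using F iFt integral_translation[of F "t n *\<^sub>R e"] by simp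
  ultimately have "(\<lambda>n. 0) \<longlonglongrightarrow> (LINT x|lborel. F' x)" by (simp only:)
  then show "(LINT x|lborel. F' x) = 0"
    using LIMSEQ_unique tendsto_const by blast
qed

section \<open>Compactly supported bumps and the fundamental lemma\<close>

definition bump_quad :: "real \<Rightarrow> real \<Rightarrow> real poly" where
  "bump_quad a b = [:- a * b, a + b, - 1:]"

lemma poly_bump_quad: "poly (bump_quad a b) t = (t - a) * (b - t)"
  by (simp add: bump_quad_def algebra_simps)

text \<open>Every derivative of \<open>exp (- c / q)\<close>, where \<open>q = (t - a) (b - t)\<close>, is a polynomial times an even power
  of \<open>1 / q\<close> times the exponential; this is the recursion for the polynomial.\<close>

primrec bump_poly :: "real \<Rightarrow> real \<Rightarrow> real \<Rightarrow> nat \<Rightarrow> real poly" where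
  "bump_poly a b c 0 = 1"
| "bump_poly a b c (Suc m) =
     pderiv (bump_poly a b c m) * (bump_quad a b)\<^sup>2
     - smult (real (2 * m)) (bump_poly a b c m * pderiv (bump_quad a b) * bump_quad a b)
     + smult c (bump_poly a b c m * pderiv (bump_quad a b))"

text \<open>The \<open>m\<close>-th derivative of the bump \<open>exp (- c / ((t - a) (b - t)))\<close> supported on \<open>[a, b]\<close>. The family
  carries its derivatives along as the index \<open>m\<close>, so that smoothness is a statement about consecutive
  indices. As \<open>c\<close> tends to 0 the member with \<open>m = 0\<close> increases to the indicator of the open interval.\<close>

definition bump :: "real \<Rightarrow> real \<Rightarrow> real \<Rightarrow> nat \<Rightarrow> real \<Rightarrow> real" where
  "bump a b c m t = (if a < t \<and> t < b
     then poly (bump_poly a b c m) t * (1 / ((t - a) * (b - t))) ^ (2 * m) * exp (- c / ((t - a) * (b - t)))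
     else 0)"

lemma power_mult_exp_le:
  fixes r c :: real
  assumes "r \<ge> 0" "c > 0" "m > 0"
  shows "r ^ m * exp (- (c * r)) \<le> (real m / c) ^ m"
proof -
  have "c * r / m \<le> exp (c * r / m)"
    using exp_ge_add_one_self[of "c * r / m"] by linarith
  then have "(c * r / m) ^ m \<le> exp (c * r / m) ^ m"
    using assms by (intro power_mono) auto
  also have "\<dots> = exp (c * r)"
    using assms by (simp add: exp_of_nat_mult[symmetric])
  finally have "(c / m) ^ m * r ^ m \<le> exp (c * r)"
    by (simp add: power_mult_distrib[symmetric])
  then show ?thesis
    using assms by (simp add: exp_minus power_divide field_simps)
qed

text \<open>The exponential beats the power of \<open>1 / q\<close> by two further orders of \<open>q\<close>. The quadratic decay makes
  every derivative of the bump differentiable at the endpoints with derivative 0.\<close>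

lemma bump_quadratic_bound:
  assumes ab: "a < b" and c: "c > 0"
  obtains C where "\<And>t. \<bar>bump a b c m t\<bar> \<le> C * (t - a)\<^sup>2" "\<And>t. \<bar>bump a b c m t\<bar> \<le> C * (t - b)\<^sup>2"
proof -
  have "continuous_on {a..b} (poly (bump_poly a b c m))" by (intro continuous_intros)
  then have "bounded (poly (bump_poly a b c m) ` {a..b})"
    by (intro compact_imp_bounded compact_continuous_image) auto
  then obtain M where M: "M > 0" "\<And>t. t \<in> {a..b} \<Longrightarrow> \<bar>poly (bump_poly a b c m) t\<bar> \<le> M"
    unfolding bounded_pos by auto
  define K where "K = (real (2 * m + 2) / c) ^ (2 * m + 2)"
  have K: "K \<ge> 0" using c by (auto simp: K_def)
  have key: "\<bar>bump a b c m t\<bar> \<le> M * K * ((t - a) * (b - t))\<^sup>2" if t: "a < t" "t < b" for t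
  proof -
    define q where "q = (t - a) * (b - t)"
    have q: "q > 0" using t by (simp add: q_def)
    have "(1 / q) ^ (2 * m + 2) * exp (- (c * (1 / q))) \<le> K"
      unfolding K_def using q c by (intro power_mult_exp_le) auto
    then have "(1 / q) ^ (2 * m + 2) * exp (- (c * (1 / q))) * q\<^sup>2 \<le> K * q\<^sup>2"
      by (intro mult_right_mono) auto
    moreover have "(1 / q) ^ (2 * m + 2) * exp (- (c * (1 / q))) * q\<^sup>2 = (1 / q) ^ (2 * m) * exp (- c / q)"
      using q by (simp add: power_add field_simps power2_eq_square)
    ultimately have "(1 / q) ^ (2 * m) * exp (- c / q) \<le> K * q\<^sup>2" by simp
    then have "\<bar>poly (bump_poly a b c m) t\<bar> * ((1 / q) ^ (2 * m) * exp (- c / q)) \<le> M * (K * q\<^sup>2)"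
      using M(2)[of t] M(1) t q K by (intro mult_mono[of _ M _ "K * q\<^sup>2"]) auto
    moreover have "\<bar>bump a b c m t\<bar> = \<bar>poly (bump_poly a b c m) t\<bar> * ((1 / q) ^ (2 * m) * exp (- c / q))"
      using t q by (simp add: bump_def q_def abs_mult)
    ultimately show ?thesis by (simp add: q_def)
  qed
  define C where "C = M * K * (b - a)\<^sup>2"
  have C: "C \<ge> 0" using M K by (simp add: C_def)
  have "\<bar>bump a b c m t\<bar> \<le> C * (t - a)\<^sup>2 \<and> \<bar>bump a b c m t\<bar> \<le> C * (t - b)\<^sup>2" for t
  proof (cases "a < t \<and> t < b")
    case True
    have 1: "(b - t)\<^sup>2 \<le> (b - a)\<^sup>2" "(t - a)\<^sup>2 \<le> (b - a)\<^sup>2"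
      using True by (intro power_mono; simp)+
    have "M * K * ((t - a)\<^sup>2 * (b - t)\<^sup>2) \<le> M * K * ((t - a)\<^sup>2 * (b - a)\<^sup>2)"
      using M K 1 by (intro mult_left_mono) auto
    moreover have "M * K * ((t - a)\<^sup>2 * (b - t)\<^sup>2) \<le> M * K * ((b - a)\<^sup>2 * (b - t)\<^sup>2)"
      using M K 1 by (intro mult_left_mono mult_right_mono) auto
    ultimately show ?thesis
      using key[of t] True by (simp add: C_def power_mult_distrib power2_commute[of t b] mult_ac)
  next
    case False
    then have "bump a b c m t = 0" unfolding bump_def by (rule if_not_P)
    then show ?thesis using C by simp
  qed
  then show thesis by (intro that) auto
qed

lemma has_real_derivative_zero_if_quadratic:
  fixes f :: "real \<Rightarrow> real"
  assumes "\<And>t. \<bar>f t\<bar> \<le> C * (t - x)\<^sup>2"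
  shows "(f has_real_derivative 0) (at x)"
proof -
  have 0: "f x = 0" using assms[of x] by simp
  have "((\<lambda>t. (f t - f x) / (t - x)) \<longlongrightarrow> 0) (at x)"
  proof (rule Lim_null_comparison)
    show "\<forall>\<^sub>F t in at x. norm ((f t - f x) / (t - x)) \<le> C * \<bar>t - x\<bar>"
    proof (rule eventually_at_topological[THEN iffD2], intro exI[of _ UNIV] conjI ballI impI)
      fix t assume "t \<noteq> x"
      then show "norm ((f t - f x) / (t - x)) \<le> C * \<bar>t - x\<bar>"
        using assms[of t] 0 by (simp add: field_simps power2_eq_square)
    qed auto
    show "((\<lambda>t. C * \<bar>t - x\<bar>) \<longlongrightarrow> 0) (at x)"
      by (auto intro!: tendsto_eq_intros)
  qed
  then show ?thesis by (simp add: has_field_derivative_iff)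
qed

lemma bump_deriv:
  assumes ab: "a < b" and c: "c > 0"
  shows "(bump a b c m has_real_derivative bump a b c (Suc m) t) (at t)"
proof -
  consider "a < t" "t < b" | "t < a" | "t > b" | "t = a" | "t = b" by linarith
  then show ?thesis
  proof cases
    case 1
    define P where "P = bump_poly a b c m"
    define r where "r s = 1 / ((s - a) * (b - s))" for s
    have q0: "(t - a) * (b - t) > 0" using 1 by simp
    have rt: "r t * ((t - a) * (b - t)) = 1" using 1 by (simp add: r_def)
    have dr: "(r has_real_derivative - (b + a - 2 * t) * (r t)\<^sup>2) (at t)"
      unfolding r_def using 1
      by (auto intro!: derivative_eq_intros simp: power2_eq_square divide_simps)
    have "((\<lambda>s. poly P s * r s ^ (2 * m) * exp (- c * r s)) has_real_derivative
        (poly (pderiv P) t * r t ^ (2 * m) + real (2 * m) * r t ^ (2 * m - 1) * (- (b + a - 2 * t) * (r t)\<^sup>2) * poly P t) * exp (- c * r t)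
        + poly P t * r t ^ (2 * m) * (exp (- c * r t) * (- c * (- (b + a - 2 * t) * (r t)\<^sup>2)))) (at t)"
      by (rule derivative_eq_intros dr refl poly_DERIV | simp add: algebra_simps)+
    also have "(poly (pderiv P) t * r t ^ (2 * m) + real (2 * m) * r t ^ (2 * m - 1) * (- (b + a - 2 * t) * (r t)\<^sup>2) * poly P t) * exp (- c * r t)
        + poly P t * r t ^ (2 * m) * (exp (- c * r t) * (- c * (- (b + a - 2 * t) * (r t)\<^sup>2)))
        = poly (bump_poly a b c (Suc m)) t * r t ^ (2 * Suc m) * exp (- c * r t)"
    proof -
      define q where "q = (t - a) * (b - t)"
      have rq: "r t * q = 1" using rt by (simp add: q_def)
      have dq: "poly (pderiv (bump_quad a b)) t = b + a - 2 * t"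
        by (simp add: bump_quad_def pderiv_pCons)
      have e: "poly (bump_poly a b c (Suc m)) t = poly (pderiv P) t * q\<^sup>2
          - real (2 * m) * (poly P t * (b + a - 2 * t) * q) + c * (poly P t * (b + a - 2 * t))"
        by (simp add: P_def poly_bump_quad dq q_def)
      have r2: "r t ^ (2 * Suc m) = r t ^ (2 * m) * (r t)\<^sup>2"
        by (simp add: power_add[symmetric])
      have rq2: "q\<^sup>2 * (r t)\<^sup>2 = 1" using rq by (simp add: power_mult_distrib[symmetric] mult.commute)
      have r3: "real (2 * m) * (r t ^ (2 * m) * (r t)\<^sup>2 * q) = real (2 * m) * (r t ^ (2 * m - 1) * (r t)\<^sup>2)"
      proof (cases m)
        case (Suc k)
        have "r t ^ (2 * m) = r t ^ (2 * m - 1) * r t"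
          using Suc by (simp add: power_Suc2[symmetric] del: power_Suc)
        then show ?thesis using rq by (simp add: algebra_simps)
      qed simp
      have "poly (bump_poly a b c (Suc m)) t * r t ^ (2 * Suc m)
         = poly (pderiv P) t * r t ^ (2 * m) * (q\<^sup>2 * (r t)\<^sup>2)
          - poly P t * (b + a - 2 * t) * (real (2 * m) * (r t ^ (2 * m) * (r t)\<^sup>2 * q))
          + c * poly P t * (b + a - 2 * t) * r t ^ (2 * m) * (r t)\<^sup>2"
        unfolding e r2 by (simp add: algebra_simps)
      then have *: "poly (bump_poly a b c (Suc m)) t * r t ^ (2 * Suc m)
         = poly (pderiv P) t * r t ^ (2 * m)
          - poly P t * (b + a - 2 * t) * (real (2 * m) * (r t ^ (2 * m - 1) * (r t)\<^sup>2))
          + c * poly P t * (b + a - 2 * t) * r t ^ (2 * m) * (r t)\<^sup>2"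
        unfolding rq2 r3 by simp
      show ?thesis unfolding * by (simp add: algebra_simps)
    qed
    finally have "((\<lambda>s. poly P s * r s ^ (2 * m) * exp (- c * r s)) has_real_derivative bump a b c (Suc m) t) (at t)"
      using 1 by (simp add: bump_def r_def del: bump_poly.simps)
    then show ?thesis
    proof (rule has_field_derivative_transform_within_open[where S = "{a<..<b}"])
    qed (use 1 in \<open>auto simp: bump_def r_def P_def\<close>)
  next
    case 2
    then have "bump a b c (Suc m) t = 0" by (simp add: bump_def del: bump_poly.simps)
    moreover have "(bump a b c m has_real_derivative 0) (at t)"
      by (rule has_field_derivative_transform_within_open[where S = "{..<a}" and f = "\<lambda>_. 0"])
        (use 2 in \<open>auto simp: bump_def\<close>)
    ultimately show ?thesis by simp
  next
    case 3
    then have "bump a b c (Suc m) t = 0" by (simp add: bump_def del: bump_poly.simps)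
    moreover have "(bump a b c m has_real_derivative 0) (at t)"
      by (rule has_field_derivative_transform_within_open[where S = "{b<..}" and f = "\<lambda>_. 0"])
        (use 3 in \<open>auto simp: bump_def\<close>)
    ultimately show ?thesis by simp
  next
    case 4
    then have "bump a b c (Suc m) t = 0" by (simp add: bump_def del: bump_poly.simps)
    then show ?thesis
      using bump_quadratic_bound[OF ab c, of m] has_real_derivative_zero_if_quadratic 4 by metis
  next
    case 5
    then have "bump a b c (Suc m) t = 0" by (simp add: bump_def del: bump_poly.simps)
    then show ?thesis
      using bump_quadratic_bound[OF ab c, of m] has_real_derivative_zero_if_quadratic 5 by metis
  qed
qed

text \<open>A product of functions of one coordinate each. \<open>D j m\<close> is meant to be the \<open>m\<close>-th derivative of the
  factor in the \<open>j\<close>-th coordinate; partial derivatives then only shift the multi-index \<open>\<alpha>\<close>, which makes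
  smoothness and the symmetry of second derivatives immediate.\<close>

definition tensor :: "('n::finite \<Rightarrow> nat \<Rightarrow> real \<Rightarrow> real) \<Rightarrow> ('n \<Rightarrow> nat) \<Rightarrow> real^'n \<Rightarrow> real" where
  "tensor D \<alpha> x = (\<Prod>j\<in>UNIV. D j (\<alpha> j) (x $ j))"

lemma tensor_has_derivative:
  assumes D: "\<And>j m t. (D j m has_real_derivative D j (Suc m) t) (at t)"
  shows "(tensor D \<alpha> has_derivative (\<lambda>h. \<Sum>i\<in>UNIV. h $ i * tensor D (\<alpha>(i := Suc (\<alpha> i))) x)) (at x)"
proof -
  have 1: "((\<lambda>x. D j m (x $ j)) has_derivative (\<lambda>h. h $ j * D j (Suc m) (x $ j))) (at x)" for j m
    using has_derivative_compose[OF bounded_linear_imp_has_derivative[OF bounded_linear_vec_nth[of j]],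
        OF D[of j m "x $ j", unfolded has_field_derivative_def]]
    by (simp add: mult.commute)
  have "((\<lambda>x. \<Prod>j\<in>UNIV. D j (\<alpha> j) (x $ j)) has_derivative
     (\<lambda>h. \<Sum>i\<in>UNIV. (h $ i * D i (Suc (\<alpha> i)) (x $ i)) * (\<Prod>j\<in>UNIV - {i}. D j (\<alpha> j) (x $ j)))) (at x)"
    by (rule has_derivative_prod) (use 1 in auto)
  moreover have "tensor D (\<alpha>(i := Suc (\<alpha> i))) x = D i (Suc (\<alpha> i)) (x $ i) * (\<Prod>j\<in>UNIV - {i}. D j (\<alpha> j) (x $ j))" for i
    unfolding tensor_def by (subst prod.remove[of _ i]) (auto intro!: prod.cong)
  ultimately show ?thesis by (simp add: tensor_def[abs_def] mult.assoc)
qed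

lemma partial_tensor:
  assumes D: "\<And>j m t. (D j m has_real_derivative D j (Suc m) t) (at t)"
  shows "partial i (tensor D \<alpha>) = tensor D (\<alpha>(i := Suc (\<alpha> i)))"
proof
  fix x
  show "partial i (tensor D \<alpha>) x = tensor D (\<alpha>(i := Suc (\<alpha> i))) x"
    unfolding partial_def frechet_derivative_at[OF tensor_has_derivative[of D, OF D], symmetric]
    by (simp add: axis_def if_distrib[where f = "\<lambda>t. t * _"] cong: if_cong)
qed

lemma smooth_tensor:
  assumes D: "\<And>j m t. (D j m has_real_derivative D j (Suc m) t) (at t)"
  shows "smooth (tensor D \<alpha>)"
proof -
  have diff: "tensor D \<alpha> differentiable (at x)" for \<alpha> x
    using tensor_has_derivative[of D, OF D] unfolding differentiable_def by blast
  have "Ck m (tensor D \<alpha>)" for m \<alpha>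
  proof (induction m arbitrary: \<alpha>)
    case 0
    then show ?case
      by (auto intro!: continuous_at_imp_continuous_on differentiable_imp_continuous_within diff)
  next
    case (Suc m)
    then show ?case using diff by (simp add: partial_tensor[of D, OF D])
  qed
  then show ?thesis by (simp add: smooth_def)
qed

definition box_bump :: "real^'n \<Rightarrow> real^'n \<Rightarrow> real \<Rightarrow> ('n \<Rightarrow> nat) \<Rightarrow> real^'n::finite \<Rightarrow> real" where
  "box_bump a b c = tensor (\<lambda>j. bump (a $ j) (b $ j) c)"

lemma box_bump_outside: "x \<notin> box a b \<Longrightarrow> box_bump a b c \<alpha> x = 0"
  by (auto simp: box_bump_def tensor_def bump_def mem_box_cart)

lemma box_bump_props:
  shows "0 \<le> box_bump a b c (\<lambda>_. 0) x"
    and "c > 0 \<Longrightarrow> box_bump a b c (\<lambda>_. 0) x \<le> 1"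
    and "x \<in> box a b \<Longrightarrow> box_bump a b c (\<lambda>_. 0) x > 0"
  by (auto simp: box_bump_def tensor_def bump_def mem_box_cart intro!: prod_nonneg prod_le_1 prod_pos)

lemma box_bump_tendsto:
  "(\<lambda>n. box_bump a b (1 / (real n + 1)) (\<lambda>_. 0) x) \<longlonglongrightarrow> indicator (box a b) x"
proof (cases "x \<in> box a b")
  case True
  have 1: "(\<lambda>n. bump (a $ j) (b $ j) (1 / (real n + 1)) 0 (x $ j)) \<longlonglongrightarrow> 1" for j
  proof -
    have "(\<lambda>n. exp (- (1 / (real n + 1)) / ((x $ j - a $ j) * (b $ j - x $ j))))
       \<longlonglongrightarrow> exp (- 0 / ((x $ j - a $ j) * (b $ j - x $ j)))"
    proof (intro tendsto_intros)
      show "(\<lambda>n. 1 / (real n + 1)) \<longlonglongrightarrow> 0"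
        using LIMSEQ_inverse_real_of_nat by (simp add: inverse_eq_divide add.commute)
    qed (use True in \<open>auto simp: mem_box_cart dest: spec[of _ j]\<close>)
    then show ?thesis using True by (simp add: bump_def mem_box_cart)
  qed
  have "(\<lambda>n. \<Prod>j\<in>UNIV. bump (a $ j) (b $ j) (1 / (real n + 1)) 0 (x $ j)) \<longlonglongrightarrow> (\<Prod>j\<in>(UNIV::'a set). 1)"
    by (intro tendsto_prod 1)
  then show ?thesis using True by (simp add: box_bump_def tensor_def)
qed (simp add: box_bump_outside)

lemma box_bump_has_derivative:
  assumes "\<And>j. a $ j < b $ j" "c > 0"
  shows "(box_bump a b c \<alpha> has_derivative (\<lambda>h. \<Sum>i\<in>UNIV. h $ i * box_bump a b c (\<alpha>(i := Suc (\<alpha> i))) x)) (at x)"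
  unfolding box_bump_def by (rule tensor_has_derivative) (use assms in \<open>auto intro: bump_deriv simp del: bump_poly.simps\<close>)

lemma continuous_box_bump:
  assumes "\<And>j. a $ j < b $ j" "c > 0"
  shows "continuous_on A (box_bump a b c \<alpha>)"
  by (meson assms box_bump_has_derivative continuous_at_imp_continuous_on has_derivative_continuous)

lemma test_function_box_bump:
  assumes "\<And>j. a $ j < b $ j" "c > 0"
  shows "test_function (box_bump a b c \<alpha>)"
  unfolding test_function_def
proof (intro conjI exI[of _ "cbox a b"] allI impI)
  show "smooth (box_bump a b c \<alpha>)"
    unfolding box_bump_def by (rule smooth_tensor) (use assms in \<open>auto intro: bump_deriv simp del: bump_poly.simps\<close>)
  fix x assume "x \<notin> cbox a b"
  then show "box_bump a b c \<alpha> x = 0"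
    using box_subset_cbox[of a b] by (intro box_bump_outside) auto
qed auto

lemma partial_box_bump:
  assumes "\<And>j. a $ j < b $ j" "c > 0"
  shows "partial i (box_bump a b c \<alpha>) = box_bump a b c (\<alpha>(i := Suc (\<alpha> i)))"
  unfolding box_bump_def by (rule partial_tensor) (use assms in \<open>auto intro: bump_deriv simp del: bump_poly.simps\<close>)

text \<open>For \<open>c = 1 / (n + 1)\<close> the bumps converge boundedly to the indicator of the box, which reduces the
  claim to vanishing box integrals.\<close>

lemma fundamental_lemma_box_bump:
  fixes f :: "real^'n::finite \<Rightarrow> real"
  assumes U: "open U"
    and int: "\<And>a b. cbox a b \<subseteq> U \<Longrightarrow> set_integrable lborel (cbox a b) f"
    and zero: "\<And>a b c. cbox a b \<subseteq> U \<Longrightarrow> (\<And>j. a $ j < b $ j) \<Longrightarrow> c > 0 \<Longrightarrow>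
      (LINT x|lborel. f x * box_bump a b c (\<lambda>_. 0) x) = 0"
  shows "AE x in lborel. x \<in> U \<longrightarrow> f x = 0"
proof (rule AE_zero_if_box_integrals_zero[OF U int])
  fix a b assume ab: "cbox a b \<subseteq> U"
  show "(LINT x:box a b|lborel. f x) = 0"
  proof (cases "\<forall>j. a $ j < b $ j")
    case True
    have iF: "set_integrable lborel (box a b) f"
      by (rule set_integrable_subset[OF int[OF ab]]) (auto simp: box_subset_cbox)
    have e: "f x * box_bump a b c (\<lambda>_. 0) x = (indicator (box a b) x * f x) * box_bump a b c (\<lambda>_. 0) x" for x c
      by (cases "x \<in> box a b") (auto simp: box_bump_outside)
    have "(\<lambda>n. LINT x|lborel. f x * box_bump a b (1 / (real n + 1)) (\<lambda>_. 0) x)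
       \<longlonglongrightarrow> (LINT x|lborel. (indicator (box a b) x * f x) * indicator (box a b) x)"
      unfolding e
    proof (rule integral_dominated_convergence[where w = "\<lambda>x. \<bar>indicator (box a b) x * f x\<bar>"])
      show "integrable lborel (\<lambda>x. \<bar>indicator (box a b) x * f x\<bar>)"
        using iF by (simp add: set_integrable_def)
      have [measurable]: "(\<lambda>x. indicator (box a b) x * f x) \<in> borel_measurable lborel"
        using iF by (auto simp: set_integrable_def)
      have [measurable]: "box_bump a b (1 / (real n + 1)) (\<lambda>_. 0) \<in> borel_measurable lborel" for n
        using True by (auto intro!: borel_measurable_continuous_onI continuous_box_bump)
      show "(\<lambda>x. indicator (box a b) x * f x * indicator (box a b) x) \<in> borel_measurable lborel"
         by measurable
      show "(\<lambda>x. indicator (box a b) x * f x * box_bump a b (1 / (real n + 1)) (\<lambda>_. 0) x) \<in> borel_measurable lborel" for n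
         by measurable
      show "AE x in lborel. norm (indicator (box a b) x * f x * box_bump a b (1 / (real n + 1)) (\<lambda>_. 0) x)
            \<le> \<bar>indicator (box a b) x * f x\<bar>" for n
        using box_bump_props(1)[of a b "1 / (real n + 1)"] box_bump_props(2)[of "1 / (real n + 1)" a b]
        by (intro AE_I2) (simp add: abs_mult mult_left_le del: mult_le_0_iff)
      show "AE x in lborel. (\<lambda>n. indicator (box a b) x * f x * box_bump a b (1 / (real n + 1)) (\<lambda>_. 0) x)
          \<longlonglongrightarrow> indicator (box a b) x * f x * indicator (box a b) x"
        by (intro AE_I2 tendsto_intros box_bump_tendsto)
    qed
    then have "(\<lambda>n::nat. 0::real) \<longlonglongrightarrow> (LINT x|lborel. (indicator (box a b) x * f x) * indicator (box a b) x)"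
      using zero[OF ab] True by simp
    then have "(LINT x|lborel. (indicator (box a b) x * f x) * indicator (box a b) x) = 0"
      using LIMSEQ_unique tendsto_const by blast
    moreover have "(LINT x:box a b|lborel. f x) = (LINT x|lborel. (indicator (box a b) x * f x) * indicator (box a b) x)"
      unfolding set_lebesgue_integral_def
      by (intro Bochner_Integration.integral_cong) (auto simp: indicator_def)
    ultimately show ?thesis by simp
  next
    case False
    then have "box a b = {}" by (auto simp: mem_box_cart) (meson order_less_trans)
    then show ?thesis by (simp add: set_lebesgue_integral_def)
  qed
qed

section \<open>Smooth functions and convolution with test functions\<close>

lemma Ck_continuous: "Ck m f \<Longrightarrow> continuous_on A f"
proof (cases m)
  case 0
  then show "Ck m f \<Longrightarrow> continuous_on A f" by (auto intro: continuous_on_subset)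
next
  case (Suc k)
  then show "Ck m f \<Longrightarrow> continuous_on A f"
    by (auto intro!: continuous_at_imp_continuous_on differentiable_imp_continuous_within)
qed

lemma Ck_Suc_imp_Ck: "Ck (Suc m) f \<Longrightarrow> Ck m f"
proof (induction m arbitrary: f)
  case 0
  then show ?case using Ck_continuous[of "Suc 0" f UNIV] by simp
next
  case (Suc m)
  then show ?case by simp
qed

lemma sum_axis: "(\<Sum>i\<in>UNIV. v $ i *\<^sub>R axis i (1::real)) = (v::real^'n::finite)"
  by (simp add: vec_eq_iff axis_def if_distrib cong: if_cong)

lemma has_derivative_partial:
  assumes "f differentiable (at x)"
  shows "(f has_derivative (\<lambda>v. \<Sum>i\<in>UNIV. v $ i * partial i f x)) (at x)"
proof -
  have d: "(f has_derivative frechet_derivative f (at x)) (at x)"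
    using assms by (simp add: frechet_derivative_works)
  then have l: "linear (frechet_derivative f (at x))" by (rule has_derivative_linear)
  have "frechet_derivative f (at x) v = (\<Sum>i\<in>UNIV. v $ i * partial i f x)" for v
  proof -
    have "frechet_derivative f (at x) v = frechet_derivative f (at x) (\<Sum>i\<in>UNIV. v $ i *\<^sub>R axis i 1)"
      by (simp add: sum_axis)
    also have "\<dots> = (\<Sum>i\<in>UNIV. v $ i * partial i f x)"
      using l by (simp add: linear_sum linear_cmul partial_def)
    finally show ?thesis .
  qed
  then have "frechet_derivative f (at x) = (\<lambda>v. \<Sum>i\<in>UNIV. v $ i * partial i f x)" by (rule ext)
  then show ?thesis using d by simp
qed

lemma partial_eqI:
  assumes "(f has_derivative f') (at x)"
  shows "partial i f x = f' (axis i 1)"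
  using assms by (metis frechet_derivative_at partial_def)

lemma Ck_add: "Ck m f \<Longrightarrow> Ck m g \<Longrightarrow> Ck m (\<lambda>x. f x + g x)"
proof (induction m arbitrary: f g)
  case (Suc m)
  have "partial i (\<lambda>x. f x + g x) = (\<lambda>x. partial i f x + partial i g x)" for i
  proof
    fix x
    have "f differentiable (at x)" "g differentiable (at x)" using Suc.prems by auto
    then show "partial i (\<lambda>x. f x + g x) x = partial i f x + partial i g x"
      by (subst partial_eqI[OF has_derivative_add[OF frechet_derivative_works[THEN iffD1] frechet_derivative_works[THEN iffD1]]])
        (auto simp: partial_def)
  qed
  then show ?case using Suc by auto
qed (auto intro: continuous_intros)

lemma partial_mult:
  assumes "f differentiable (at x)" "g differentiable (at x)"
  shows "partial i (\<lambda>x. f x * g x) x = f x * partial i g x + partial i f x * g x"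
  using assms
  by (subst partial_eqI[OF has_derivative_mult[OF frechet_derivative_works[THEN iffD1] frechet_derivative_works[THEN iffD1]]])
    (auto simp: partial_def)

lemma Ck_mult: "Ck m f \<Longrightarrow> Ck m g \<Longrightarrow> Ck m (\<lambda>x. f x * g x)"
proof (induction m arbitrary: f g)
  case (Suc m)
  have "partial i (\<lambda>x. f x * g x) = (\<lambda>x. f x * partial i g x + partial i f x * g x)" for i
    using Suc.prems by (intro ext partial_mult) auto
  then show ?case using Suc Ck_Suc_imp_Ck[OF Suc.prems(1)] Ck_Suc_imp_Ck[OF Suc.prems(2)]
    by (auto intro!: Ck_add)
qed (auto intro: continuous_intros)

lemma partial_const: "partial i (\<lambda>x. c) x = 0"
  using partial_eqI[OF has_derivative_const] .

lemma Ck_const: "Ck m (\<lambda>x. c)"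
proof (induction m arbitrary: c)
  case (Suc m)
  have "partial i (\<lambda>x. c) = (\<lambda>x. 0)" for i by (simp add: fun_eq_iff partial_const)
  then show ?case using Suc by simp
qed auto

lemma Ck_minus: "Ck m f \<Longrightarrow> Ck m (\<lambda>x. - f x)"
  using Ck_mult[OF Ck_const[of m "-1"], of f] by simp

lemma Ck_reflect: "Ck m f \<Longrightarrow> Ck m (\<lambda>y. f (x - y))"
  and partial_reflect: "f differentiable (at (x - y)) \<Longrightarrow> partial i (\<lambda>y. f (x - y)) y = - partial i f (x - y)"
proof -
  have 1: "((\<lambda>y. f (x - y)) has_derivative (\<lambda>h. frechet_derivative f (at (x - y)) (- h))) (at y)"
    if "f differentiable (at (x - y))" for f and y :: "real^3"
  proof -
    have "((\<lambda>y. x - y) has_derivative (\<lambda>h. - h)) (at y)"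
      by (auto intro!: derivative_eq_intros)
    then show ?thesis
      using has_derivative_compose[of "\<lambda>y. x - y" "\<lambda>h. - h" y UNIV f] that
      by (simp add: frechet_derivative_works)
  qed
  have 2: "partial i (\<lambda>y. f (x - y)) y = - partial i f (x - y)" if "f differentiable (at (x - y))" for f i y
    using partial_eqI[OF 1[OF that], of i] linear_neg[OF linear_frechet_derivative[OF that], of "axis i 1"]
    by (simp add: partial_def)
  then show "f differentiable (at (x - y)) \<Longrightarrow> partial i (\<lambda>y. f (x - y)) y = - partial i f (x - y)" .
  show "Ck m f \<Longrightarrow> Ck m (\<lambda>y. f (x - y))"
  proof (induction m arbitrary: f)
    case 0
    then show ?case by (auto intro!: continuous_on_compose2[of UNIV f] continuous_intros)
  next
    case (Suc m)
    have "partial i (\<lambda>y. f (x - y)) = (\<lambda>y. - partial i f (x - y))" for i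
      using Suc.prems 2[of f] by (auto simp: fun_eq_iff)
    then show ?case using Suc 1[of f] by (auto simp: differentiable_def intro!: Ck_minus)
  qed
qed

lemma smooth_mult: "smooth f \<Longrightarrow> smooth g \<Longrightarrow> smooth (\<lambda>x. f x * g x)"
  by (simp add: smooth_def Ck_mult)

lemma smooth_sum: "(\<And>i. i \<in> I \<Longrightarrow> smooth (f i)) \<Longrightarrow> smooth (\<lambda>x. \<Sum>i\<in>I. f i x)"
  by (induction I rule: infinite_finite_induct) (auto simp: smooth_def Ck_const intro: Ck_add)

lemma smooth_const: "smooth (\<lambda>x. c)" by (simp add: smooth_def Ck_const)

lemma smooth_diff: "smooth f \<Longrightarrow> smooth g \<Longrightarrow> smooth (\<lambda>x. f x - g x)"
  using Ck_add[of _ f "\<lambda>x. - g x"] Ck_minus[of _ g] by (simp add: smooth_def)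

lemma smooth_partial: "smooth f \<Longrightarrow> smooth (partial i f)"
  unfolding smooth_def using Ck.simps(2) by blast

lemma smooth_differentiable: "smooth f \<Longrightarrow> f differentiable (at x)"
  by (auto simp: smooth_def dest!: spec[of _ "Suc 0"])

lemma smooth_continuous: "smooth f \<Longrightarrow> continuous_on A f"
  by (auto simp: smooth_def intro: Ck_continuous)

lemma smooth_borel: "smooth f \<Longrightarrow> f \<in> borel_measurable borel"
  by (intro borel_measurable_continuous_onI smooth_continuous)

lemma partial_diff:
  assumes "f differentiable (at x)" "g differentiable (at x)"
  shows "partial i (\<lambda>x. f x - g x) x = partial i f x - partial i g x"
  using assms
  by (subst partial_eqI[OF has_derivative_diff[OF frechet_derivative_works[THEN iffD1] frechet_derivative_works[THEN iffD1]]])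
    (auto simp: partial_def)

lemma test_function_smooth: "test_function \<eta> \<Longrightarrow> smooth \<eta>" by (simp add: test_function_def)

lemma test_function_partial:
  assumes "test_function \<eta>" shows "test_function (partial i \<eta>)"
proof -
  obtain K where K: "compact K" "\<And>x. x \<notin> K \<Longrightarrow> \<eta> x = 0" using assms by (auto simp: test_function_def)
  have "partial i \<eta> x = 0" if x: "x \<notin> K" for x
  proof -
    have "(\<eta> has_derivative (\<lambda>h. 0)) (at x)"
      by (rule has_derivative_transform_within_open[of "\<lambda>_. 0" _ _ _ "- K"])
        (use K x in \<open>auto simp: compact_imp_closed open_Compl\<close>)
    then show ?thesis by (simp add: partial_eqI)
  qed
  then show ?thesis using assms K(1) by (auto simp: test_function_def intro: smooth_partial)
qed

lemma test_function_reflect: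
  assumes "test_function \<eta>" shows "test_function (\<lambda>y. \<eta> (x - y))"
proof -
  obtain K where K: "compact K" "\<And>x. x \<notin> K \<Longrightarrow> \<eta> x = 0" using assms by (auto simp: test_function_def)
  have "compact ((\<lambda>z. x - z) ` K)" by (intro compact_continuous_image continuous_intros K)
  moreover have "\<eta> (x - y) = 0" if "y \<notin> (\<lambda>z. x - z) ` K" for y
    using that by (intro K) (auto simp: image_iff dest: bspec[of _ _ "x - y"])
  ultimately show ?thesis
    using assms by (auto simp: test_function_def smooth_def intro: Ck_reflect)
qed

lemma test_function_bounded:
  assumes "test_function \<eta>"
  obtains B R where "\<And>x. \<bar>\<eta> x\<bar> \<le> B" "B > 0" "R > 0" "\<And>x. norm x > R \<Longrightarrow> \<eta> x = 0"
proof -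
  obtain K where K: "compact K" "\<And>x. x \<notin> K \<Longrightarrow> \<eta> x = 0" using assms by (auto simp: test_function_def)
  have cK: "compact (\<eta> ` K)"
    using assms by (intro compact_continuous_image K(1) smooth_continuous test_function_smooth)
  then obtain B where B: "B > 0" "\<And>x. x \<in> K \<Longrightarrow> \<bar>\<eta> x\<bar> \<le> B"
    using compact_imp_bounded[OF cK] by (auto simp: bounded_pos)
  obtain R where R: "R > 0" "\<And>x. x \<in> K \<Longrightarrow> norm x \<le> R"
    using compact_imp_bounded[OF K(1)] by (auto simp: bounded_pos)
  show thesis
  proof (rule that[of B R])
    show "\<bar>\<eta> x\<bar> \<le> B" for x using B K(2)[of x] by (cases "x \<in> K") auto
    show "\<eta> x = 0" if "norm x > R" for x using that R(2)[of x] K(2)[of x] by force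
  qed (use B R in auto)
qed

lemma test_function_lipschitz:
  assumes "test_function \<eta>"
  obtains L where "L > 0" "\<And>x y. \<bar>\<eta> x - \<eta> y\<bar> \<le> L * norm (x - y)"
proof -
  have "\<exists>B>0. \<forall>x. \<bar>partial i \<eta> x\<bar> \<le> B" for i
    using test_function_bounded[OF test_function_partial[OF assms, of i]] by metis
  then obtain B where B: "\<And>i. B i > 0" "\<And>i x. \<bar>partial i \<eta> x\<bar> \<le> B i" by metis
  define L where "L = (\<Sum>i\<in>UNIV. B i)"
  have L: "L > 0" unfolding L_def using B by (intro sum_pos) auto
  have "\<bar>\<eta> x - \<eta> y\<bar> \<le> L * norm (x - y)" for x y
  proof -
    have "norm (\<eta> x - \<eta> y) \<le> L * norm (x - y)"
    proof (rule differentiable_bound[where S = UNIV])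
      fix z
      show "(\<eta> has_derivative (\<lambda>v. \<Sum>i\<in>UNIV. v $ i * partial i \<eta> z)) (at z within UNIV)"
        using has_derivative_partial assms by (auto intro: smooth_differentiable test_function_smooth)
      show "onorm (\<lambda>v. \<Sum>i\<in>UNIV. v $ i * partial i \<eta> z) \<le> L"
      proof (rule onorm_le)
        fix v :: "real^3"
        have "\<bar>\<Sum>i\<in>UNIV. v $ i * partial i \<eta> z\<bar> \<le> (\<Sum>i\<in>UNIV. norm v * B i)"
          by (intro order_trans[OF sum_abs] sum_mono) (auto simp: abs_mult intro!: mult_mono component_le_norm_cart B)
        then show "norm (\<Sum>i\<in>UNIV. v $ i * partial i \<eta> z) \<le> L * norm v"
          by (simp add: L_def sum_distrib_left mult.commute)
      qed
    qed auto
    then show ?thesis by simp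
  qed
  with L show thesis by (rule that)
qed

lemma locally_L1_mult_test:
  assumes f: "locally_L1 f" and \<eta>: "test_function \<eta>"
  shows "integrable lborel (\<lambda>x. f x * \<eta> x)"
proof -
  obtain B R where B: "\<And>x. \<bar>\<eta> x\<bar> \<le> B" "B > 0" "R > 0" "\<And>x. norm x > R \<Longrightarrow> \<eta> x = 0"
    using test_function_bounded[OF \<eta>] by blast
  have fR: "integrable lborel (\<lambda>x. indicator (cball 0 R) x * f x)"
    using f by (auto simp: locally_L1_def set_integrable_def)
  have [measurable]: "\<eta> \<in> borel_measurable borel"
    using \<eta> by (intro smooth_borel test_function_smooth)
  have "integrable lborel (\<lambda>x. (indicator (cball 0 R) x * f x) * \<eta> x)"
  proof (rule Bochner_Integration.integrable_bound[where f = "\<lambda>x. B * (indicator (cball 0 R) x * f x)"])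
    show "AE x in lborel. norm (indicator (cball 0 R) x * f x * \<eta> x) \<le> norm (B * (indicator (cball 0 R) x * f x))"
      using B(2) by (intro AE_I2) (simp add: abs_mult mult.commute[of B] mult_left_mono[OF B(1)])
  qed (use fR in auto)
  also have "(\<lambda>x. (indicator (cball 0 R) x * f x) * \<eta> x) = (\<lambda>x. f x * \<eta> x)"
    using B(4) by (auto simp: fun_eq_iff indicator_def not_le)
  finally show ?thesis .
qed

definition conv :: "(real^3 \<Rightarrow> real) \<Rightarrow> (real^3 \<Rightarrow> real) \<Rightarrow> real^3 \<Rightarrow> real" where
  "conv f \<eta> x = (LINT y|lborel. f y * \<eta> (x - y))"

text \<open>Differentiation under the integral, by dominated convergence along an arbitrary sequence of
  increments: the difference quotients of \<open>\<eta>\<close> are bounded by its Lipschitz constant, and for small increments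
  they vanish outside a fixed ball.\<close>

lemma conv_has_derivative:
  assumes f: "locally_L1 f" and \<eta>: "test_function \<eta>"
  shows "(conv f \<eta> has_derivative (\<lambda>v. \<Sum>i\<in>UNIV. v $ i * conv f (partial i \<eta>) x)) (at x)"
proof -
  obtain R where R: "R > 0" "\<And>x. norm x > R \<Longrightarrow> \<eta> x = 0" using test_function_bounded[OF \<eta>] by metis
  obtain L where L: "L > 0" "\<And>x y. \<bar>\<eta> x - \<eta> y\<bar> \<le> L * norm (x - y)" using test_function_lipschitz[OF \<eta>] by metis
  have int: "integrable lborel (\<lambda>y. f y * \<eta> (x - y))" for x
    by (rule locally_L1_mult_test[OF f test_function_reflect[OF \<eta>]])
  have intp: "integrable lborel (\<lambda>y. f y * partial i \<eta> (x - y))" for x i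
    by (rule locally_L1_mult_test[OF f test_function_reflect[OF test_function_partial[OF \<eta>]]])
  have dif: "\<eta> differentiable (at z)" for z using \<eta> by (intro smooth_differentiable test_function_smooth)
  let ?D = "\<lambda>z v. \<Sum>i\<in>UNIV. v $ i * partial i \<eta> z"
  have bl: "bounded_linear (\<lambda>v. \<Sum>i\<in>UNIV. v $ i * c i)" for c :: "3 \<Rightarrow> real"
    by (intro bounded_linear_sum bounded_linear_mult_const bounded_linear_vec_nth)
  have lim: "((\<lambda>h. (conv f \<eta> (x + h) - conv f \<eta> x - (\<Sum>i\<in>UNIV. h $ i * conv f (partial i \<eta>) x)) /\<^sub>R norm h) \<longlongrightarrow> 0) (at 0)"
  proof (subst tendsto_at_iff_sequentially, intro allI impI)
    fix h :: "nat \<Rightarrow> real^3"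
    assume h0: "\<forall>n. h n \<in> UNIV - {0}" and hl: "h \<longlonglongrightarrow> 0"
    have hn: "h n \<noteq> 0" for n using h0 by simp
    obtain Bp where Bp: "Bp > 0" "\<And>i z. \<bar>partial i \<eta> z\<bar> \<le> Bp"
    proof -
      have "\<exists>B>0. \<forall>x. \<bar>partial i \<eta> x\<bar> \<le> B" for i
        using test_function_bounded[OF test_function_partial[OF \<eta>, of i]] by metis
      then obtain B where B: "\<And>i. B i > 0" "\<And>i x. \<bar>partial i \<eta> x\<bar> \<le> B i" by metis
      have "B i \<le> (\<Sum>i\<in>UNIV. B i)" for i by (rule member_le_sum) (use B in \<open>auto simp: less_imp_le\<close>)
      moreover have "(\<Sum>i\<in>UNIV. B i) > 0" using B by (intro sum_pos) auto
      ultimately show ?thesis using B that by (meson order_trans)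
    qed
    \<comment> \<open>the integrand of the difference quotient minus the candidate derivative\<close>
    define g where "g n y = f y * ((\<eta> (x + h n - y) - \<eta> (x - y) - ?D (x - y) (h n)) / norm (h n))" for n y
    have eq: "(conv f \<eta> (x + h n) - conv f \<eta> x - (\<Sum>i\<in>UNIV. h n $ i * conv f (partial i \<eta>) x)) /\<^sub>R norm (h n)
        = (LINT y|lborel. g n y)" for n
    proof -
      have "(LINT y|lborel. g n y) = (LINT y|lborel. (f y * \<eta> (x + h n - y) - f y * \<eta> (x - y)
          - (\<Sum>i\<in>UNIV. h n $ i * (f y * partial i \<eta> (x - y)))) / norm (h n))"
        by (intro Bochner_Integration.integral_cong) (auto simp: g_def field_simps sum_distrib_left)
      also have "\<dots> = ((LINT y|lborel. f y * \<eta> (x + h n - y)) - (LINT y|lborel. f y * \<eta> (x - y))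
          - (\<Sum>i\<in>UNIV. h n $ i * (LINT y|lborel. f y * partial i \<eta> (x - y)))) / norm (h n)"
        using int intp by (simp add: Bochner_Integration.integral_sum)
      finally show ?thesis by (simp add: conv_def divide_inverse_commute)
    qed
    have hb: "\<forall>\<^sub>F n in sequentially. norm (h n) < 1"
      using hl by (metis order_tendstoD(2) tendsto_norm_zero zero_less_one)
    then obtain N where N: "\<And>n. n \<ge> N \<Longrightarrow> norm (h n) < 1" by (auto simp: eventually_sequentially)
    have iw: "integrable lborel (\<lambda>y. indicator (cball x (R + 1)) y * f y)"
      using f by (auto simp: locally_L1_def set_integrable_def)
    have gm: "g n \<in> borel_measurable lborel" for n
    proof -
      have "integrable lborel (g n)"
      proof -
        have "integrable lborel (\<lambda>y. (f y * \<eta> (x + h n - y) - f y * \<eta> (x - y)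
          - (\<Sum>i\<in>UNIV. h n $ i * (f y * partial i \<eta> (x - y)))) / norm (h n))"
          using int intp by auto
        then show ?thesis
          by (rule Bochner_Integration.integrable_cong[THEN iffD1, rotated -1])
            (auto simp: g_def field_simps sum_distrib_left)
      qed
      then show ?thesis by auto
    qed
    have "(\<lambda>n. LINT y|lborel. g (n + N) y) \<longlonglongrightarrow> (LINT y|(lborel::(real^3) measure). (0::real))"
    proof (rule integral_dominated_convergence[where w = "\<lambda>y. (L + 3 * Bp) * \<bar>indicator (cball x (R + 1)) y * f y\<bar>"])
      show "AE y in lborel. (\<lambda>n. g (n + N) y) \<longlonglongrightarrow> 0"
      proof (rule AE_I2)
        fix y
        have "((\<lambda>k. (\<eta> ((x - y) + k) - \<eta> (x - y) - ?D (x - y) k) /\<^sub>R norm k) \<longlongrightarrow> 0) (at 0)"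
          using has_derivative_partial[OF dif, of "x - y"]
          by (intro tendsto_norm_zero_cancel[where f = "\<lambda>k. (\<eta> ((x - y) + k) - \<eta> (x - y) - ?D (x - y) k) /\<^sub>R norm k"])
            (simp add: has_derivative_at abs_mult divide_inverse_commute)
        then have "(\<lambda>n. (\<eta> ((x - y) + h n) - \<eta> (x - y) - ?D (x - y) (h n)) /\<^sub>R norm (h n)) \<longlonglongrightarrow> 0"
          using hl hn by (auto simp: tendsto_at_iff_sequentially comp_def)
        then have "(\<lambda>n. f y * ((\<eta> ((x - y) + h n) - \<eta> (x - y) - ?D (x - y) (h n)) /\<^sub>R norm (h n))) \<longlonglongrightarrow> f y * 0"
          by (intro tendsto_intros)
        then have "(\<lambda>n. g n y) \<longlonglongrightarrow> 0"
          by (simp add: g_def divide_inverse_commute algebra_simps)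
        then show "(\<lambda>n. g (n + N) y) \<longlonglongrightarrow> 0" by (rule LIMSEQ_ignore_initial_segment)
      qed
      show "AE y in lborel. norm (g (n + N) y) \<le> (L + 3 * Bp) * \<bar>indicator (cball x (R + 1)) y * f y\<bar>" for n
      proof (rule AE_I2)
        fix y
        define m where "m = n + N"
        have m: "norm (h m) < 1" using N by (simp add: m_def)
        show "norm (g (n + N) y) \<le> (L + 3 * Bp) * \<bar>indicator (cball x (R + 1)) y * f y\<bar>"
        proof (cases "y \<in> cball x (R + 1)")
          case True
          have 1: "\<bar>\<eta> (x + h m - y) - \<eta> (x - y)\<bar> \<le> L * norm (h m)"
            using L(2)[of "x + h m - y" "x - y"] by simp
          have 2: "\<bar>?D (x - y) (h m)\<bar> \<le> (\<Sum>i\<in>(UNIV::3 set). norm (h m) * Bp)"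
            by (intro order_trans[OF sum_abs] sum_mono) (auto simp: abs_mult intro!: mult_mono component_le_norm_cart Bp)
          then have "\<bar>?D (x - y) (h m)\<bar> \<le> 3 * Bp * norm (h m)" by (simp add: mult_ac)
          with 1 have "\<bar>\<eta> (x + h m - y) - \<eta> (x - y) - ?D (x - y) (h m)\<bar> \<le> (L + 3 * Bp) * norm (h m)"
            unfolding distrib_right by linarith
          then have "\<bar>\<eta> (x + h m - y) - \<eta> (x - y) - ?D (x - y) (h m)\<bar> / norm (h m) \<le> L + 3 * Bp"
            using hn[of m] by (simp add: pos_divide_le_eq)
          then have "\<bar>f y\<bar> * (\<bar>\<eta> (x + h m - y) - \<eta> (x - y) - ?D (x - y) (h m)\<bar> / norm (h m)) \<le> \<bar>f y\<bar> * (L + 3 * Bp)"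
            by (intro mult_left_mono) auto
          then show ?thesis using True unfolding g_def m_def[symmetric]
            by (simp add: abs_mult mult.commute[of _ "\<bar>f y\<bar>"])
        next
          case False
          then have far: "norm (x - y) > R + 1" by (simp add: dist_norm)
          have "norm (x - y) \<le> norm (x + h m - y) + norm (h m)"
            using norm_triangle_ineq4[of "x + h m - y" "h m"] by simp
          then have "\<eta> (x + h m - y) = 0" "\<eta> (x - y) = 0" using far m by (auto intro!: R)
          moreover have "partial i \<eta> (x - y) = 0" for i
          proof -
            have "(\<eta> has_derivative (\<lambda>h. 0)) (at (x - y))"
              by (rule has_derivative_transform_within_open[of "\<lambda>_. 0" _ _ _ "- cball 0 R"])
                (use R far in \<open>auto simp: open_Compl\<close>)
            then show ?thesis by (simp add: partial_eqI)
          qed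
          ultimately show ?thesis using False by (simp add: g_def m_def[symmetric])
        qed
      qed
      show "integrable lborel (\<lambda>y. (L + 3 * Bp) * \<bar>indicator (cball x (R + 1)) y * f y\<bar>)"
        using iw by auto
    qed (use gm in auto)
    then have "(\<lambda>n. LINT y|lborel. g (n + N) y) \<longlonglongrightarrow> 0" by simp
    then have "(\<lambda>n. LINT y|lborel. g n y) \<longlonglongrightarrow> 0" by (rule LIMSEQ_offset)
    then show "((\<lambda>h. (conv f \<eta> (x + h) - conv f \<eta> x - (\<Sum>i\<in>UNIV. h $ i * conv f (partial i \<eta>) x)) /\<^sub>R norm h) \<circ> h) \<longlonglongrightarrow> 0"
      by (simp only: comp_def eq)
  qed
  then show ?thesis unfolding has_derivative_at using bl tendsto_norm_zero[OF lim]
    by (simp add: abs_mult divide_inverse_commute)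
qed

lemma partial_conv:
  assumes "locally_L1 f" "test_function \<eta>"
  shows "partial i (conv f \<eta>) = conv f (partial i \<eta>)"
proof
  fix x
  show "partial i (conv f \<eta>) x = conv f (partial i \<eta>) x"
    unfolding partial_eqI[OF conv_has_derivative[OF assms]]
    by (simp add: axis_def if_distrib[where f = "\<lambda>t. t * _"] cong: if_cong)
qed

lemma smooth_conv:
  assumes f: "locally_L1 f" and \<eta>: "test_function \<eta>"
  shows "smooth (conv f \<eta>)"
proof -
  have diff: "conv f \<eta> differentiable (at x)" if "test_function \<eta>" for x \<eta>
    using conv_has_derivative[OF f that] by (auto simp: differentiable_def)
  have "Ck m (conv f \<eta>)" if "test_function \<eta>" for m \<eta>
    using that
  proof (induction m arbitrary: \<eta>)
    case 0
    then show ?case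
      by (auto intro!: continuous_at_imp_continuous_on differentiable_imp_continuous_within diff)
  next
    case (Suc m)
    then show ?case using diff by (simp add: partial_conv[OF f] test_function_partial)
  qed
  then show ?thesis using \<eta> by (simp add: smooth_def)
qed

text \<open>For fixed \<open>x\<close> the function \<open>\<eta> (x - y)\<close> of \<open>y\<close> is a test function. The reflection changes the sign of its
  partial derivative, which cancels the sign in the definition of the weak derivative.\<close>

lemma conv_weak_partial:
  assumes w: "weak_partial i f w" and \<eta>: "test_function \<eta>"
  shows "conv f (partial i \<eta>) = conv w \<eta>"
proof
  fix x
  have "partial i (\<lambda>y. \<eta> (x - y)) y = - partial i \<eta> (x - y)" for y
    by (intro partial_reflect smooth_differentiable test_function_smooth \<eta>)
  moreover have "(LINT y|lborel. f y * partial i (\<lambda>y. \<eta> (x - y)) y) = - (LINT y|lborel. w y * \<eta> (x - y))"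
    using w test_function_reflect[OF \<eta>, of x] by (auto simp: weak_partial_def)
  ultimately show "conv f (partial i \<eta>) x = conv w \<eta> x" by (simp add: conv_def)
qed

lemma partial_conv_weak:
  assumes w: "weak_partial i f w" and \<eta>: "test_function \<eta>"
  shows "partial i (conv f \<eta>) = conv w \<eta>"
  using partial_conv[OF _ \<eta>] conv_weak_partial[OF w \<eta>] w by (auto simp: weak_partial_def)

section \<open>Mollification in the space of square integrable functions\<close>

lemma emeasure_lborel_compact: "compact K \<Longrightarrow> emeasure lborel K < top"
  using emeasure_compact_finite[of K] by simp

lemma L2_locally_L1:
  assumes "u \<in> L2" shows "locally_L1 u"
  unfolding locally_L1_def
proof (intro allI impI)
  fix K :: "(real^3) set" assume K: "compact K"
  have [measurable]: "u \<in> borel_measurable borel" using assms by (simp add: L2_def)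
  have [measurable]: "K \<in> sets borel" using K by (simp add: compact_imp_closed)
  have "integrable lborel (\<lambda>x. indicator K x + (u x)\<^sup>2)"
    using assms K by (intro Bochner_Integration.integrable_add integrable_real_indicator) (auto simp: L2_def emeasure_lborel_compact)
  then show "set_integrable lborel K u"
    unfolding set_integrable_def
  proof (rule Bochner_Integration.integrable_bound)
    show "AE x in lborel. norm (indicator K x *\<^sub>R u x) \<le> norm (indicator K x + (u x)\<^sup>2)"
    proof (rule AE_I2)
      fix x
      have "\<bar>u x\<bar> \<le> 1 + (u x)\<^sup>2"
        using zero_le_power2[of "\<bar>u x\<bar> - 1"] by (simp add: power2_eq_square algebra_simps)
      then show "norm (indicator K x *\<^sub>R u x) \<le> norm (indicator K x + (u x)\<^sup>2)"
        by (auto simp: indicator_def)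
    qed
  qed measurable
qed

text \<open>The map \<open>a \<mapsto> a \<bar>a\<bar>\<close> carries \<open>L\<^sup>2\<close> to \<open>L\<^sup>1\<close>, and by this inequality it controls squared differences. It
  transfers continuity of translations from \<open>L\<^sup>1\<close> to \<open>L\<^sup>2\<close>.\<close>

lemma abs_diff_square_le:
  fixes a b :: real shows "(a - b)\<^sup>2 \<le> 2 * \<bar>a * \<bar>a\<bar> - b * \<bar>b\<bar>\<bar>"
proof -
  have *: "(a - b)\<^sup>2 \<le> 2 * \<bar>a * \<bar>a\<bar> - b * \<bar>b\<bar>\<bar>" if "\<bar>b\<bar> \<le> \<bar>a\<bar>" "a \<ge> 0" for a b :: real
  proof (cases "b \<ge> 0")
    case True
    have "(a - b) * (a - b) \<le> (a - b) * (a + b)" using that True by (intro mult_left_mono) auto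
    moreover have "(a - b) * (a + b) \<ge> 0" using that True by auto
    ultimately show ?thesis using that True by (simp add: power2_eq_square algebra_simps)
  next
    case False
    have "0 \<le> (a + b)\<^sup>2" by simp
    moreover have "a * \<bar>a\<bar> - b * \<bar>b\<bar> = a\<^sup>2 + b\<^sup>2" using that False by (simp add: power2_eq_square)
    ultimately show ?thesis by (simp add: power2_diff power2_sum)
  qed
  show ?thesis
  proof (cases "\<bar>b\<bar> \<le> \<bar>a\<bar>")
    case True
    then show ?thesis using *[of b a] *[of "-b" "-a"] by (cases "a \<ge> 0") (auto simp: power2_commute abs_minus_commute add.commute)
  next
    case False
    then show ?thesis using *[of a b] *[of "-a" "-b"]
      by (cases "b \<ge> 0") (auto simp: power2_commute[of a] abs_minus_commute add.commute)
  qed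
qed

lemma L2_translation_continuous:
  assumes f: "f \<in> L2" and e: "e > 0"
  obtains d where "d > 0" "\<And>z. norm z < d \<Longrightarrow> (\<integral>\<^sup>+ x. ennreal ((f (x + z) - f x)\<^sup>2) \<partial>lborel) \<le> ennreal e"
proof -
  have [measurable]: "f \<in> borel_measurable borel" using f by (simp add: L2_def)
  \<comment> \<open>an integrable function whose \<open>L\<^sup>1\<close> translation error bounds the \<open>L\<^sup>2\<close> translation error of \<open>f\<close>\<close>
  define h where "h x = f x * \<bar>f x\<bar>" for x
  have h: "integrable lborel h"
  proof (rule Bochner_Integration.integrable_bound)
    show "integrable lborel (\<lambda>x. (f x)\<^sup>2)" using f by (simp add: L2_def)
    show "AE x in lborel. norm (h x) \<le> norm ((f x)\<^sup>2)"
      by (intro AE_I2) (simp add: h_def abs_mult power2_eq_square)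
  qed (simp_all add: h_def[abs_def])
  have [measurable]: "h \<in> borel_measurable borel" using h by auto
  have hz: "integrable lborel (\<lambda>x. h (x + z))" for z by (rule integrable_translation[OF h])
  have le: "(\<integral>\<^sup>+ x. ennreal ((f (x + z) - f x)\<^sup>2) \<partial>lborel) \<le> ennreal (2 * (LINT x|lborel. \<bar>h (x + z) - h x\<bar>))" for z
  proof -
    have "(\<integral>\<^sup>+ x. ennreal ((f (x + z) - f x)\<^sup>2) \<partial>lborel) \<le> (\<integral>\<^sup>+ x. ennreal (2 * \<bar>h (x + z) - h x\<bar>) \<partial>lborel)"
      unfolding h_def by (intro nn_integral_mono ennreal_leI abs_diff_square_le)
    also have "\<dots> = ennreal (LINT x|lborel. 2 * \<bar>h (x + z) - h x\<bar>)"
      using h hz by (intro nn_integral_eq_integral) auto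
    finally show ?thesis by simp
  qed
  have "\<exists>d>0. \<forall>z. norm z < d \<longrightarrow> (LINT x|lborel. \<bar>h (x + z) - h x\<bar>) \<le> e / 2"
  proof (rule ccontr)
    assume "\<not> ?thesis"
    then have "\<forall>d>0. \<exists>z. norm z < d \<and> (LINT x|lborel. \<bar>h (x + z) - h x\<bar>) > e / 2" by force
    then have "\<forall>n. \<exists>z. norm z < 1 / real (Suc n) \<and> (LINT x|lborel. \<bar>h (x + z) - h x\<bar>) > e / 2"
      by (auto simp del: of_nat_Suc)
    then obtain z where z: "\<And>n. norm (z n) < 1 / real (Suc n)"
      "\<And>n. (LINT x|lborel. \<bar>h (x + z n) - h x\<bar>) > e / 2" by metis
    have "z \<longlonglongrightarrow> 0"
      using z(1) LIMSEQ_inverse_real_of_nat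
      by (intro Lim_null_comparison[of z "\<lambda>n. inverse (real (Suc n))"]) (auto simp: inverse_eq_divide less_imp_le)
    then have "(\<lambda>n. LINT x|lborel. \<bar>h (x + z n) - h x\<bar>) \<longlonglongrightarrow> 0"
      by (rule translation_continuous_L1[OF h])
    then have "\<forall>\<^sub>F n in sequentially. (LINT x|lborel. \<bar>h (x + z n) - h x\<bar>) < e / 2"
      using e by (intro order_tendstoD) auto
    then obtain n where "(LINT x|lborel. \<bar>h (x + z n) - h x\<bar>) < e / 2" by (auto simp: eventually_sequentially)
    with z(2)[of n] show False by simp
  qed
  then obtain d where d: "d > 0" "\<And>z. norm z < d \<Longrightarrow> (LINT x|lborel. \<bar>h (x + z) - h x\<bar>) \<le> e / 2" by blast
  show thesis
  proof (rule that[OF d(1)])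
    fix z :: "real^3" assume "norm z < d"
    then show "(\<integral>\<^sup>+ x. ennreal ((f (x + z) - f x)\<^sup>2) \<partial>lborel) \<le> ennreal e"
      using d(2)[of z] by (intro order_trans[OF le] ennreal_leI) auto
  qed
qed

text \<open>Since \<open>\<rho>\<close> is a probability density, \<open>conv f \<rho> x - f x\<close> is an average of \<open>f (x + z) - f x\<close>. The
  Cauchy-Schwarz inequality moves the square inside the average, and Tonelli's theorem leaves an average of
  squared translation errors.\<close>

lemma conv_L2_estimate:
  assumes f: "f \<in> L2" and \<rho>: "test_function \<rho>" and pos: "\<And>z. \<rho> z \<ge> 0" and even: "\<And>z. \<rho> (- z) = \<rho> z"
    and one: "(LINT z|lborel. \<rho> z) = 1"
    and supp: "\<And>z. norm z \<ge> d \<Longrightarrow> \<rho> z = 0"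
    and tr: "\<And>z. norm z < d \<Longrightarrow> (\<integral>\<^sup>+ x. ennreal ((f (x + z) - f x)\<^sup>2) \<partial>lborel) \<le> e"
  shows "(\<integral>\<^sup>+ x. ennreal ((conv f \<rho> x - f x)\<^sup>2) \<partial>lborel) \<le> e"
proof -
  have [measurable]: "f \<in> borel_measurable borel" using f by (simp add: L2_def)
  have [measurable]: "\<rho> \<in> borel_measurable borel" using \<rho> by (intro smooth_borel test_function_smooth)
  have L: "locally_L1 f" by (rule L2_locally_L1[OF f])
  have i\<rho>: "integrable lborel \<rho>" by (rule ccontr) (use one not_integrable_integral_eq in force)
  have nn1: "(\<integral>\<^sup>+ z. ennreal (\<rho> z) \<partial>lborel) = 1"
    using i\<rho> pos one by (subst nn_integral_eq_integral) auto
  have pw: "ennreal ((conv f \<rho> x - f x)\<^sup>2) \<le> (\<integral>\<^sup>+ z. ennreal (\<rho> z) * ennreal ((f (x + z) - f x)\<^sup>2) \<partial>lborel)" for x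
  proof -
    have c1: "conv f \<rho> x = (LINT z|lborel. f (x + z) * \<rho> z)"
    proof -
      have "conv f \<rho> x = (LINT y|lborel. f y * \<rho> (y - x))"
        unfolding conv_def using even by (metis minus_diff_eq)
      also have "\<dots> = (LINT z|lborel. f (z + x) * \<rho> (z + x - x))"
        by (rule integral_translation[symmetric, where f = "\<lambda>y. f y * \<rho> (y - x)"]) simp
      finally show ?thesis by (simp add: add.commute)
    qed
    have i1: "integrable lborel (\<lambda>z. f (x + z) * \<rho> z)"
    proof -
      have "integrable lborel (\<lambda>y. f y * \<rho> (x - y))"
        by (rule locally_L1_mult_test[OF L test_function_reflect[OF \<rho>]])
      then have "integrable lborel (\<lambda>z. f (z + x) * \<rho> (x - (z + x)))"
        by (rule integrable_translation)
      then show ?thesis by (simp add: add.commute even)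
    qed
    have c2: "conv f \<rho> x - f x = (LINT z|lborel. \<rho> z * (f (x + z) - f x))"
      unfolding c1 using i1 i\<rho> one by (simp add: right_diff_distrib mult.commute[of "\<rho> _"])
    have i2: "integrable lborel (\<lambda>z. \<rho> z * (f (x + z) - f x))"
      using i1 i\<rho> by (simp add: right_diff_distrib mult.commute[of "\<rho> _"])
    define M where "M = density lborel (\<lambda>z. ennreal (\<rho> z))"
    have M1: "(\<integral>\<^sup>+ z. 1 \<partial>M) = 1"
      unfolding M_def by (subst nn_integral_density) (auto simp: nn1)
    have "ennreal \<bar>conv f \<rho> x - f x\<bar> \<le> (\<integral>\<^sup>+ z. ennreal \<bar>\<rho> z * (f (x + z) - f x)\<bar> \<partial>lborel)"
      unfolding c2 using integral_norm_bound_ennreal[OF i2] by simp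
    also have "\<dots> = (\<integral>\<^sup>+ z. ennreal (\<rho> z) * ennreal \<bar>f (x + z) - f x\<bar> \<partial>lborel)"
      using pos by (intro nn_integral_cong) (simp add: abs_mult ennreal_mult)
    also have "\<dots> = (\<integral>\<^sup>+ z. ennreal \<bar>f (x + z) - f x\<bar> * 1 \<partial>M)"
      unfolding M_def by (subst nn_integral_density) auto
    finally have "(ennreal \<bar>conv f \<rho> x - f x\<bar>)\<^sup>2 \<le> (\<integral>\<^sup>+ z. ennreal \<bar>f (x + z) - f x\<bar> * 1 \<partial>M)\<^sup>2"
      by (rule power_mono) simp
    also have "\<dots> \<le> (\<integral>\<^sup>+ z. (ennreal \<bar>f (x + z) - f x\<bar>)\<^sup>2 \<partial>M) * (\<integral>\<^sup>+ z. 1\<^sup>2 \<partial>M)"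
      by (rule Cauchy_Schwarz_nn_integral) (auto simp: M_def)
    also have "\<dots> = (\<integral>\<^sup>+ z. ennreal ((f (x + z) - f x)\<^sup>2) \<partial>M)"
      using M1 by (simp add: ennreal_power)
    also have "\<dots> = (\<integral>\<^sup>+ z. ennreal (\<rho> z) * ennreal ((f (x + z) - f x)\<^sup>2) \<partial>lborel)"
      unfolding M_def by (subst nn_integral_density) auto
    finally show ?thesis by (simp add: ennreal_power)
  qed
  have "(\<integral>\<^sup>+ x. ennreal ((conv f \<rho> x - f x)\<^sup>2) \<partial>lborel)
      \<le> (\<integral>\<^sup>+ x. (\<integral>\<^sup>+ z. ennreal (\<rho> z) * ennreal ((f (x + z) - f x)\<^sup>2) \<partial>lborel) \<partial>lborel)"
    by (intro nn_integral_mono pw)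
  also have "\<dots> = (\<integral>\<^sup>+ z. (\<integral>\<^sup>+ x. ennreal (\<rho> z) * ennreal ((f (x + z) - f x)\<^sup>2) \<partial>lborel) \<partial>lborel)"
    by (rule lborel_pair.Fubini'[of "\<lambda>z x. ennreal (\<rho> z) * ennreal ((f (x + z) - f x)\<^sup>2)"]) simp
  also have "\<dots> = (\<integral>\<^sup>+ z. ennreal (\<rho> z) * (\<integral>\<^sup>+ x. ennreal ((f (x + z) - f x)\<^sup>2) \<partial>lborel) \<partial>lborel)"
    by (intro nn_integral_cong nn_integral_cmult) auto
  also have "\<dots> \<le> (\<integral>\<^sup>+ z. ennreal (\<rho> z) * e \<partial>lborel)"
  proof (intro nn_integral_mono)
    fix z
    show "ennreal (\<rho> z) * (\<integral>\<^sup>+ x. ennreal ((f (x + z) - f x)\<^sup>2) \<partial>lborel) \<le> ennreal (\<rho> z) * e"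
      using tr[of z] supp[of z] by (cases "norm z < d") (auto intro: mult_left_mono)
  qed
  also have "\<dots> = e" by (simp add: nn_integral_multc nn1)
  finally show ?thesis .
qed

definition mollifier :: "nat \<Rightarrow> real^3 \<Rightarrow> real" where
  "mollifier k x = inverse (LINT z|lborel. box_bump (- vec (1 / (real k + 1))) (vec (1 / (real k + 1))) 1 (\<lambda>_. 0) (z :: real^3))
     * box_bump (- vec (1 / (real k + 1))) (vec (1 / (real k + 1))) 1 (\<lambda>_. 0) x"

lemma test_function_cmult: "test_function \<eta> \<Longrightarrow> test_function (\<lambda>x. c * \<eta> x)"
  unfolding test_function_def by (auto intro!: smooth_mult smooth_const)

lemma locally_L1_const: "locally_L1 (\<lambda>_. c)"
  unfolding locally_L1_def set_integrable_def
  using borel_integrable_compact[of _ "\<lambda>_. c"] by auto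

lemma test_function_integrable: "test_function \<eta> \<Longrightarrow> integrable lborel \<eta>"
  using locally_L1_mult_test[OF locally_L1_const[of 1], of \<eta>] by simp

lemma mollifier_props:
  shows "test_function (mollifier k)" and "mollifier k z \<ge> 0" and "mollifier k (- z) = mollifier k z"
    and "(LINT z|lborel. mollifier k z) = 1"
    and "norm z \<ge> 4 / (real k + 1) \<Longrightarrow> mollifier k z = 0"
    and "partial i (partial j (mollifier k)) = partial j (partial i (mollifier k))"
proof -
  define e where "e = 1 / (real k + 1)"
  have e: "e > 0" by (simp add: e_def)
  define b where "b = (box_bump (- vec e) (vec e) 1 (\<lambda>_. 0) :: real^3 \<Rightarrow> real)"
  have m: "mollifier k = (\<lambda>x. inverse (LINT z|lborel. b z) * b x)"
    by (simp add: fun_eq_iff mollifier_def b_def e_def)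
  have tb: "test_function b" unfolding b_def using e by (intro test_function_box_bump) auto
  show "test_function (mollifier k)" unfolding m by (rule test_function_cmult[OF tb])
  have b0: "b x \<ge> 0" for x by (simp add: b_def box_bump_props)
  show "mollifier k z \<ge> 0" unfolding m using b0 by simp
  have b_even: "b (- z) = b z" for z
    unfolding b_def box_bump_def tensor_def
    by (intro prod.cong refl) (auto simp: bump_def algebra_simps)
  show "mollifier k (- z) = mollifier k z" by (simp add: m b_even)
  have ib: "integrable lborel b" by (rule test_function_integrable[OF tb])
  have "(LINT z|lborel. b z) \<noteq> 0"
  proof
    assume "(LINT z|lborel. b z) = 0"
    then have "AE z in lborel. b z = 0"
      using integral_nonneg_eq_0_iff_AE[OF ib] b0 by auto
    then have "AE z in lborel. z \<notin> box (- vec e) (vec e :: real^3)"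
      by eventually_elim (metis b_def box_bump_props(3) less_irrefl)
    then have "emeasure lborel (box (- vec e) (vec e :: real^3)) = 0"
      by (subst (asm) AE_iff_measurable[OF _ refl]) auto
    moreover have "emeasure lborel (box (- vec e) (vec e :: real^3)) > 0"
      using e by (subst emeasure_lborel_box) (auto simp: Basis_vec_def inner_axis intro!: prod_pos)
    ultimately show False by simp
  qed
  then show "(LINT z|lborel. mollifier k z) = 1" unfolding m by simp
  show "mollifier k z = 0" if z: "norm z \<ge> 4 / (real k + 1)"
  proof -
    have "z \<notin> box (- vec e) (vec e)"
    proof
      assume "z \<in> box (- vec e) (vec e)"
      then have "\<bar>z $ i\<bar> \<le> e" for i by (auto simp: mem_box_cart dest: spec[of _ i])
      then have "(\<Sum>i\<in>UNIV. \<bar>z $ i\<bar>) \<le> (\<Sum>i\<in>(UNIV::3 set). e)" by (intro sum_mono)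
      then have "norm z \<le> 3 * e" using norm_le_l1_cart[of z] by simp
      moreover have "4 * e \<le> norm z" using z by (simp add: e_def)
      ultimately show False using e by linarith
    qed
    then show ?thesis by (simp add: m b_def box_bump_outside)
  qed
  have pc: "partial i (\<lambda>x. c * g x) = (\<lambda>x. c * partial i g x)" if "smooth g" for i c g
    using partial_mult[of "\<lambda>_. c" _ g i] smooth_differentiable[OF that] by (auto simp: fun_eq_iff partial_const)
  have sb: "smooth b" using tb by (rule test_function_smooth)
  have "partial i (partial j b) = partial j (partial i b)"
    unfolding b_def using e by (auto simp: partial_box_bump fun_upd_twist)
  then show "partial i (partial j (mollifier k)) = partial j (partial i (mollifier k))"
    by (simp add: m pc sb smooth_partial)
qed

definition L2_tendsto :: "(nat \<Rightarrow> real^3 \<Rightarrow> real) \<Rightarrow> (real^3 \<Rightarrow> real) \<Rightarrow> bool" where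
  "L2_tendsto f u \<longleftrightarrow> (\<forall>k. smooth (f k)) \<and> u \<in> L2 \<and> (\<forall>k. integrable lborel (\<lambda>x. (f k x - u x)\<^sup>2))
     \<and> (\<lambda>k. LINT x|lborel. (f k x - u x)\<^sup>2) \<longlonglongrightarrow> 0"

lemma mollifier_L2_tendsto:
  assumes f: "f \<in> L2"
  shows "L2_tendsto (\<lambda>k. conv f (mollifier k)) f"
proof -
  have fm[measurable]: "f \<in> borel_measurable borel" and f2: "integrable lborel (\<lambda>x. (f x)\<^sup>2)"
    using f by (auto simp: L2_def)
  have L: "locally_L1 f" by (rule L2_locally_L1[OF f])
  have sm: "smooth (conv f (mollifier k))" for k by (rule smooth_conv[OF L mollifier_props(1)])
  have [measurable]: "conv f (mollifier k) \<in> borel_measurable borel" for k by (rule smooth_borel[OF sm])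
  have int: "integrable lborel (\<lambda>x. (conv f (mollifier k) x - f x)\<^sup>2)" for k
  proof -
    \<comment> \<open>a bound on all translation errors, valid for every radius\<close>
    define E where "E = ennreal (4 * (LINT x|lborel. (f x)\<^sup>2))"
    have "(\<integral>\<^sup>+ x. ennreal ((conv f (mollifier k) x - f x)\<^sup>2) \<partial>lborel) \<le> E"
    proof (rule conv_L2_estimate[OF f mollifier_props(1-5)])
      fix z :: "real^3"
      have f2z: "integrable lborel (\<lambda>x. (f (x + z))\<^sup>2)" by (rule integrable_translation[OF f2])
      have "(\<integral>\<^sup>+ x. ennreal ((f (x + z) - f x)\<^sup>2) \<partial>lborel)
          \<le> (\<integral>\<^sup>+ x. ennreal (2 * (f (x + z))\<^sup>2 + 2 * (f x)\<^sup>2) \<partial>lborel)"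
      proof (intro nn_integral_mono ennreal_leI)
        fix x show "(f (x + z) - f x)\<^sup>2 \<le> 2 * (f (x + z))\<^sup>2 + 2 * (f x)\<^sup>2"
          using zero_le_power2[of "f (x + z) + f x"] by (simp add: power2_sum power2_diff)
      qed
      also have "\<dots> = ennreal (LINT x|lborel. 2 * (f (x + z))\<^sup>2 + 2 * (f x)\<^sup>2)"
        using f2 f2z by (intro nn_integral_eq_integral) auto
      also have "(LINT x|lborel. 2 * (f (x + z))\<^sup>2 + 2 * (f x)\<^sup>2) = 4 * (LINT x|lborel. (f x)\<^sup>2)"
        using f2 f2z integral_translation[of "\<lambda>x. (f x)\<^sup>2" z] by simp
      finally show "(\<integral>\<^sup>+ x. ennreal ((f (x + z) - f x)\<^sup>2) \<partial>lborel) \<le> E" by (simp add: E_def)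
    qed
    also have "\<dots> < \<infinity>" by (simp add: E_def)
    finally show ?thesis by (intro integrableI_nonneg) auto
  qed
  have lim: "(\<lambda>k. LINT x|lborel. (conv f (mollifier k) x - f x)\<^sup>2) \<longlonglongrightarrow> 0"
  proof (rule LIMSEQ_I)
    fix e :: real assume e: "e > 0"
    obtain d where d: "d > 0" "\<And>z. norm z < d \<Longrightarrow> (\<integral>\<^sup>+ x. ennreal ((f (x + z) - f x)\<^sup>2) \<partial>lborel) \<le> ennreal (e / 2)"
      using L2_translation_continuous[OF f, of "e / 2"] e by auto
    obtain N :: nat where N: "real N > 4 / d" using reals_Archimedean2 by blast
    show "\<exists>N. \<forall>k\<ge>N. norm ((LINT x|lborel. (conv f (mollifier k) x - f x)\<^sup>2) - 0) < e"
    proof (intro exI[of _ N] allI impI)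
      fix k assume k: "N \<le> k"
      have "4 / d < real k + 1" using N k by linarith
      then have kd: "4 / (real k + 1) \<le> d" using d(1) by (simp add: field_simps)
      have "(\<integral>\<^sup>+ x. ennreal ((conv f (mollifier k) x - f x)\<^sup>2) \<partial>lborel) \<le> ennreal (e / 2)"
        by (rule conv_L2_estimate[OF f mollifier_props(1-4), of d k]) (use mollifier_props(5) kd d(2) in auto)
      then have "ennreal (LINT x|lborel. (conv f (mollifier k) x - f x)\<^sup>2) \<le> ennreal (e / 2)"
        by (subst (asm) nn_integral_eq_integral[OF int]) auto
      then have "(LINT x|lborel. (conv f (mollifier k) x - f x)\<^sup>2) \<le> e / 2"
        using e by (subst (asm) ennreal_le_iff) auto
      then show "norm ((LINT x|lborel. (conv f (mollifier k) x - f x)\<^sup>2) - 0) < e"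
        using e by simp
    qed
  qed
  show ?thesis unfolding L2_tendsto_def using sm f int lim by auto
qed

text \<open>By \<open>2 \<bar>a b\<bar> \<le> t a\<^sup>2 + b\<^sup>2 / t\<close>, choosing first \<open>t\<close> and then \<open>k\<close>.\<close>

lemma tendsto_zero_L2_mult:
  fixes a :: "real^3 \<Rightarrow> real" and b :: "nat \<Rightarrow> real^3 \<Rightarrow> real"
  assumes [measurable]: "a \<in> borel_measurable lborel" and a: "integrable lborel (\<lambda>x. (a x)\<^sup>2)"
    and [measurable]: "\<And>k. b k \<in> borel_measurable lborel" and b: "\<And>k. integrable lborel (\<lambda>x. (b k x)\<^sup>2)"
    and lim: "(\<lambda>k. LINT x|lborel. (b k x)\<^sup>2) \<longlonglongrightarrow> 0"
  shows "integrable lborel (\<lambda>x. a x * b k x)" and "(\<lambda>k. LINT x|lborel. \<bar>a x * b k x\<bar>) \<longlonglongrightarrow> 0"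
proof -
  have le: "\<bar>x * y\<bar> \<le> t * x\<^sup>2 + y\<^sup>2 / t" if "t > 0" for x y t :: real
  proof -
    have "0 \<le> (t * \<bar>x\<bar> - \<bar>y\<bar>)\<^sup>2" by simp
    then have "2 * t * \<bar>x * y\<bar> \<le> t\<^sup>2 * x\<^sup>2 + y\<^sup>2" by (simp add: power2_diff power_mult_distrib abs_mult)
    moreover have "t * \<bar>x * y\<bar> \<ge> 0" using that by simp
    ultimately have "t * \<bar>x * y\<bar> \<le> t\<^sup>2 * x\<^sup>2 + y\<^sup>2" by linarith
    then show ?thesis using that by (simp add: field_simps power2_eq_square)
  qed
  show int: "integrable lborel (\<lambda>x. a x * b k x)" for k
  proof (rule Bochner_Integration.integrable_bound)
    show "integrable lborel (\<lambda>x. (a x)\<^sup>2 + (b k x)\<^sup>2)" using a b by auto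
    show "AE x in lborel. norm (a x * b k x) \<le> norm ((a x)\<^sup>2 + (b k x)\<^sup>2)"
      using le[of 1] by (intro AE_I2) simp
  qed auto
  define A where "A = (LINT x|lborel. (a x)\<^sup>2)"
  have A: "A \<ge> 0" by (simp add: A_def)
  show "(\<lambda>k. LINT x|lborel. \<bar>a x * b k x\<bar>) \<longlonglongrightarrow> 0"
  proof (rule LIMSEQ_I)
    fix e :: real assume e: "e > 0"
    define t where "t = e / (2 * (A + 1))"
    have t: "t > 0" using e A by (simp add: t_def)
    have tA: "t * A < e / 2" using e A by (simp add: t_def field_simps)
    \<comment> \<open>the error splits into \<open>t A < e / 2\<close> and \<open>\<integral> b\<^sup>2 / t < e / 2\<close>\<close>
    have "e * t / 2 > 0" using e t by simp
    from order_tendstoD(2)[OF lim this]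
    obtain N where N: "\<And>k. k \<ge> N \<Longrightarrow> (LINT x|lborel. (b k x)\<^sup>2) < e * t / 2"
      unfolding eventually_sequentially by blast
    show "\<exists>N. \<forall>k\<ge>N. norm ((LINT x|lborel. \<bar>a x * b k x\<bar>) - 0) < e"
    proof (intro exI[of _ N] allI impI)
      fix k assume k: "N \<le> k"
      have "(LINT x|lborel. \<bar>a x * b k x\<bar>) \<le> (LINT x|lborel. t * (a x)\<^sup>2 + (b k x)\<^sup>2 / t)"
        using int a b le[OF t] by (intro integral_mono) auto
      also have "\<dots> = t * A + (LINT x|lborel. (b k x)\<^sup>2) / t"
        using a b by (simp add: A_def)
      also have "(LINT x|lborel. (b k x)\<^sup>2) / t < e / 2"
        using N[OF k] t by (simp add: field_simps)
      finally show "norm ((LINT x|lborel. \<bar>a x * b k x\<bar>) - 0) < e" using tA by simp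
    qed
  qed
qed

lemma L2_tendsto_D:
  assumes "L2_tendsto f u"
  shows "smooth (f k)" "u \<in> L2" "u \<in> borel_measurable lborel" "integrable lborel (\<lambda>x. (u x)\<^sup>2)"
    "(\<lambda>x. f k x - u x) \<in> borel_measurable lborel" "f k \<in> borel_measurable lborel"
    "integrable lborel (\<lambda>x. (f k x - u x)\<^sup>2)" "(\<lambda>k. LINT x|lborel. (f k x - u x)\<^sup>2) \<longlonglongrightarrow> 0"
  using assms smooth_borel[of "f k"] by (auto simp: L2_tendsto_def L2_def)

lemma set_integrable_smooth: "compact K \<Longrightarrow> smooth f \<Longrightarrow> set_integrable lborel K f"
  unfolding set_integrable_def by (intro borel_integrable_compact smooth_continuous)

lemma L1_loc_tendstoI:
  fixes f :: "nat \<Rightarrow> real^3 \<Rightarrow> real"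
  assumes "locally_L1 u" and f: "\<And>k. smooth (f k)"
    and "\<And>K. compact K \<Longrightarrow> (\<lambda>k. LINT x:K|lborel. \<bar>f k x - u x\<bar>) \<longlonglongrightarrow> 0"
  shows "L1_loc_tendsto UNIV f u"
  using assms by (auto simp: L1_loc_tendsto_def locally_L1_def intro: set_integrable_smooth)

lemma L2_tendsto_imp_L1_loc:
  assumes f: "L2_tendsto f u"
  shows "L1_loc_tendsto UNIV f u"
proof (rule L1_loc_tendstoI)
  note D = L2_tendsto_D[OF f]
  show "locally_L1 u" by (rule L2_locally_L1[OF D(2)])
  show "smooth (f k)" for k by (rule D)
  fix K :: "(real^3) set" assume K: "compact K"
  have KM[measurable]: "K \<in> sets borel" using K by (simp add: compact_imp_closed)
  have "integrable lborel (\<lambda>x. (indicator K x :: real)\<^sup>2)"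
    using K by (auto simp: power2_eq_square indicator_inter_arith[symmetric] emeasure_lborel_compact)
  then have "(\<lambda>k. LINT x|lborel. \<bar>indicator K x * (f k x - u x)\<bar>) \<longlonglongrightarrow> 0"
    using D by (intro tendsto_zero_L2_mult) auto
  then show "(\<lambda>k. LINT x:K|lborel. \<bar>f k x - u x\<bar>) \<longlonglongrightarrow> 0"
    by (simp add: set_lebesgue_integral_def abs_mult)
qed

text \<open>From \<open>f g - u v = u (g - v) + v (f - u) + (f - u) (g - v)\<close>; the last product is bounded by the sum of
  the squares. Only \<open>L\<^sup>1\<close> convergence is left, which is why traces are taken in \<open>W\<^sup>1\<^sup>,\<^sup>1\<close>.\<close>

lemma L2_tendsto_mult:
  assumes f: "L2_tendsto f u" and g: "L2_tendsto g v"
  shows "L1_loc_tendsto UNIV (\<lambda>k x. f k x * g k x) (\<lambda>x. u x * v x)"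
proof (rule L1_loc_tendstoI)
  note F = L2_tendsto_D[OF f] and G = L2_tendsto_D[OF g]
  note [measurable] = F(3,6) G(3,6)
  show "smooth (\<lambda>x. f k x * g k x)" for k by (intro smooth_mult F G)
  have uv: "integrable lborel (\<lambda>x. u x * v x)"
  proof (rule Bochner_Integration.integrable_bound)
    show "integrable lborel (\<lambda>x. (u x)\<^sup>2 + (v x)\<^sup>2)" using F G by auto
    show "AE x in lborel. norm (u x * v x) \<le> norm ((u x)\<^sup>2 + (v x)\<^sup>2)"
    proof (rule AE_I2)
      fix x
      have "2 * (\<bar>u x\<bar> * \<bar>v x\<bar>) \<le> (u x)\<^sup>2 + (v x)\<^sup>2"
        using zero_le_power2[of "\<bar>u x\<bar> - \<bar>v x\<bar>"] by (simp add: power2_diff)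
      moreover have "\<bar>u x\<bar> * \<bar>v x\<bar> \<ge> 0" by simp
      ultimately show "norm (u x * v x) \<le> norm ((u x)\<^sup>2 + (v x)\<^sup>2)"
        unfolding real_norm_def abs_mult by linarith
    qed
  qed auto
  show "locally_L1 (\<lambda>x. u x * v x)"
    using uv by (auto simp: locally_L1_def set_integrable_def compact_imp_closed intro!: integrable_mult_indicator[where 'b = real, simplified])
  fix K :: "(real^3) set" assume K: "compact K"
  have KM[measurable]: "K \<in> sets borel" using K by (simp add: compact_imp_closed)
  note 1 = tendsto_zero_L2_mult[OF F(3,4) G(5,7,8)]
  note 2 = tendsto_zero_L2_mult[OF G(3,4) F(5,7,8)]
  have i3: "integrable lborel (\<lambda>x. (f k x - u x)\<^sup>2 + (g k x - v x)\<^sup>2)" for k using F G by auto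
  let ?B = "\<lambda>k. (LINT x|lborel. \<bar>u x * (g k x - v x)\<bar>) + (LINT x|lborel. \<bar>v x * (f k x - u x)\<bar>)
      + ((LINT x|lborel. (f k x - u x)\<^sup>2) + (LINT x|lborel. (g k x - v x)\<^sup>2))"
  have B: "?B \<longlonglongrightarrow> 0 + 0 + (0 + 0)"
    by (intro tendsto_add 1 2 F G)
  have le: "(LINT x:K|lborel. \<bar>f k x * g k x - u x * v x\<bar>) \<le> ?B k" for k
  proof -
    have "(LINT x:K|lborel. \<bar>f k x * g k x - u x * v x\<bar>) \<le> (LINT x|lborel.
       \<bar>u x * (g k x - v x)\<bar> + \<bar>v x * (f k x - u x)\<bar> + ((f k x - u x)\<^sup>2 + (g k x - v x)\<^sup>2))"
      unfolding set_lebesgue_integral_def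
    proof (rule integral_mono_AE')
      show "integrable lborel (\<lambda>x. \<bar>u x * (g k x - v x)\<bar> + \<bar>v x * (f k x - u x)\<bar> + ((f k x - u x)\<^sup>2 + (g k x - v x)\<^sup>2))"
        using 1(1) 2(1) i3 by auto
      show "AE x in lborel. indicator K x *\<^sub>R \<bar>f k x * g k x - u x * v x\<bar>
         \<le> \<bar>u x * (g k x - v x)\<bar> + \<bar>v x * (f k x - u x)\<bar> + ((f k x - u x)\<^sup>2 + (g k x - v x)\<^sup>2)"
      proof (rule AE_I2)
        fix x
        define a b where "a = f k x - u x" and "b = g k x - v x"
        have e: "f k x * g k x - u x * v x = u x * b + v x * a + a * b" by (simp add: a_def b_def algebra_simps)
        have "2 * (\<bar>a\<bar> * \<bar>b\<bar>) \<le> a\<^sup>2 + b\<^sup>2"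
          using zero_le_power2[of "\<bar>a\<bar> - \<bar>b\<bar>"] by (simp add: power2_diff)
        moreover have "\<bar>a\<bar> * \<bar>b\<bar> \<ge> 0" by simp
        ultimately have "\<bar>a * b\<bar> \<le> a\<^sup>2 + b\<^sup>2" unfolding abs_mult by linarith
        then have "\<bar>f k x * g k x - u x * v x\<bar> \<le> \<bar>u x * b\<bar> + \<bar>v x * a\<bar> + (a\<^sup>2 + b\<^sup>2)"
          unfolding e by linarith
        moreover have "0 \<le> \<bar>u x * b\<bar> + \<bar>v x * a\<bar> + (a\<^sup>2 + b\<^sup>2)" by simp
        ultimately show "indicator K x *\<^sub>R \<bar>f k x * g k x - u x * v x\<bar>
         \<le> \<bar>u x * (g k x - v x)\<bar> + \<bar>v x * (f k x - u x)\<bar> + ((f k x - u x)\<^sup>2 + (g k x - v x)\<^sup>2)"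
          unfolding a_def b_def by (cases "x \<in> K") auto
      qed
    qed auto
    also have "\<dots> = ?B k" using 1(1) 2(1) F(7) G(7) by simp
    finally show ?thesis .
  qed
  show "(\<lambda>k. LINT x:K|lborel. \<bar>f k x * g k x - u x * v x\<bar>) \<longlonglongrightarrow> 0"
  proof (rule tendsto_sandwich[OF _ _ tendsto_const])
    show "?B \<longlonglongrightarrow> 0" using B by simp
    show "\<forall>\<^sub>F k in sequentially. (LINT x:K|lborel. \<bar>f k x * g k x - u x * v x\<bar>) \<le> ?B k"
      using le by simp
  qed (auto simp: set_lebesgue_integral_def)
qed

section \<open>Weak derivatives as limits of smooth derivatives\<close>

lemma weak_partial_unique:
  assumes w: "weak_partial i u w" and w': "weak_partial i u w'"
  shows "AE x in lborel. w x = w' x"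
proof -
  have L: "locally_L1 w" "locally_L1 w'" using w w' by (auto simp: weak_partial_def)
  have "AE x in lborel. x \<in> UNIV \<longrightarrow> w x - w' x = 0"
  proof (rule fundamental_lemma_box_bump)
    fix a b :: "real^3"
    show "set_integrable lborel (cbox a b) (\<lambda>x. w x - w' x)"
      using L by (intro set_integral_diff(1)) (auto simp: locally_L1_def)
  next
    fix a b :: "real^3" and c :: real
    assume ab: "\<And>j. a $ j < b $ j" "c > 0"
    let ?\<eta> = "box_bump a b c (\<lambda>_. 0)"
    have t: "test_function ?\<eta>" by (rule test_function_box_bump[OF ab])
    have "(LINT x|lborel. w x * ?\<eta> x) = (LINT x|lborel. w' x * ?\<eta> x)"
      using w w' t unfolding weak_partial_def by (metis neg_equal_iff_equal)
    then show "(LINT x|lborel. (w x - w' x) * ?\<eta> x) = 0"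
      using locally_L1_mult_test[OF L(1) t] locally_L1_mult_test[OF L(2) t]
      by (simp add: left_diff_distrib)
  qed auto
  then show ?thesis by eventually_elim auto
qed

lemma weak_partial_wpartial: "weak_partial i u w \<Longrightarrow> weak_partial i u (wpartial i u)"
  unfolding wpartial_def by (rule someI[of "weak_partial i u"])

lemma integral_partial_test_function:
  assumes F: "test_function F"
  shows "(LINT x|lborel. partial i F x) = 0"
proof -
  obtain R where R: "\<And>x. norm x > R \<Longrightarrow> F x = 0" using test_function_bounded[OF F] by metis
  obtain L where L: "\<And>x y. \<bar>F x - F y\<bar> \<le> L * norm (x - y)" using test_function_lipschitz[OF F] by metis
  show ?thesis
  proof (rule integral_directional_derivative_eq_0(2)[where e = "axis i 1" and \<delta> = 1, OF test_function_integrable[OF F] _ R])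
    show "partial i F \<in> borel_measurable lborel"
      using F by (simp add: smooth_borel smooth_partial test_function_smooth)
    show "\<bar>F (x + t *\<^sub>R axis i 1) - F x\<bar> \<le> L * \<bar>t\<bar>" for x t
      using L[of "x + t *\<^sub>R axis i 1" x] by simp
    show "AE x in lborel. ((\<lambda>t. F (x + t *\<^sub>R axis i 1)) has_real_derivative partial i F x) (at 0)"
    proof (rule AE_I2)
      fix x
      have d: "(F has_derivative frechet_derivative F (at (x + 0 *\<^sub>R axis i 1))) (at (x + 0 *\<^sub>R axis i 1))"
        using smooth_differentiable[OF test_function_smooth[OF F]] by (simp add: frechet_derivative_works)
      have "((\<lambda>t. x + t *\<^sub>R axis i (1::real)) has_derivative (\<lambda>t. t *\<^sub>R axis i 1)) (at 0)"
        by (auto intro!: derivative_eq_intros)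
      from has_derivative_compose[OF this d]
      show "((\<lambda>t. F (x + t *\<^sub>R axis i 1)) has_real_derivative partial i F x) (at 0)"
        using linear_cmul[OF linear_frechet_derivative[OF smooth_differentiable[OF test_function_smooth[OF F]]]]
        by (simp add: has_field_derivative_def partial_def mult.commute[of _ "frechet_derivative F _ _"])
    qed
  qed auto
qed

lemma L1_loc_tendsto_onD:
  assumes "L1_loc_tendsto S f u" "compact K" "K \<subseteq> S"
  shows "set_integrable lborel K u" "set_integrable lborel K (f k)"
    "(\<lambda>k. LINT x:K|lborel. \<bar>f k x - u x\<bar>) \<longlonglongrightarrow> 0"
  using assms by (auto simp: L1_loc_tendsto_def)

lemma L1_loc_tendsto_D:
  assumes "L1_loc_tendsto UNIV f u" "compact K"
  shows "set_integrable lborel K u" "set_integrable lborel K (f k)"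
    "(\<lambda>k. LINT x:K|lborel. \<bar>f k x - u x\<bar>) \<longlonglongrightarrow> 0"
  using assms by (auto simp: L1_loc_tendsto_def)

lemma L1_loc_tendsto_locally_L1:
  assumes "L1_loc_tendsto UNIV f u" shows "locally_L1 u" "locally_L1 (f k)"
  using L1_loc_tendsto_D[OF assms] by (auto simp: locally_L1_def)

text \<open>The weight \<open>b\<close> is bounded only almost everywhere, since it will be built from a derivative of a
  Lipschitz function.\<close>

lemma tendsto_set_integral_mult_bounded:
  fixes f :: "nat \<Rightarrow> 'a::euclidean_space \<Rightarrow> real"
  assumes u: "set_integrable lborel K u" and f: "\<And>k. set_integrable lborel K (f k)"
    and lim: "(\<lambda>k. LINT x:K|lborel. \<bar>f k x - u x\<bar>) \<longlonglongrightarrow> 0"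
    and b[measurable]: "b \<in> borel_measurable lborel" and B: "AE x in lborel. x \<in> K \<longrightarrow> \<bar>b x\<bar> \<le> B"
  shows "set_integrable lborel K (\<lambda>x. b x * u x)" "set_integrable lborel K (\<lambda>x. b x * f k x)"
    and "(\<lambda>k. LINT x:K|lborel. b x * f k x) \<longlonglongrightarrow> (LINT x:K|lborel. b x * u x)"
proof -
  have *: "set_integrable lborel K (\<lambda>x. b x * g x)" if "set_integrable lborel K g" for g :: "'a \<Rightarrow> real"
    unfolding set_integrable_def
  proof (rule Bochner_Integration.integrable_bound)
    show "integrable lborel (\<lambda>x. B * (indicator K x *\<^sub>R g x))"
      using that by (simp add: set_integrable_def)
    have [measurable]: "(\<lambda>x. indicator K x *\<^sub>R g x) \<in> borel_measurable lborel"
      using that by (auto simp: set_integrable_def)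
    have "(\<lambda>x. b x * (indicator K x *\<^sub>R g x)) \<in> borel_measurable lborel" by measurable
    then show "(\<lambda>x. indicator K x *\<^sub>R (b x * g x)) \<in> borel_measurable lborel"
      by (simp add: mult_ac)
    show "AE x in lborel. norm (indicator K x *\<^sub>R (b x * g x)) \<le> norm (B * (indicator K x *\<^sub>R g x))"
      using B
    proof eventually_elim
      case (elim x)
      then show ?case by (cases "x \<in> K") (auto simp: abs_mult intro!: mult_right_mono)
    qed
  qed
  show 1: "set_integrable lborel K (\<lambda>x. b x * u x)" by (rule *[OF u])
  show 2: "set_integrable lborel K (\<lambda>x. b x * f k x)" for k by (rule *[OF f])
  have d: "set_integrable lborel K (\<lambda>x. \<bar>f k x - u x\<bar>)" for k
    using set_integrable_abs[OF set_integral_diff(1)[OF f u]] .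
  have le: "\<bar>(LINT x:K|lborel. b x * f k x) - (LINT x:K|lborel. b x * u x)\<bar> \<le> \<bar>B\<bar> * (LINT x:K|lborel. \<bar>f k x - u x\<bar>)" for k
  proof -
    have "(LINT x:K|lborel. b x * f k x) - (LINT x:K|lborel. b x * u x) = (LINT x:K|lborel. b x * f k x - b x * u x)"
      using set_integral_diff(2)[OF 2 1] by simp
    also have "\<bar>\<dots>\<bar> \<le> (LINT x:K|lborel. \<bar>b x * f k x - b x * u x\<bar>)"
      unfolding set_lebesgue_integral_def
      using integral_abs_bound[of lborel "\<lambda>x. indicator K x *\<^sub>R (b x * f k x - b x * u x)"]
      by (simp add: abs_mult)
    also have "\<dots> \<le> (LINT x:K|lborel. \<bar>B\<bar> * \<bar>f k x - u x\<bar>)"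
      unfolding set_lebesgue_integral_def
    proof (rule integral_mono_AE)
      show "integrable lborel (\<lambda>x. indicator K x *\<^sub>R \<bar>b x * f k x - b x * u x\<bar>)"
        using set_integrable_abs[OF set_integral_diff(1)[OF 2 1]] by (simp add: set_integrable_def)
      show "integrable lborel (\<lambda>x. indicator K x *\<^sub>R (\<bar>B\<bar> * \<bar>f k x - u x\<bar>))"
        using set_integrable_mult_right[of "\<bar>B\<bar>", OF d] by (simp add: set_integrable_def)
      show "AE x in lborel. indicator K x *\<^sub>R \<bar>b x * f k x - b x * u x\<bar> \<le> indicator K x *\<^sub>R (\<bar>B\<bar> * \<bar>f k x - u x\<bar>)"
        using B
      proof eventually_elim
        case (elim x)
        then show ?case
          by (cases "x \<in> K") (auto simp: right_diff_distrib[symmetric] abs_mult intro!: mult_right_mono)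
      qed
    qed
    finally show ?thesis by simp
  qed
  show "(\<lambda>k. LINT x:K|lborel. b x * f k x) \<longlonglongrightarrow> (LINT x:K|lborel. b x * u x)"
  proof (rule LIM_zero_cancel, rule Lim_null_comparison)
    show "(\<lambda>k. \<bar>B\<bar> * (LINT x:K|lborel. \<bar>f k x - u x\<bar>)) \<longlonglongrightarrow> 0"
      using tendsto_mult[OF tendsto_const lim, of "\<bar>B\<bar>"] by simp
  qed (use le in auto)
qed

lemma L1_loc_tendsto_test:
  assumes f: "L1_loc_tendsto UNIV f u" and \<eta>: "test_function \<eta>"
  shows "(\<lambda>k. LINT x|lborel. f k x * \<eta> x) \<longlonglongrightarrow> (LINT x|lborel. u x * \<eta> x)"
proof -
  obtain B R where B: "\<And>x. \<bar>\<eta> x\<bar> \<le> B" "\<And>x. norm x > R \<Longrightarrow> \<eta> x = 0"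
    using test_function_bounded[OF \<eta>] by metis
  have e: "(LINT x|lborel. g x * \<eta> x) = (LINT x:cball 0 R|lborel. \<eta> x * g x)" for g
    unfolding set_lebesgue_integral_def
    by (intro Bochner_Integration.integral_cong) (auto simp: indicator_def B(2))
  note D = L1_loc_tendsto_D[OF f compact_cball[of 0 R]]
  show ?thesis unfolding e
    by (rule tendsto_set_integral_mult_bounded(3)[OF D, of _ B])
      (use B \<eta> in \<open>auto simp: smooth_borel test_function_smooth\<close>)
qed

text \<open>Integration by parts holds for the smooth \<open>f k\<close>, and both of its sides converge.\<close>

lemma weak_partial_limit:
  assumes sm: "\<And>k. smooth (f k)" and u: "L1_loc_tendsto UNIV f u"
    and v: "L1_loc_tendsto UNIV (\<lambda>k. partial i (f k)) v"
  shows "weak_partial i u v"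
  unfolding weak_partial_def
proof (intro conjI allI impI)
  show "locally_L1 u" "locally_L1 v" using u v by (auto dest: L1_loc_tendsto_locally_L1)
  fix \<eta> assume \<eta>: "test_function \<eta>"
  have "(LINT x|lborel. f k x * partial i \<eta> x) = - (LINT x|lborel. partial i (f k) x * \<eta> x)" for k
  proof -
    obtain K where K: "compact K" "\<And>x. x \<notin> K \<Longrightarrow> \<eta> x = 0" using \<eta> by (auto simp: test_function_def)
    have t: "test_function (\<lambda>x. f k x * \<eta> x)"
      using K sm \<eta> by (auto simp: test_function_def intro: smooth_mult)
    have "partial i (\<lambda>x. f k x * \<eta> x) x = f k x * partial i \<eta> x + partial i (f k) x * \<eta> x" for x
      by (intro partial_mult smooth_differentiable sm test_function_smooth \<eta>)
    then have "(LINT x|lborel. f k x * partial i \<eta> x + partial i (f k) x * \<eta> x) = 0"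
      using integral_partial_test_function[OF t, of i] by simp
    moreover have "integrable lborel (\<lambda>x. f k x * partial i \<eta> x)"
      by (intro locally_L1_mult_test L1_loc_tendsto_locally_L1(2)[OF u] test_function_partial \<eta>)
    moreover have "integrable lborel (\<lambda>x. partial i (f k) x * \<eta> x)"
      by (intro locally_L1_mult_test L1_loc_tendsto_locally_L1(2)[OF v] \<eta>)
    ultimately show ?thesis by simp
  qed
  then have "(\<lambda>k. LINT x|lborel. f k x * partial i \<eta> x) \<longlonglongrightarrow> - (LINT x|lborel. v x * \<eta> x)"
    using tendsto_minus[OF L1_loc_tendsto_test[OF v \<eta>]] by simp
  moreover have "(\<lambda>k. LINT x|lborel. f k x * partial i \<eta> x) \<longlonglongrightarrow> (LINT x|lborel. u x * partial i \<eta> x)"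
    by (rule L1_loc_tendsto_test[OF u test_function_partial[OF \<eta>]])
  ultimately show "(LINT x|lborel. u x * partial i \<eta> x) = - (LINT x|lborel. v x * \<eta> x)"
    using LIMSEQ_unique by blast
qed

lemma L1_loc_tendsto_cong_AE:
  assumes f: "L1_loc_tendsto UNIV f u" and "locally_L1 u'" and ae: "AE x in lborel. u x = u' x"
  shows "L1_loc_tendsto UNIV f u'"
  unfolding L1_loc_tendsto_def
proof (intro allI impI conjI, goal_cases)
  case (1 K)
  then show ?case using assms(2) by (auto simp: locally_L1_def)
next
  case (2 K k)
  then show ?case using L1_loc_tendsto_D[OF f] by auto
next
  case (3 K)
  then have K: "compact K" by simp
  have i: "set_integrable lborel K u'" using K assms(2) by (auto simp: locally_L1_def)
  note D = L1_loc_tendsto_D[OF f K]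
  have "(LINT x:K|lborel. \<bar>f k x - u x\<bar>) = (LINT x:K|lborel. \<bar>f k x - u' x\<bar>)" for k
    unfolding set_lebesgue_integral_def
  proof (rule integral_cong_AE)
    show "AE x in lborel. indicator K x *\<^sub>R \<bar>f k x - u x\<bar> = indicator K x *\<^sub>R \<bar>f k x - u' x\<bar>"
      using ae by eventually_elim simp
    show "(\<lambda>x. indicator K x *\<^sub>R \<bar>f k x - u x\<bar>) \<in> borel_measurable lborel"
      using set_integrable_abs[OF set_integral_diff(1)[OF D(2) D(1)]] by (auto simp: set_integrable_def)
    show "(\<lambda>x. indicator K x *\<^sub>R \<bar>f k x - u' x\<bar>) \<in> borel_measurable lborel"
      using set_integrable_abs[OF set_integral_diff(1)[OF D(2) i]] by (auto simp: set_integrable_def)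
  qed
  then show ?case using D(3) by simp
qed

text \<open>The form in which limits enter all later arguments: no matter which function the derivatives are
  seen to converge to, they converge to the chosen representative of the weak derivative.\<close>

lemma L1_loc_tendsto_wpartial:
  assumes sm: "\<And>k. smooth (f k)" and u: "L1_loc_tendsto UNIV f u"
    and v: "L1_loc_tendsto UNIV (\<lambda>k. partial i (f k)) v"
  shows "L1_loc_tendsto UNIV (\<lambda>k. partial i (f k)) (wpartial i u)" "AE x in lborel. v x = wpartial i u x"
proof -
  have w: "weak_partial i u v" by (rule weak_partial_limit[OF assms])
  have w': "weak_partial i u (wpartial i u)" by (rule weak_partial_wpartial[OF w])
  show ae: "AE x in lborel. v x = wpartial i u x" by (rule weak_partial_unique[OF w w'])
  show "L1_loc_tendsto UNIV (\<lambda>k. partial i (f k)) (wpartial i u)"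
    by (rule L1_loc_tendsto_cong_AE[OF v _ ae]) (use w' in \<open>simp add: weak_partial_def\<close>)
qed

lemma L1_loc_tendsto_add:
  assumes f: "L1_loc_tendsto S f u" and g: "L1_loc_tendsto S g v"
  shows "L1_loc_tendsto S (\<lambda>k x. f k x + g k x) (\<lambda>x. u x + v x)"
  unfolding L1_loc_tendsto_def
proof (intro allI impI, elim conjE)
  fix K :: "'a set" assume K: "compact K" "K \<subseteq> S"
  note F = L1_loc_tendsto_onD[OF f K]
  note G = L1_loc_tendsto_onD[OF g K]
  note df = set_integrable_abs[OF set_integral_diff(1)[OF F(2,1)]]
  note dg = set_integrable_abs[OF set_integral_diff(1)[OF G(2,1)]]
  have 1: "set_integrable lborel K (\<lambda>x. u x + v x)" "\<And>k. set_integrable lborel K (\<lambda>x. f k x + g k x)"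
    using F G by (auto intro: set_integral_add)
  have "(\<lambda>k. LINT x:K|lborel. \<bar>f k x + g k x - (u x + v x)\<bar>) \<longlonglongrightarrow> 0"
  proof (rule tendsto_sandwich[OF _ _ tendsto_const])
    show "(\<lambda>k. (LINT x:K|lborel. \<bar>f k x - u x\<bar>) + (LINT x:K|lborel. \<bar>g k x - v x\<bar>)) \<longlonglongrightarrow> 0"
      using tendsto_add[OF F(3) G(3)] by simp
    have "(LINT x:K|lborel. \<bar>f k x + g k x - (u x + v x)\<bar>)
      \<le> (LINT x:K|lborel. \<bar>f k x - u x\<bar> + \<bar>g k x - v x\<bar>)" for k
      by (rule set_integral_mono[OF set_integrable_abs[OF set_integral_diff(1)[OF 1(2,1)]] set_integral_add(1)[OF df dg]]) auto
    also have "\<And>k. (LINT x:K|lborel. \<bar>f k x - u x\<bar> + \<bar>g k x - v x\<bar>) = (LINT x:K|lborel. \<bar>f k x - u x\<bar>) + (LINT x:K|lborel. \<bar>g k x - v x\<bar>)"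
      by (rule set_integral_add(2)[OF df dg])
    finally show "\<forall>\<^sub>F k in sequentially. (LINT x:K|lborel. \<bar>f k x + g k x - (u x + v x)\<bar>)
      \<le> (LINT x:K|lborel. \<bar>f k x - u x\<bar>) + (LINT x:K|lborel. \<bar>g k x - v x\<bar>)" by simp
  qed (auto simp: set_lebesgue_integral_def)
  with 1 show "set_integrable lborel K (\<lambda>x. u x + v x) \<and> (\<forall>k. set_integrable lborel K (\<lambda>x. f k x + g k x))
     \<and> (\<lambda>k. LINT x:K|lborel. \<bar>f k x + g k x - (u x + v x)\<bar>) \<longlonglongrightarrow> 0" by blast
qed

lemma L1_loc_tendsto_zero: "L1_loc_tendsto S (\<lambda>k x. 0) (\<lambda>x. 0)"
  by (auto simp: L1_loc_tendsto_def set_integrable_def set_lebesgue_integral_def)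

lemma L1_loc_tendsto_sum:
  "finite I \<Longrightarrow> (\<And>i. i \<in> I \<Longrightarrow> L1_loc_tendsto S (f i) (u i)) \<Longrightarrow>
   L1_loc_tendsto S (\<lambda>k x. \<Sum>i\<in>I. f i k x) (\<lambda>x. \<Sum>i\<in>I. u i x)"
  by (induction I rule: finite_induct) (auto intro: L1_loc_tendsto_add L1_loc_tendsto_zero)

lemma smooth_add: "smooth f \<Longrightarrow> smooth g \<Longrightarrow> smooth (\<lambda>x. f x + g x)"
  by (simp add: smooth_def Ck_add)

lemma partial_add:
  assumes "f differentiable (at x)" "g differentiable (at x)"
  shows "partial i (\<lambda>x. f x + g x) x = partial i f x + partial i g x"
  using assms
  by (subst partial_eqI[OF has_derivative_add[OF frechet_derivative_works[THEN iffD1] frechet_derivative_works[THEN iffD1]]])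
    (auto simp: partial_def)

lemma partial_sum:
  assumes "finite I" "\<And>j. j \<in> I \<Longrightarrow> smooth (f j)"
  shows "partial i (\<lambda>x. \<Sum>j\<in>I. f j x) = (\<lambda>x. \<Sum>j\<in>I. partial i (f j) x)"
  using assms
proof (induction I rule: finite_induct)
  case (insert j I)
  have "smooth (\<lambda>x. \<Sum>j\<in>I. f j x)" using insert by (intro smooth_sum) auto
  then have "partial i (\<lambda>x. f j x + (\<Sum>j\<in>I. f j x)) x = partial i (f j) x + partial i (\<lambda>x. \<Sum>j\<in>I. f j x) x" for x
    using insert by (intro partial_add smooth_differentiable) auto
  then show ?case using insert by (simp add: fun_eq_iff)
qed (simp add: fun_eq_iff partial_const)

text \<open>Derivatives of the mollifications of \<open>\<phi>\<close> are mollifications of the weak derivatives, hence converge in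
  \<open>L\<^sup>2\<close> up to order three. The derivatives of \<open>\<bar>\<nabla>\<phi>\<bar>\<^sup>2\<close> up to second order are sums of products of two such
  derivatives. Second derivatives of the mollifications commute because those of the mollifier do.\<close>

lemma sobolev_H3_approximation:
  assumes \<phi>: "\<phi> \<in> sobolev_H 3"
  obtains p where "\<And>k. smooth (p k)"
    "\<And>k i j. partial j (partial i (p k)) = partial i (partial j (p k))"
    "\<And>i. L1_loc_tendsto UNIV (\<lambda>k. partial i (p k)) (wpartial i \<phi>)"
    "\<And>i j. L1_loc_tendsto UNIV (\<lambda>k. partial j (partial i (p k))) (wpartial j (wpartial i \<phi>))"
    "\<And>i j l. L1_loc_tendsto UNIV (\<lambda>k. partial l (partial j (partial i (p k)))) (wpartial l (wpartial j (wpartial i \<phi>)))"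
    "\<And>i. L1_loc_tendsto UNIV (\<lambda>k x. \<Sum>j\<in>UNIV. 2 * partial j (p k) x * partial i (partial j (p k)) x)
        (wpartial i (\<lambda>z. (norm (wgrad \<phi> z))\<^sup>2))"
    "\<And>i l. L1_loc_tendsto UNIV (\<lambda>k. partial l (\<lambda>x. \<Sum>j\<in>UNIV. 2 * partial j (p k) x * partial i (partial j (p k)) x))
        (wpartial l (wpartial i (\<lambda>z. (norm (wgrad \<phi> z))\<^sup>2)))"
proof -
  have H3: "sobolev_H 3 = {u \<in> L2. \<forall>i. \<exists>w \<in> sobolev_H 2. weak_partial i u w}"
    "sobolev_H 2 = {u \<in> L2. \<forall>i. \<exists>w \<in> sobolev_H 1. weak_partial i u w}"
    "sobolev_H 1 = {u \<in> L2. \<forall>i. \<exists>w \<in> L2. weak_partial i u w}"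
    by (simp_all add: numeral_3_eq_3 numeral_2_eq_2)
  obtain w1 where w1: "\<And>i. w1 i \<in> sobolev_H 2" "\<And>i. weak_partial i \<phi> (w1 i)"
    using \<phi> unfolding H3(1) by auto metis
  obtain w2 where w2: "\<And>i j. w2 i j \<in> sobolev_H 1" "\<And>i j. weak_partial j (w1 i) (w2 i j)"
    using w1(1) unfolding H3(2) by auto metis
  obtain w3 where w3: "\<And>i j l. w3 i j l \<in> L2" "\<And>i j l. weak_partial l (w2 i j) (w3 i j l)"
    using w2(1) unfolding H3(3) by auto metis
  have L2: "\<phi> \<in> L2" "w1 i \<in> L2" "w2 i j \<in> L2" "w3 i j l \<in> L2" for i j l
    using \<phi> w1(1) w2(1) w3(1) unfolding H3 by auto
  define p where "p k = conv \<phi> (mollifier k)" for k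
  note T = mollifier_props(1)
  have p1: "partial i (p k) = conv (w1 i) (mollifier k)" for i k
    unfolding p_def by (rule partial_conv_weak[OF w1(2) T])
  have p2: "partial j (partial i (p k)) = conv (w2 i j) (mollifier k)" for i j k
    unfolding p1 by (rule partial_conv_weak[OF w2(2) T])
  have p3: "partial l (partial j (partial i (p k))) = conv (w3 i j l) (mollifier k)" for i j k l
    unfolding p2 by (rule partial_conv_weak[OF w3(2) T])
  have c0: "L2_tendsto p \<phi>" unfolding p_def by (rule mollifier_L2_tendsto[OF L2(1)])
  have c1: "L2_tendsto (\<lambda>k. partial i (p k)) (w1 i)" for i
    unfolding p1 by (rule mollifier_L2_tendsto[OF L2(2)])
  have c2: "L2_tendsto (\<lambda>k. partial j (partial i (p k))) (w2 i j)" for i j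
    unfolding p2 by (rule mollifier_L2_tendsto[OF L2(3)])
  have c3: "L2_tendsto (\<lambda>k. partial l (partial j (partial i (p k)))) (w3 i j l)" for i j l
    unfolding p3 by (rule mollifier_L2_tendsto[OF L2(4)])
  have sm: "smooth (p k)" for k by (rule L2_tendsto_D[OF c0])
  have sm1: "smooth (partial i (p k))" for i k by (rule smooth_partial[OF sm])
  have sm2: "smooth (partial j (partial i (p k)))" for i j k by (rule smooth_partial[OF sm1])
  have sm3: "smooth (partial l (partial j (partial i (p k))))" for i j k l by (rule smooth_partial[OF sm2])
  have sym: "partial j (partial i (p k)) = partial i (partial j (p k))" for i j k
    unfolding p_def
    by (simp add: partial_conv[OF L2_locally_L1[OF L2(1)]] T test_function_partial mollifier_props(6))
  note d1 = L1_loc_tendsto_wpartial[OF sm L2_tendsto_imp_L1_loc[OF c0] L2_tendsto_imp_L1_loc[OF c1]]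
  note d2 = L1_loc_tendsto_wpartial[OF sm1 d1(1) L2_tendsto_imp_L1_loc[OF c2]]
  note d3 = L1_loc_tendsto_wpartial[OF sm2 d2(1) L2_tendsto_imp_L1_loc[OF c3]]
  define q where "q k = (\<lambda>x. \<Sum>j\<in>UNIV. partial j (p k) x * partial j (p k) x)" for k
  define q1 where "q1 i k = (\<lambda>x. \<Sum>j\<in>UNIV. 2 * partial j (p k) x * partial i (partial j (p k)) x)" for i k
  let ?u = "\<lambda>z. (norm (wgrad \<phi> z))\<^sup>2"
  have smq: "smooth (q k)" for k unfolding q_def by (intro smooth_sum smooth_mult sm1)
  have smq1: "smooth (q1 i k)" for i k unfolding q1_def by (intro smooth_sum smooth_mult sm1 sm2 smooth_const)
  have q1: "partial i (q k) = q1 i k" for i k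
  proof -
    have "partial i (q k) = (\<lambda>x. \<Sum>j\<in>UNIV. partial i (\<lambda>x. partial j (p k) x * partial j (p k) x) x)"
      unfolding q_def by (rule partial_sum) (auto intro: smooth_mult sm1)
    also have "\<dots> = q1 i k"
      unfolding q1_def by (auto simp: fun_eq_iff partial_mult smooth_differentiable sm1 algebra_simps intro!: sum.cong)
    finally show ?thesis .
  qed
  have q2: "partial l (q1 i k) = (\<lambda>x. \<Sum>j\<in>UNIV. (partial l (partial j (p k)) x * partial i (partial j (p k)) x
       + partial l (partial j (p k)) x * partial i (partial j (p k)) x)
       + (partial j (p k) x * partial l (partial i (partial j (p k))) x + partial j (p k) x * partial l (partial i (partial j (p k))) x))" for i l k
  proof -
    have e: "q1 i k = (\<lambda>x. \<Sum>j\<in>UNIV. partial j (p k) x * partial i (partial j (p k)) x + partial j (p k) x * partial i (partial j (p k)) x)"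
      by (auto simp: q1_def fun_eq_iff algebra_simps intro!: sum.cong)
    have s: "smooth (\<lambda>x. partial j (p k) x * partial i (partial j (p k)) x)" for j by (intro smooth_mult sm1 sm2)
    have "partial l (q1 i k) = (\<lambda>x. \<Sum>j\<in>UNIV. partial l (\<lambda>x. partial j (p k) x * partial i (partial j (p k)) x + partial j (p k) x * partial i (partial j (p k)) x) x)"
      unfolding e by (intro partial_sum smooth_add s) auto
    also have "\<dots> = (\<lambda>x. \<Sum>j\<in>UNIV. (partial l (partial j (p k)) x * partial i (partial j (p k)) x
       + partial l (partial j (p k)) x * partial i (partial j (p k)) x)
       + (partial j (p k) x * partial l (partial i (partial j (p k))) x + partial j (p k) x * partial l (partial i (partial j (p k))) x))"
      unfolding partial_add[OF smooth_differentiable[OF s] smooth_differentiable[OF s]]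
        partial_mult[OF smooth_differentiable[OF sm1] smooth_differentiable[OF sm2]]
      by (simp add: algebra_simps)
    finally show ?thesis .
  qed
  have Q0: "L1_loc_tendsto UNIV q ?u"
  proof (rule L1_loc_tendsto_cong_AE)
    show 1: "L1_loc_tendsto UNIV q (\<lambda>x. \<Sum>j\<in>UNIV. w1 j x * w1 j x)"
      unfolding q_def by (intro L1_loc_tendsto_sum L2_tendsto_mult c1) auto
    have "AE x in lborel. \<forall>j. w1 j x = wpartial j \<phi> x"
      using d1(2) by (subst AE_all_countable) auto
    then show ae: "AE x in lborel. (\<Sum>j\<in>UNIV. w1 j x * w1 j x) = ?u x"
    proof eventually_elim
      case (elim x)
      then show ?case by (simp add: wgrad_def norm_vec_def L2_set_def real_sqrt_pow2 sum_nonneg power2_eq_square)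
    qed
    show "locally_L1 ?u"
      unfolding locally_L1_def
    proof (intro allI impI)
      fix K :: "(real^3) set" assume K: "compact K"
      have e: "?u z = (\<Sum>j\<in>UNIV. wpartial j \<phi> z * wpartial j \<phi> z)" for z
        by (auto simp: wgrad_def norm_vec_def L2_set_def real_sqrt_pow2 sum_nonneg power2_eq_square)
      have "set_integrable lborel K (wpartial j \<phi>)" for j
        using L1_loc_tendsto_D(1)[OF d1(1) K] .
      then have [measurable]: "(\<lambda>x. indicator K x * wpartial j \<phi> x) \<in> borel_measurable lborel" for j
        by (auto simp: set_integrable_def)
      have "(\<lambda>x. \<Sum>j\<in>UNIV. (indicator K x * wpartial j \<phi> x) * (indicator K x * wpartial j \<phi> x)) \<in> borel_measurable lborel"
        by measurable
      also have "(\<lambda>x. \<Sum>j\<in>UNIV. (indicator K x * wpartial j \<phi> x) * (indicator K x * wpartial j \<phi> x))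
         = (\<lambda>x. indicator K x *\<^sub>R ?u x)"
        unfolding e by (auto simp: fun_eq_iff indicator_def)
      finally have m: "(\<lambda>x. indicator K x *\<^sub>R ?u x) \<in> borel_measurable lborel" .
      have i: "set_integrable lborel K (\<lambda>x. \<Sum>j\<in>UNIV. w1 j x * w1 j x)"
        using L1_loc_tendsto_D(1)[OF 1 K] .
      show "set_integrable lborel K ?u"
        unfolding set_integrable_def
        by (rule integrable_cong_AE_imp[OF i[unfolded set_integrable_def] m]) (use ae in eventually_elim, simp)
    qed
  qed
  have Q1: "L1_loc_tendsto UNIV (\<lambda>k. partial i (q k)) (\<lambda>x. \<Sum>j\<in>UNIV. w1 j x * w2 j i x + w1 j x * w2 j i x)" for i
  proof -
    have e: "partial i (q k) = (\<lambda>x. \<Sum>j\<in>UNIV. partial j (p k) x * partial i (partial j (p k)) x + partial j (p k) x * partial i (partial j (p k)) x)" for k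
      by (auto simp: q1 q1_def fun_eq_iff algebra_simps intro!: sum.cong)
    show ?thesis unfolding e
      by (intro L1_loc_tendsto_sum L1_loc_tendsto_add L2_tendsto_mult c1 c2) auto
  qed
  note e1 = L1_loc_tendsto_wpartial[OF smq Q0 Q1]
  have Q2: "L1_loc_tendsto UNIV (\<lambda>k. partial l (q1 i k)) (\<lambda>x. \<Sum>j\<in>UNIV. (w2 j l x * w2 j i x + w2 j l x * w2 j i x) + (w1 j x * w3 j i l x + w1 j x * w3 j i l x))" for i l
    unfolding q2 by (intro L1_loc_tendsto_sum L1_loc_tendsto_add L2_tendsto_mult c1 c2 c3) auto
  note e2 = L1_loc_tendsto_wpartial[OF smq1 e1(1)[unfolded q1] Q2]
  show thesis
    by (rule that[OF sm sym d1(1) d2(1) d3(1) e1(1)[unfolded q1 q1_def] e2(1)[unfolded q1_def]])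
qed

section \<open>The trace inequality in a graph chart\<close>

lemma lift_components [simp]: "lift y t $ 1 = y $ 1" "lift y t $ 2 = y $ 2" "lift y t $ 3 = t"
  by (simp_all add: lift_def vector_3)

lemma lift_eq: "lift y t = (y $ 1) *\<^sub>R axis 1 1 + (y $ 2) *\<^sub>R axis 2 1 + t *\<^sub>R axis 3 1"
  by (simp add: vec_eq_iff forall_3 axis_def)

lemma lift_add: "lift (y + z) (s + t) = lift y s + lift z t"
  by (simp add: vec_eq_iff forall_3)

lemma lift_scaleR: "lift (c *\<^sub>R y) (c * t) = c *\<^sub>R lift y t"
  by (simp add: vec_eq_iff forall_3)

lemma lift_inner: "lift y s \<bullet> lift z t = y \<bullet> z + s * t"
  by (simp add: inner_vec_def sum_3 sum_2)

lemma norm_lift: "norm (lift y t) \<le> norm y + \<bar>t\<bar>"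
proof -
  have "(norm (lift y t))\<^sup>2 = (norm y)\<^sup>2 + t\<^sup>2"
    unfolding power2_norm_eq_inner lift_inner by (simp add: power2_eq_square)
  also have "\<dots> \<le> (norm y + \<bar>t\<bar>)\<^sup>2" by (simp add: power2_sum)
  finally show ?thesis by (rule power2_le_imp_le) simp
qed

lemma continuous_lift: "continuous_on A (\<lambda>z. lift (fst z) (snd z))"
  unfolding lift_eq by (intro continuous_intros)

lemma prod_Basis_cart:
  fixes x :: "real^'n::finite"
  shows "(\<Prod>b\<in>Basis. x \<bullet> b) = (\<Prod>i\<in>UNIV. x $ i)"
proof -
  have B: "(Basis :: (real^'n) set) = (\<lambda>i. axis i 1) ` UNIV"
    by (auto simp: Basis_vec_def)
  have inj: "inj (\<lambda>i. axis i 1 :: real^'n)" by (auto simp: inj_on_def axis_eq_axis)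
  show ?thesis unfolding B by (subst prod.reindex[OF inj]) (simp add: inner_axis)
qed

text \<open>The identification of the plane times the line with space preserves Lebesgue measure, because it
  maps products of boxes to boxes.\<close>

lemma distr_lift: "distr (lborel \<Otimes>\<^sub>M lborel) borel (\<lambda>(y, t). lift y t) = lborel"
proof (rule lborel_eqI[symmetric])
  fix l u :: "real^3"
  assume le: "\<And>b. b \<in> Basis \<Longrightarrow> l \<bullet> b \<le> u \<bullet> b"
  have le': "l $ i \<le> u $ i" for i using le[of "axis i 1"] by (simp add: inner_axis axis_in_Basis_iff)
  have [measurable]: "(\<lambda>(y, t). lift y t) \<in> borel_measurable (lborel \<Otimes>\<^sub>M lborel)"
    using borel_measurable_continuous_onI[OF continuous_lift, unfolded borel_prod[symmetric]]
    by (simp add: case_prod_unfold cong: measurable_cong_sets)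
  define l' u' where "l' = (vector [l $ 1, l $ 2] :: real^2)" and "u' = (vector [u $ 1, u $ 2] :: real^2)"
  have lu: "l' $ i \<le> u' $ i" for i
    using le'[of 1] le'[of 2] exhaust_2[of i] by (auto simp: l'_def u'_def vector_2)
  have "emeasure (distr (lborel \<Otimes>\<^sub>M lborel) borel (\<lambda>(y, t). lift y t)) (box l u)
     = emeasure (lborel \<Otimes>\<^sub>M lborel) ((\<lambda>(y, t). lift y t) -` box l u \<inter> space (lborel \<Otimes>\<^sub>M lborel))"
    by (rule emeasure_distr) auto
  also have "(\<lambda>(y, t). lift y t) -` box l u \<inter> space (lborel \<Otimes>\<^sub>M lborel) = box l' u' \<times> box (l $ 3) (u $ 3)"
    by (auto simp: space_pair_measure mem_box_cart forall_3 forall_2 l'_def u'_def vector_2)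
  also have "emeasure (lborel \<Otimes>\<^sub>M lborel) (box l' u' \<times> box (l $ 3) (u $ 3))
     = emeasure lborel (box l' u') * emeasure lborel (box (l $ 3) (u $ 3))"
    by (rule lborel.emeasure_pair_measure_Times) auto
  also have "emeasure lborel (box l' u') = ennreal ((u $ 1 - l $ 1) * (u $ 2 - l $ 2))"
  proof -
    have "\<And>b. b \<in> Basis \<Longrightarrow> l' \<bullet> b \<le> u' \<bullet> b"
      using lu by (auto simp: Basis_vec_def inner_axis)
    then have "emeasure lborel (box l' u') = ennreal (\<Prod>b\<in>Basis. (u' - l') \<bullet> b)"
      by (rule emeasure_lborel_box)
    then show ?thesis by (simp add: prod_Basis_cart UNIV_2 l'_def u'_def vector_2)
  qed
  also have "emeasure lborel (box (l $ 3) (u $ 3)) = ennreal (u $ 3 - l $ 3)"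
    using le' by simp
  also have "ennreal ((u $ 1 - l $ 1) * (u $ 2 - l $ 2)) * ennreal (u $ 3 - l $ 3) = ennreal (\<Prod>b\<in>Basis. (u - l) \<bullet> b)"
  proof -
    have e: "(\<Prod>b\<in>Basis. (u - l) \<bullet> b) = ((u $ 1 - l $ 1) * (u $ 2 - l $ 2)) * (u $ 3 - l $ 3)"
      unfolding prod_Basis_cart UNIV_3 by simp
    have n: "0 \<le> u $ i - l $ i" for i using le'[of i] by simp
    show ?thesis unfolding e by (rule ennreal_mult[symmetric]) (intro mult_nonneg_nonneg n)+
  qed
  finally show "emeasure (distr (lborel \<Otimes>\<^sub>M lborel) borel (\<lambda>(y, t). lift y t)) (box l u)
     = ennreal (\<Prod>b\<in>Basis. (u - l) \<bullet> b)" .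
qed simp

lemma nn_integral_lift:
  assumes [measurable]: "F \<in> borel_measurable borel"
  shows "(\<integral>\<^sup>+ y. \<integral>\<^sup>+ t. F (lift y t) \<partial>lborel \<partial>lborel) = (\<integral>\<^sup>+ x. F x \<partial>lborel)"
proof -
  have m[measurable]: "(\<lambda>(y, t). lift y t) \<in> borel_measurable (lborel \<Otimes>\<^sub>M lborel)"
    using borel_measurable_continuous_onI[OF continuous_lift, unfolded borel_prod[symmetric]]
    by (simp add: case_prod_unfold cong: measurable_cong_sets)
  have "(\<integral>\<^sup>+ x. F x \<partial>lborel) = (\<integral>\<^sup>+ z. F (case z of (y, t) \<Rightarrow> lift y t) \<partial>(lborel \<Otimes>\<^sub>M lborel))"
    by (subst distr_lift[symmetric], subst nn_integral_distr) auto
  also have "\<dots> = (\<integral>\<^sup>+ y. \<integral>\<^sup>+ t. F (lift y t) \<partial>lborel \<partial>lborel)"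
    by (subst lborel.nn_integral_fst[symmetric]) auto
  finally show ?thesis by simp
qed

lemma distr_orthogonal:
  fixes R :: "real^3 \<Rightarrow> real^3"
  assumes R: "orthogonal_transformation R"
  shows "distr lborel borel R = lborel"
proof (rule lborel_eqI[symmetric])
  fix l u :: "real^3"
  assume le: "\<And>b. b \<in> Basis \<Longrightarrow> l \<bullet> b \<le> u \<bullet> b"
  have lin: "linear R" by (rule orthogonal_transformation_linear[OF R])
  have [measurable]: "R \<in> borel_measurable borel"
    by (intro borel_measurable_continuous_onI linear_continuous_on linear_conv_bounded_linear[THEN iffD1] lin)
  have bij: "bij R" by (rule orthogonal_transformation_bij[OF R])
  have Ri: "orthogonal_transformation (inv R)" by (rule orthogonal_transformation_inv[OF R])
  have v: "R -` box l u = inv R ` box l u" by (rule bij_vimage_eq_inv_image[OF bij])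
  have b: "box l u \<in> lmeasurable" by simp
  have op: "R -` box l u \<in> sets borel" using measurable_sets[of R borel borel "box l u"] by simp
  have lm: "R -` box l u \<in> lmeasurable" unfolding v by (rule measurable_orthogonal_image[OF Ri b])
  have "emeasure (distr lborel borel R) (box l u) = emeasure lborel (R -` box l u)"
    by (subst emeasure_distr) auto
  also have "\<dots> = emeasure lebesgue (R -` box l u)" using op by simp
  also have "\<dots> = ennreal (measure lebesgue (R -` box l u))"
    using fmeasurableD2[OF lm] by (rule emeasure_eq_ennreal_measure)
  also have "measure lebesgue (R -` box l u) = measure lebesgue (box l u)"
    unfolding v by (rule measure_orthogonal_image[OF Ri b])
  also have "\<dots> = (\<Prod>b\<in>Basis. (u - l) \<bullet> b)"
    using le by (simp add: measure_lborel_box)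
  finally show "emeasure (distr lborel borel R) (box l u) = ennreal (\<Prod>b\<in>Basis. (u - l) \<bullet> b)" .
qed simp

lemma nn_integral_rigid_motion:
  fixes R :: "real^3 \<Rightarrow> real^3"
  assumes R: "orthogonal_transformation R" and F[measurable]: "F \<in> borel_measurable borel"
  shows "(\<integral>\<^sup>+ x. F (p + R x) \<partial>lborel) = (\<integral>\<^sup>+ x. F x \<partial>lborel)"
proof -
  have lin: "linear R" by (rule orthogonal_transformation_linear[OF R])
  have [measurable]: "R \<in> borel_measurable borel"
    by (intro borel_measurable_continuous_onI linear_continuous_on linear_conv_bounded_linear[THEN iffD1] lin)
  have "(\<integral>\<^sup>+ x. F (p + R x) \<partial>lborel) = (\<integral>\<^sup>+ x. F (p + x) \<partial>distr lborel borel R)"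
    by (subst nn_integral_distr) auto
  also have "\<dots> = (\<integral>\<^sup>+ x. F (p + x) \<partial>lborel)" by (simp add: distr_orthogonal[OF R])
  also have "\<dots> = (\<integral>\<^sup>+ x. F x \<partial>lborel)"
    using nn_integral_translation[OF F, of p] by (simp add: add.commute)
  finally show ?thesis .
qed

text \<open>Average \<open>F 0 = F s - \<integral> F'\<close> over \<open>s\<close> in the unit interval.\<close>

lemma one_dim_trace:
  fixes F F' :: "real \<Rightarrow> real"
  assumes d: "\<And>s. (F has_real_derivative F' s) (at s)" and c: "continuous_on UNIV F'"
  shows "ennreal \<bar>F 0\<bar> \<le> (\<integral>\<^sup>+ s. indicator {0..1} s * ennreal (\<bar>F s\<bar> + \<bar>F' s\<bar>) \<partial>lborel)"
proof -
  have cF: "continuous_on A F" for A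
    by (intro continuous_at_imp_continuous_on ballI DERIV_isCont[OF d])
  have cF': "continuous_on A F'" for A using c by (rule continuous_on_subset) auto
  define J where "J = integral {0..1} (\<lambda>s. \<bar>F' s\<bar>)"
  have pt: "\<bar>F 0\<bar> \<le> \<bar>F s\<bar> + J" if s: "s \<in> {0..1}" for s
  proof -
    have "(F' has_integral (F s - F 0)) {0..s}"
      using s d by (intro fundamental_theorem_of_calculus)
        (auto simp: has_real_derivative_iff_has_vector_derivative[symmetric] intro: has_field_derivative_at_within)
    then have e: "integral {0..s} F' = F s - F 0" by (rule integral_unique)
    have "\<bar>integral {0..s} F'\<bar> \<le> integral {0..s} (\<lambda>s. \<bar>F' s\<bar>)"
      using integral_norm_bound_integral[of F' "{0..s}" "\<lambda>s. \<bar>F' s\<bar>"]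
      by (simp add: integrable_continuous_interval cF' continuous_on_rabs)
    also have "\<dots> \<le> J"
      unfolding J_def using s
      by (intro integral_subset_le integrable_continuous_interval continuous_on_rabs cF') auto
    finally show ?thesis using e by linarith
  qed
  have iF: "(\<lambda>s. \<bar>F s\<bar>) integrable_on {0..1}" "(\<lambda>s. \<bar>F' s\<bar>) integrable_on {0..1}"
    by (intro integrable_continuous_interval continuous_on_rabs cF cF')+
  have "\<bar>F 0\<bar> = integral {0..1::real} (\<lambda>s. \<bar>F 0\<bar>)" by simp
  also have "\<dots> \<le> integral {0..1} (\<lambda>s. \<bar>F s\<bar> + J)"
    using iF pt by (intro integral_le integrable_add) auto
  also have "\<dots> = integral {0..1} (\<lambda>s. \<bar>F s\<bar>) + J"
    using iF by (subst integral_add) auto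
  also have "\<dots> = integral {0..1} (\<lambda>s. \<bar>F s\<bar> + \<bar>F' s\<bar>)"
    unfolding J_def using iF by (subst integral_add) auto
  finally have "ennreal \<bar>F 0\<bar> \<le> ennreal (integral {0..1} (\<lambda>s. \<bar>F s\<bar> + \<bar>F' s\<bar>))"
    by (rule ennreal_leI)
  also have "\<dots> = (\<integral>\<^sup>+ s. ennreal (indicator {0..1} s * (\<bar>F s\<bar> + \<bar>F' s\<bar>)) \<partial>lborel)"
    by (rule nn_integral_has_integral_lebesgue[symmetric])
      (auto intro!: integrable_integral integrable_add iF)
  also have "\<dots> = (\<integral>\<^sup>+ s. indicator {0..1} s * ennreal (\<bar>F s\<bar> + \<bar>F' s\<bar>) \<partial>lborel)"
    by (intro nn_integral_cong) (auto simp: indicator_def)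
  finally show ?thesis .
qed

text \<open>An extended nonnegative integral, so that the trace inequality holds without integrability
  questions.\<close>

definition W11_norm :: "real \<Rightarrow> (real^3 \<Rightarrow> real) \<Rightarrow> ennreal" where
  "W11_norm M f = (\<integral>\<^sup>+ x. indicator (cball 0 M) x * ennreal (\<bar>f x\<bar> + (\<Sum>i\<in>UNIV. \<bar>partial i f x\<bar>)) \<partial>lborel)"

lemma graph_point_add:
  assumes "orthogonal_transformation R"
  shows "graph_point p R g y + s *\<^sub>R R (axis 3 1) = p + R (lift y (g y + s))"
proof -
  have lin: "linear R" by (rule orthogonal_transformation_linear[OF assms])
  have "lift y (g y + s) = lift y (g y) + s *\<^sub>R axis 3 1"
    by (simp add: lift_eq algebra_simps)
  then show ?thesis
    by (simp add: graph_point_def linear_add[OF lin] linear_cmul[OF lin])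
qed

text \<open>Apply the one-dimensional estimate on the segment of length 1 above each point of the graph. The
  shear \<open>(y, t) \<mapsto> (y, g y + t)\<close>, the identification \<open>lift\<close> and the rigid motion of the chart preserve measure.
  The segments may leave the cylinder of the chart because \<open>f\<close> is smooth on the whole space, so the estimate
  holds over the full ball of parameters and \<open>M\<close> depends only on the chart.\<close>

lemma trace_inequality:
  assumes lg: "local_graph \<Omega> p R g r h"
  obtains M where "\<And>f. smooth f \<Longrightarrow>
    (\<integral>\<^sup>+ y. indicator (ball 0 r) y * ennreal \<bar>f (graph_point p R g y)\<bar> \<partial>lborel) \<le> W11_norm M f"
proof -
  have R: "orthogonal_transformation R" and gh: "\<And>y. y \<in> ball 0 r \<Longrightarrow> \<bar>g y\<bar> < h"
    using lg by (auto simp: local_graph_def)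
  define e where "e = R (axis 3 1)"
  have ne: "norm e = 1" unfolding e_def using orthogonal_transformation_norm[OF R] by simp
  define M where "M = norm p + r + h + 1"
  show thesis
  proof (rule that[of M])
    fix f :: "real^3 \<Rightarrow> real" assume f: "smooth f"
    define \<Phi> where "\<Phi> x = ennreal (\<bar>f x\<bar> + (\<Sum>i\<in>UNIV. \<bar>partial i f x\<bar>))" for x
    have [measurable]: "f \<in> borel_measurable borel" "\<And>i. partial i f \<in> borel_measurable borel"
      using f by (auto intro: smooth_borel smooth_partial)
    have cM[measurable]: "cball (0 :: real^3) M \<in> sets borel" by simp
    have m\<Phi>[measurable]: "\<Phi> \<in> borel_measurable borel" unfolding \<Phi>_def by measurable
    have ptw: "ennreal \<bar>f (graph_point p R g y)\<bar> \<le> (\<integral>\<^sup>+ s. indicator {0..1} s * \<Phi> (p + R (lift y (g y + s))) \<partial>lborel)" for y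
    proof -
      let ?x = "\<lambda>s. graph_point p R g y + s *\<^sub>R e"
      let ?D = "\<lambda>s. \<Sum>i\<in>UNIV. e $ i * partial i f (?x s)"
      have d: "((\<lambda>s. f (?x s)) has_real_derivative ?D s) (at s)" for s
      proof -
        have "((\<lambda>s. ?x s) has_derivative (\<lambda>t. t *\<^sub>R e)) (at s)"
          by (auto intro!: derivative_eq_intros)
        from has_derivative_compose[OF this has_derivative_partial[OF smooth_differentiable[OF f]]]
        show ?thesis unfolding has_field_derivative_def
          by (rule has_derivative_eq_rhs) (simp add: fun_eq_iff sum_distrib_left mult_ac)
      qed
      have cp: "continuous_on UNIV (\<lambda>s. partial i f (?x s))" for i
        by (rule continuous_on_compose2[OF smooth_continuous[OF smooth_partial[OF f], of UNIV]])
          (auto intro!: continuous_intros)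
      have "ennreal \<bar>f (?x 0)\<bar> \<le> (\<integral>\<^sup>+ s. indicator {0..1} s * ennreal (\<bar>f (?x s)\<bar> + \<bar>?D s\<bar>) \<partial>lborel)"
        by (rule one_dim_trace[OF d]) (intro continuous_intros cp)
      also have "\<dots> \<le> (\<integral>\<^sup>+ s. indicator {0..1} s * \<Phi> (?x s) \<partial>lborel)"
      proof (intro nn_integral_mono mult_left_mono)
        fix s
        have "\<bar>?D s\<bar> \<le> (\<Sum>i\<in>UNIV. \<bar>partial i f (?x s)\<bar>)"
        proof (intro order_trans[OF sum_abs] sum_mono)
          fix i
          have "\<bar>e $ i\<bar> \<le> 1" using component_le_norm_cart[of e i] ne by simp
          then show "\<bar>e $ i * partial i f (?x s)\<bar> \<le> \<bar>partial i f (?x s)\<bar>"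
            by (simp add: abs_mult mult_left_le_one_le)
        qed
        then show "ennreal (\<bar>f (?x s)\<bar> + \<bar>?D s\<bar>) \<le> \<Phi> (?x s)"
          unfolding \<Phi>_def by (intro ennreal_leI) simp
      qed simp
      finally show ?thesis by (simp add: e_def graph_point_add[OF R])
    qed
    have inner: "indicator (ball 0 r) y * ennreal \<bar>f (graph_point p R g y)\<bar>
        \<le> (\<integral>\<^sup>+ t. indicator (cball 0 M) (p + R (lift y t)) * \<Phi> (p + R (lift y t)) \<partial>lborel)" for y
    proof (cases "y \<in> ball 0 r")
      case True
      have [measurable]: "(\<lambda>t. lift y t) \<in> borel_measurable borel"
        unfolding lift_eq by measurable
      have [measurable]: "R \<in> borel_measurable borel"
        by (intro borel_measurable_continuous_onI linear_continuous_on linear_conv_bounded_linear[THEN iffD1]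
            orthogonal_transformation_linear[OF R])
      have "ennreal \<bar>f (graph_point p R g y)\<bar> \<le> (\<integral>\<^sup>+ s. indicator {0..1} s * \<Phi> (p + R (lift y (g y + s))) \<partial>lborel)"
        by (rule ptw)
      also have "\<dots> = (\<integral>\<^sup>+ s. indicator {0..1} (s + g y - g y) * \<Phi> (p + R (lift y (s + g y))) \<partial>lborel)"
        by (simp add: add.commute)
      also have "\<dots> = (\<integral>\<^sup>+ t. indicator {0..1} (t - g y) * \<Phi> (p + R (lift y t)) \<partial>lborel)"
        by (rule nn_integral_translation[where f = "\<lambda>t. indicator {0..1} (t - g y) * \<Phi> (p + R (lift y t))"]) measurable
      also have "\<dots> \<le> (\<integral>\<^sup>+ t. indicator (cball 0 M) (p + R (lift y t)) * \<Phi> (p + R (lift y t)) \<partial>lborel)"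
      proof (intro nn_integral_mono mult_right_mono)
        fix t
        have "p + R (lift y t) \<in> cball 0 M" if "t - g y \<in> {0..1}"
        proof -
          have "norm (p + R (lift y t)) \<le> norm p + norm (lift y t)"
            using norm_triangle_ineq[of p "R (lift y t)"] orthogonal_transformation_norm[OF R] by simp
          also have "\<dots> \<le> norm p + (norm y + \<bar>t\<bar>)" by (intro add_left_mono norm_lift)
          finally show ?thesis using gh[OF True] True that by (auto simp: M_def)
        qed
        then show "(indicator {0..1} (t - g y) :: ennreal) \<le> indicator (cball 0 M) (p + R (lift y t))"
          by (auto simp: indicator_def)
      qed simp
      finally show ?thesis using True by simp
    qed simp
    have "(\<integral>\<^sup>+ y. indicator (ball 0 r) y * ennreal \<bar>f (graph_point p R g y)\<bar> \<partial>lborel)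
       \<le> (\<integral>\<^sup>+ y. \<integral>\<^sup>+ t. indicator (cball 0 M) (p + R (lift y t)) * \<Phi> (p + R (lift y t)) \<partial>lborel \<partial>lborel)"
      by (intro nn_integral_mono inner)
    also have "\<dots> = (\<integral>\<^sup>+ x. indicator (cball 0 M) (p + R x) * \<Phi> (p + R x) \<partial>lborel)"
    proof (rule nn_integral_lift[where F = "\<lambda>x. indicator (cball 0 M) (p + R x) * \<Phi> (p + R x)"])
      have "(\<lambda>x. indicator (cball 0 M) x * \<Phi> x) \<in> borel_measurable borel" by measurable
      moreover have "(\<lambda>x. p + R x) \<in> borel_measurable borel"
        by (intro borel_measurable_continuous_onI continuous_intros linear_continuous_on
            linear_conv_bounded_linear[THEN iffD1] orthogonal_transformation_linear[OF R])
      ultimately show "(\<lambda>x. indicator (cball 0 M) (p + R x) * \<Phi> (p + R x)) \<in> borel_measurable borel"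
        by (rule measurable_compose_rev)
    qed
    also have "\<dots> = W11_norm M f"
      unfolding W11_norm_def \<Phi>_def[symmetric]
      by (rule nn_integral_rigid_motion[OF R, where F = "\<lambda>x. indicator (cball 0 M) x * \<Phi> x"]) measurable
    finally show "(\<integral>\<^sup>+ y. indicator (ball 0 r) y * ennreal \<bar>f (graph_point p R g y)\<bar> \<partial>lborel) \<le> W11_norm M f" .
  qed
qed

lemma continuous_graph_point:
  assumes lg: "local_graph \<Omega> p R g r h"
  shows "continuous_on (ball 0 r) (graph_point p R g)"
proof -
  have R: "orthogonal_transformation R" and "C11_on (ball 0 r) g"
    using lg by (auto simp: local_graph_def)
  then obtain G where G': "\<forall>y\<in>ball 0 r. GDERIV g y :> G y" by (auto simp: C11_on_def)
  have G: "GDERIV g y :> G y" if "y \<in> ball 0 r" for y using G' that by (rule bspec)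
  then have g: "continuous_on (ball 0 r) g"
    by (intro continuous_at_imp_continuous_on ballI has_derivative_continuous[OF G[unfolded gderiv_def]])
  have l: "continuous_on (ball 0 r) (\<lambda>y. lift y (g y))"
    unfolding lift_eq by (intro continuous_intros g)
  have "continuous_on (ball 0 r) (\<lambda>y. p + R (lift y (g y)))"
    by (rule continuous_on_add[OF continuous_on_const linear_continuous_on_compose[OF l orthogonal_transformation_linear[OF R]]])
  then show ?thesis by (simp add: graph_point_def[abs_def])
qed

section \<open>Existence and stability of traces\<close>

text \<open>The distance of \<open>f\<close> from a function \<open>u\<close> with candidate derivatives \<open>v i\<close>. It is increasing in \<open>M\<close>, so a
  sequence that is fast on the balls of radius \<open>k\<close> at step \<open>k\<close> is eventually fast on every ball.\<close>

definition W11_dist :: "real \<Rightarrow> (real^3 \<Rightarrow> real) \<Rightarrow> (real^3 \<Rightarrow> real) \<Rightarrow> (3 \<Rightarrow> real^3 \<Rightarrow> real) \<Rightarrow> real" where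
  "W11_dist M f u v = (LINT x:cball 0 M|lborel. \<bar>f x - u x\<bar>)
     + (\<Sum>i\<in>UNIV. LINT x:cball 0 M|lborel. \<bar>partial i f x - v i x\<bar>)"

lemma W11_dist_tendsto:
  assumes "L1_loc_tendsto UNIV f u" "\<And>i. L1_loc_tendsto UNIV (\<lambda>k. partial i (f k)) (v i)"
  shows "(\<lambda>k. W11_dist M (f k) u v) \<longlonglongrightarrow> 0"
proof -
  have "(\<lambda>k. W11_dist M (f k) u v) \<longlonglongrightarrow> 0 + (\<Sum>i\<in>(UNIV::3 set). 0)"
    unfolding W11_dist_def
    by (intro tendsto_add tendsto_sum L1_loc_tendsto_D(3) assms compact_cball)
  then show ?thesis by simp
qed

lemma set_integrable_abs_diff:
  fixes f g :: "'a::euclidean_space \<Rightarrow> real"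
  assumes "set_integrable lborel K f" "set_integrable lborel K g"
  shows "set_integrable lborel K (\<lambda>x. \<bar>f x - g x\<bar>)"
  by (rule set_integrable_abs[OF set_integral_diff(1)[OF assms]])

lemma set_integral_nonneg_mono_set:
  fixes f :: "'a::euclidean_space \<Rightarrow> real"
  assumes "set_integrable lborel B f" "A \<subseteq> B" "A \<in> sets borel" "\<And>x. f x \<ge> 0"
  shows "(LINT x:A|lborel. f x) \<le> (LINT x:B|lborel. f x)"
proof -
  have "set_integrable lborel A f" by (rule set_integrable_subset[OF assms(1)]) (use assms in auto)
  then show ?thesis using assms unfolding set_lebesgue_integral_def set_integrable_def
    by (intro integral_mono) (auto simp: indicator_def)
qed

lemma set_integral_finite_sum:
  fixes f :: "'i \<Rightarrow> 'a::euclidean_space \<Rightarrow> real"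
  assumes "\<And>i. i \<in> I \<Longrightarrow> set_integrable lborel K (f i)"
  shows "set_integrable lborel K (\<lambda>x. \<Sum>i\<in>I. f i x)"
    and "(LINT x:K|lborel. \<Sum>i\<in>I. f i x) = (\<Sum>i\<in>I. LINT x:K|lborel. f i x)"
  using assms unfolding set_integrable_def set_lebesgue_integral_def scaleR_sum_right
  by (auto intro: Bochner_Integration.integrable_sum Bochner_Integration.integral_sum)

lemma set_integrable_smooth_diff:
  assumes "smooth f" "locally_L1 u"
  shows "set_integrable lborel (cball 0 M) (\<lambda>x. \<bar>f x - u x\<bar>)"
  using assms(2) by (intro set_integrable_abs_diff[OF set_integrable_smooth[OF compact_cball assms(1)]])
    (simp add: locally_L1_def)

lemma W11_dist_mono:
  assumes f: "smooth f" and u: "locally_L1 u" "\<And>i. locally_L1 (v i)" and "M \<le> M'"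
  shows "W11_dist M f u v \<le> W11_dist M' f u v"
  unfolding W11_dist_def
  using assms by (intro add_mono sum_mono set_integral_nonneg_mono_set set_integrable_smooth_diff smooth_partial) auto

lemma W11_norm_le:
  assumes f: "smooth f" and f': "smooth f'" and u: "locally_L1 u" "\<And>i. locally_L1 (v i)"
  shows "W11_norm M (\<lambda>x. f x - f' x) \<le> ennreal (W11_dist M f u v + W11_dist M f' u v)"
proof -
  let ?B = "cball (0::real^3) M"
  have i: "set_integrable lborel ?B (\<lambda>x. \<bar>g x - u x\<bar>)" "\<And>i. set_integrable lborel ?B (\<lambda>x. \<bar>partial i g x - v i x\<bar>)" if "smooth g" for g
    using that u by (intro set_integrable_smooth_diff smooth_partial; simp)+
  define T where "T g x = \<bar>g x - u x\<bar> + (\<Sum>i\<in>UNIV. \<bar>partial i g x - v i x\<bar>)" for g x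
  have iT: "set_integrable lborel ?B (T g)" if "smooth g" for g
    unfolding T_def by (rule set_integral_add(1)[OF i(1)[OF that] set_integral_finite_sum(1)[OF i(2)[OF that]]])
  have T: "(LINT x:?B|lborel. T g x) = W11_dist M g u v" if "smooth g" for g
    unfolding T_def W11_dist_def set_integral_finite_sum(2)[OF i(2)[OF that], symmetric]
    by (rule set_integral_add(2)[OF i(1)[OF that] set_integral_finite_sum(1)[OF i(2)[OF that]]])
  have iTT: "set_integrable lborel ?B (\<lambda>x. T f x + T f' x)"
    by (intro set_integral_add(1) iT f f')
  have "W11_norm M (\<lambda>x. f x - f' x) \<le> (\<integral>\<^sup>+ x. ennreal (indicator ?B x *\<^sub>R (T f x + T f' x)) \<partial>lborel)"
    unfolding W11_norm_def
  proof (intro nn_integral_mono)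
    fix x
    have "\<bar>f x - f' x\<bar> + (\<Sum>i\<in>UNIV. \<bar>partial i (\<lambda>x. f x - f' x) x\<bar>) \<le> T f x + T f' x"
    proof -
      have "(\<Sum>i\<in>UNIV. \<bar>partial i (\<lambda>x. f x - f' x) x\<bar>) \<le> (\<Sum>i\<in>UNIV. \<bar>partial i f x - v i x\<bar> + \<bar>partial i f' x - v i x\<bar>)"
        using f f' by (intro sum_mono) (simp add: partial_diff smooth_differentiable)
      then show ?thesis by (simp add: T_def sum.distrib)
    qed
    then show "indicator ?B x * ennreal (\<bar>f x - f' x\<bar> + (\<Sum>i\<in>UNIV. \<bar>partial i (\<lambda>x. f x - f' x) x\<bar>))
       \<le> ennreal (indicator ?B x *\<^sub>R (T f x + T f' x))"
      by (cases "x \<in> ?B") (simp_all add: ennreal_leI del: ennreal_plus)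
  qed
  also have "\<dots> = ennreal (LINT x:?B|lborel. T f x + T f' x)"
    unfolding set_lebesgue_integral_def
    using iTT by (intro nn_integral_eq_integral) (auto simp: set_integrable_def T_def sum_nonneg)
  also have "(LINT x:?B|lborel. T f x + T f' x) = W11_dist M f u v + W11_dist M f' u v"
    using set_integral_add(2)[OF iT[OF f] iT[OF f']] T[OF f] T[OF f'] by simp
  finally show ?thesis .
qed

lemma L1_loc_tendsto_compose:
  assumes f: "L1_loc_tendsto S f u" and N: "filterlim N sequentially sequentially"
  shows "L1_loc_tendsto S (\<lambda>k. f (N k)) u"
  unfolding L1_loc_tendsto_def
proof (intro allI impI conjI)
  fix K assume K: "compact K \<and> K \<subseteq> S"
  then show "set_integrable lborel K u" "\<And>k. set_integrable lborel K (f (N k))"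
    using f by (auto simp: L1_loc_tendsto_def)
  have "(\<lambda>k. LINT x:K|lborel. \<bar>f k x - u x\<bar>) \<longlonglongrightarrow> 0"
    using f K by (auto simp: L1_loc_tendsto_def)
  then show "(\<lambda>k. LINT x:K|lborel. \<bar>f (N k) x - u x\<bar>) \<longlonglongrightarrow> 0"
    by (rule filterlim_compose[OF _ N])
qed

lemma L1_loc_tendsto_ballI:
  fixes F :: "nat \<Rightarrow> real^2 \<Rightarrow> real"
  assumes F: "\<And>k. continuous_on (ball 0 r) (F k)"
    and G: "(\<lambda>y. indicator (ball 0 r) y * G y) \<in> borel_measurable borel"
    and lim: "(\<lambda>k. \<integral>\<^sup>+ y. indicator (ball 0 r) y * ennreal \<bar>F k y - G y\<bar> \<partial>lborel) \<longlonglongrightarrow> 0"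
  shows "L1_loc_tendsto (ball 0 r) F G"
  unfolding L1_loc_tendsto_def
proof (intro allI impI, elim conjE)
  fix K :: "(real^2) set" assume K: "compact K" "K \<subseteq> ball 0 r"
  have [measurable]: "K \<in> sets borel" using K by (simp add: compact_imp_closed)
  have iF: "set_integrable lborel K (F k)" for k
    unfolding set_integrable_def by (rule borel_integrable_compact[OF K(1) continuous_on_subset[OF F K(2)]])
  have [measurable]: "(\<lambda>y. indicator K y * F k y) \<in> borel_measurable borel" for k
    using iF[of k] by (auto simp: set_integrable_def)
  have "(\<lambda>y. indicator K y * (indicator (ball 0 r) y * G y)) \<in> borel_measurable borel"
    using G by measurable
  also have "(\<lambda>y. indicator K y * (indicator (ball 0 r) y * G y)) = (\<lambda>y. indicator K y * G y)"
    using K(2) by (auto simp: fun_eq_iff indicator_def)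
  finally have mG[measurable]: "(\<lambda>y. indicator K y * G y) \<in> borel_measurable borel" .
  have le: "(\<integral>\<^sup>+ y. ennreal (indicator K y * \<bar>F k y - G y\<bar>) \<partial>lborel)
      \<le> (\<integral>\<^sup>+ y. indicator (ball 0 r) y * ennreal \<bar>F k y - G y\<bar> \<partial>lborel)" for k
    using K(2) by (intro nn_integral_mono) (auto simp: indicator_def)
  have meas: "(\<lambda>y. indicator K y * \<bar>F k y - G y\<bar>) \<in> borel_measurable borel" for k
  proof -
    have "(\<lambda>y. \<bar>indicator K y * F k y - indicator K y * G y\<bar>) \<in> borel_measurable borel" by measurable
    then show ?thesis by (simp add: right_diff_distrib[symmetric] abs_mult)
  qed
  have ex: "\<exists>k. (\<integral>\<^sup>+ y. indicator (ball 0 r) y * ennreal \<bar>F k y - G y\<bar> \<partial>lborel) < 1"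
    using order_tendstoD(2)[OF lim, of 1] by (auto simp: eventually_sequentially)
  have iG: "set_integrable lborel K G"
  proof -
    obtain k where k: "(\<integral>\<^sup>+ y. indicator (ball 0 r) y * ennreal \<bar>F k y - G y\<bar> \<partial>lborel) < 1" using ex by blast
    have "integrable lborel (\<lambda>y. indicator K y * F k y - indicator K y * G y)"
    proof (rule integrableI_bounded)
      have "(\<integral>\<^sup>+ y. ennreal (norm (indicator K y * F k y - indicator K y * G y)) \<partial>lborel)
          = (\<integral>\<^sup>+ y. ennreal (indicator K y * \<bar>F k y - G y\<bar>) \<partial>lborel)"
        by (intro nn_integral_cong) (simp add: right_diff_distrib[symmetric] abs_mult)
      also have "\<dots> < 1" using le[of k] k by (rule order.strict_trans1)
      also have "(1::ennreal) < \<infinity>" by simp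
      finally show "(\<integral>\<^sup>+ y. ennreal (norm (indicator K y * F k y - indicator K y * G y)) \<partial>lborel) < \<infinity>" .
    qed measurable
    moreover have "integrable lborel (\<lambda>y. indicator K y * F k y)"
      using iF[of k] by (simp add: set_integrable_def)
    ultimately have "integrable lborel (\<lambda>y. indicator K y * F k y - (indicator K y * F k y - indicator K y * G y))"
      by (rule Bochner_Integration.integrable_diff[rotated])
    moreover have "(\<lambda>y. indicator K y * F k y - (indicator K y * F k y - indicator K y * G y)) = (\<lambda>y. indicator K y *\<^sub>R G y)"
      by (simp add: fun_eq_iff)
    ultimately show ?thesis by (simp only: set_integrable_def)
  qed
  have int: "integrable lborel (\<lambda>y. indicator K y * \<bar>F k y - G y\<bar>)" for k
    using set_integrable_abs_diff[OF iF[of k] iG] by (simp add: set_integrable_def)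
  have eq: "ennreal (LINT y:K|lborel. \<bar>F k y - G y\<bar>) = (\<integral>\<^sup>+ y. ennreal (indicator K y * \<bar>F k y - G y\<bar>) \<partial>lborel)" for k
    unfolding set_lebesgue_integral_def using int[of k] by (subst nn_integral_eq_integral) auto
  have "(\<lambda>k. ennreal (LINT y:K|lborel. \<bar>F k y - G y\<bar>)) \<longlonglongrightarrow> ennreal 0"
  proof (rule tendsto_sandwich[OF _ _ tendsto_const])
    show "(\<lambda>k. \<integral>\<^sup>+ y. indicator (ball 0 r) y * ennreal \<bar>F k y - G y\<bar> \<partial>lborel) \<longlonglongrightarrow> ennreal 0"
      using lim by simp
  qed (use le in \<open>auto simp: eq\<close>)
  then have "(\<lambda>k. LINT y:K|lborel. \<bar>F k y - G y\<bar>) \<longlonglongrightarrow> 0"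
    by (rule tendsto_ennrealD) (auto simp: set_lebesgue_integral_def)
  with iF iG show "set_integrable lborel K G \<and> (\<forall>k. set_integrable lborel K (F k))
     \<and> (\<lambda>k. LINT x:K|lborel. \<bar>F k x - G x\<bar>) \<longlonglongrightarrow> 0" by blast
qed

text \<open>If consecutive distances decay geometrically, the telescoping series converges absolutely almost
  everywhere, and its tail bounds the distance to the pointwise limit.\<close>

lemma nn_integral_dist_fast_limit:
  fixes F :: "nat \<Rightarrow> 'a \<Rightarrow> real"
  assumes F[measurable]: "\<And>k. F k \<in> borel_measurable N"
    and fast: "\<And>k. k \<ge> m \<Longrightarrow> (\<integral>\<^sup>+ y. ennreal \<bar>F (Suc k) y - F k y\<bar> \<partial>N) \<le> ennreal (C * (1/2) ^ k)" and C: "C \<ge> 0"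
  shows "(\<integral>\<^sup>+ y. ennreal \<bar>F m y - lim (\<lambda>k. F k y)\<bar> \<partial>N) \<le> ennreal (2 * C * (1/2) ^ m)"
proof -
  define S where "S y = (\<Sum>k. ennreal \<bar>F (Suc (k + m)) y - F (k + m) y\<bar>)" for y
  have "(\<integral>\<^sup>+ y. S y \<partial>N) = (\<Sum>k. \<integral>\<^sup>+ y. ennreal \<bar>F (Suc (k + m)) y - F (k + m) y\<bar> \<partial>N)"
    unfolding S_def by (rule nn_integral_suminf) measurable
  also have "\<dots> \<le> (\<Sum>k. ennreal (C * (1/2) ^ m * (1/2) ^ k))"
    by (intro suminf_le order_trans[OF fast]) (auto simp: power_add mult_ac)
  also have "\<dots> = ennreal (2 * C * (1/2) ^ m)"
  proof -
    have "(\<lambda>k. C * (1/2) ^ m * (1/2) ^ k) sums (C * (1/2) ^ m * (1 / (1 - 1/2)))"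
      by (intro sums_mult geometric_sums) auto
    then show ?thesis using C by (intro suminf_ennreal_eq) (auto simp: mult_ac)
  qed
  finally have S: "(\<integral>\<^sup>+ y. S y \<partial>N) \<le> ennreal (2 * C * (1/2) ^ m)" .
  have Sm: "S \<in> borel_measurable N" unfolding S_def by measurable
  have "(\<integral>\<^sup>+ y. S y \<partial>N) \<noteq> \<infinity>" using S by (auto simp: top_unique)
  then have "AE y in N. S y \<noteq> \<infinity>" by (rule nn_integral_noteq_infinite[OF Sm])
  then have "AE y in N. ennreal \<bar>F m y - lim (\<lambda>k. F k y)\<bar> \<le> S y"
  proof eventually_elim
    case (elim y)
    define a where "a k = F (Suc (k + m)) y - F (k + m) y" for k
    have sa: "summable (\<lambda>k. \<bar>a k\<bar>)"
      using elim by (intro summable_suminf_not_top) (auto simp: S_def a_def)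
    then have sa': "summable a" by (rule summable_rabs_cancel)
    have tel: "(\<Sum>k<n. a k) = F (n + m) y - F m y" for n
      by (induction n) (auto simp: a_def)
    have "(\<lambda>n. (\<Sum>k<n. a k) + F m y) \<longlonglongrightarrow> suminf a + F m y"
      by (intro tendsto_intros summable_LIMSEQ sa')
    then have "(\<lambda>n. F (n + m) y) \<longlonglongrightarrow> suminf a + F m y" by (simp add: tel)
    then have "(\<lambda>n. F n y) \<longlonglongrightarrow> suminf a + F m y" by (rule LIMSEQ_offset)
    then have "lim (\<lambda>n. F n y) = suminf a + F m y" by (rule limI)
    then have "\<bar>F m y - lim (\<lambda>k. F k y)\<bar> \<le> (\<Sum>k. \<bar>a k\<bar>)"
      using summable_rabs[OF sa] by simp
    then have "ennreal \<bar>F m y - lim (\<lambda>k. F k y)\<bar> \<le> ennreal (\<Sum>k. \<bar>a k\<bar>)" by (rule ennreal_leI)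
    also have "\<dots> = S y" unfolding S_def a_def[symmetric] using sa by (intro suminf_ennreal2[symmetric]) auto
    finally show ?case .
  qed
  then have "(\<integral>\<^sup>+ y. ennreal \<bar>F m y - lim (\<lambda>k. F k y)\<bar> \<partial>N) \<le> (\<integral>\<^sup>+ y. S y \<partial>N)"
    by (rule nn_integral_mono_AE)
  then show ?thesis using S by (rule order_trans)
qed

text \<open>The trace must be one function on \<open>\<Gamma>\<close> that serves all charts at once. A subsequence that is fast in
  \<open>W\<^sup>1\<^sup>,\<^sup>1\<close> of every ball is fast in \<open>L\<^sup>1\<close> of every chart, by the trace inequality, and so converges almost
  everywhere in every chart. Its pointwise limit is defined without reference to charts, so nothing has
  to be glued.\<close>

lemma has_trace_exists:
  assumes sm: "\<And>k. smooth (f k)" and u: "L1_loc_tendsto UNIV f u"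
    and v: "\<And>i. L1_loc_tendsto UNIV (\<lambda>k. partial i (f k)) (wpartial i u)"
  shows "\<exists>v. has_trace \<Omega> \<Gamma> u v"
proof -
  have Lu: "locally_L1 u" "\<And>i. locally_L1 (wpartial i u)"
    using L1_loc_tendsto_locally_L1(1)[OF u] L1_loc_tendsto_locally_L1(1)[OF v] by auto
  let ?D = "\<lambda>M k. W11_dist M (f k) u (\<lambda>i. wpartial i u)"
  have "\<exists>n\<ge>k. ?D (real k) n < (1/2) ^ k" for k
  proof -
    have "\<forall>\<^sub>F n in sequentially. ?D (real k) n < (1/2) ^ k"
      using W11_dist_tendsto[where v = "\<lambda>i. wpartial i u", OF u v, of "real k"] by (rule order_tendstoD) simp
    then obtain n0 where "\<And>n. n \<ge> n0 \<Longrightarrow> ?D (real k) n < (1/2) ^ k" by (auto simp: eventually_sequentially)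
    then show ?thesis by (intro exI[of _ "max k n0"]) auto
  qed
  then obtain s where s: "\<And>k. s k \<ge> k" "\<And>k. ?D (real k) (s k) < (1/2) ^ k" by metis
  have fs: "filterlim s sequentially sequentially"
    by (rule filterlim_at_top_mono[OF filterlim_ident]) (use s in auto)
  define q where "q k = f (s k)" for k
  have smq: "smooth (q k)" for k by (simp add: q_def sm)
  have Dq: "W11_dist M (q k) u (\<lambda>i. wpartial i u) \<le> (1/2) ^ k" if "M \<le> real k" for M k
    using W11_dist_mono[where v = "\<lambda>i. wpartial i u", OF smq Lu that, of k] s(2)[of k] by (simp add: q_def)
  \<comment> \<open>where the sequence diverges the value is irrelevant: this happens on a null set of each chart\<close>
  define w where "w x = lim (\<lambda>k. q k x)" for x
  have surf: "surface_L1_loc_tendsto \<Omega> \<Gamma> q w"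
    unfolding surface_L1_loc_tendsto_def
  proof (intro allI impI)
    fix p R g r h assume "graph_chart \<Omega> \<Gamma> p R g r h"
    then have lg: "local_graph \<Omega> p R g r h" by (simp add: graph_chart_def)
    obtain M where M: "\<And>f. smooth f \<Longrightarrow>
       (\<integral>\<^sup>+ y. indicator (ball 0 r) y * ennreal \<bar>f (graph_point p R g y)\<bar> \<partial>lborel) \<le> W11_norm M f"
      using trace_inequality[OF lg] by blast
    define \<gamma> where "\<gamma> = graph_point p R g"
    define F where "F k y = indicator (ball 0 r) y * q k (\<gamma> y)" for k y
    have c: "continuous_on (ball 0 r) (\<lambda>y. q k (\<gamma> y))" for k
      unfolding \<gamma>_def
      by (rule continuous_on_compose2[OF smooth_continuous[OF smq, of UNIV] continuous_graph_point[OF lg]]) auto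
    have Fm[measurable]: "F k \<in> borel_measurable lborel" for k
      unfolding F_def using borel_measurable_continuous_on_indicator[OF _ c, of k]
      by (simp add: mult.commute)
    have limF: "lim (\<lambda>k. F k y) = indicator (ball 0 r) y * w (\<gamma> y)" for y
      by (cases "y \<in> ball 0 r") (auto simp: F_def w_def)
    have fast: "(\<integral>\<^sup>+ y. ennreal \<bar>F (Suc k) y - F k y\<bar> \<partial>lborel) \<le> ennreal (2 * (1/2) ^ k)" if k: "M \<le> real k" for k
    proof -
      have "(\<integral>\<^sup>+ y. ennreal \<bar>F (Suc k) y - F k y\<bar> \<partial>lborel)
          = (\<integral>\<^sup>+ y. indicator (ball 0 r) y * ennreal \<bar>q (Suc k) (graph_point p R g y) - q k (graph_point p R g y)\<bar> \<partial>lborel)"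
        by (intro nn_integral_cong) (auto simp: F_def \<gamma>_def indicator_def)
      also have "\<dots> \<le> W11_norm M (\<lambda>x. q (Suc k) x - q k x)"
        by (rule M[OF smooth_diff[OF smq smq]])
      also have "\<dots> \<le> ennreal (W11_dist M (q (Suc k)) u (\<lambda>i. wpartial i u) + W11_dist M (q k) u (\<lambda>i. wpartial i u))"
        by (rule W11_norm_le[where v = "\<lambda>i. wpartial i u", OF smq smq Lu])
      also have "\<dots> \<le> ennreal (2 * (1/2) ^ k)"
      proof (rule ennreal_leI)
        have "W11_dist M (q (Suc k)) u (\<lambda>i. wpartial i u) \<le> (1/2) ^ Suc k" by (rule Dq) (use k in simp)
        moreover have "(1/2::real) ^ Suc k \<le> (1/2) ^ k" by simp
        ultimately show "W11_dist M (q (Suc k)) u (\<lambda>i. wpartial i u) + W11_dist M (q k) u (\<lambda>i. wpartial i u) \<le> 2 * (1/2) ^ k"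
          using Dq[OF k] by linarith
      qed
      finally show ?thesis .
    qed
    have bd: "(\<integral>\<^sup>+ y. indicator (ball 0 r) y * ennreal \<bar>q m (\<gamma> y) - w (\<gamma> y)\<bar> \<partial>lborel) \<le> ennreal (4 * (1/2) ^ m)"
      if m: "M \<le> real m" for m
    proof -
      have "(\<integral>\<^sup>+ y. ennreal \<bar>F m y - lim (\<lambda>k. F k y)\<bar> \<partial>lborel) \<le> ennreal (2 * 2 * (1/2) ^ m)"
        by (rule nn_integral_dist_fast_limit) (use m fast in auto)
      moreover have "(\<integral>\<^sup>+ y. ennreal \<bar>F m y - lim (\<lambda>k. F k y)\<bar> \<partial>lborel)
         = (\<integral>\<^sup>+ y. indicator (ball 0 r) y * ennreal \<bar>q m (\<gamma> y) - w (\<gamma> y)\<bar> \<partial>lborel)"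
        unfolding limF by (intro nn_integral_cong) (auto simp: F_def indicator_def)
      ultimately show ?thesis by simp
    qed
    show "L1_loc_tendsto (ball 0 r) (\<lambda>k y. q k (graph_point p R g y)) (\<lambda>y. w (graph_point p R g y))"
    proof (rule L1_loc_tendsto_ballI)
      show "continuous_on (ball 0 r) (\<lambda>y. q k (graph_point p R g y))" for k using c by (simp add: \<gamma>_def)
      have "(\<lambda>y. lim (\<lambda>k. F k y)) \<in> borel_measurable borel" using Fm by measurable
      then show "(\<lambda>y. indicator (ball 0 r) y * w (graph_point p R g y)) \<in> borel_measurable borel"
        by (simp add: limF \<gamma>_def)
      show "(\<lambda>k. \<integral>\<^sup>+ y. indicator (ball 0 r) y * ennreal \<bar>q k (graph_point p R g y) - w (graph_point p R g y)\<bar> \<partial>lborel) \<longlonglongrightarrow> 0"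
      proof (rule tendsto_sandwich[OF _ _ tendsto_const])
        have "(\<lambda>m. 4 * (1/2::real) ^ m) \<longlonglongrightarrow> 4 * 0" by (intro tendsto_intros LIMSEQ_realpow_zero) auto
        then show "(\<lambda>m. ennreal (4 * (1/2) ^ m)) \<longlonglongrightarrow> 0" using tendsto_ennrealI by fastforce
        obtain k0 :: nat where "M \<le> real k0" using real_arch_simple by blast
        then show "\<forall>\<^sub>F k in sequentially. (\<integral>\<^sup>+ y. indicator (ball 0 r) y * ennreal \<bar>q k (graph_point p R g y) - w (graph_point p R g y)\<bar> \<partial>lborel) \<le> ennreal (4 * (1/2) ^ k)"
          using bd unfolding eventually_sequentially \<gamma>_def by (intro exI[of _ k0]) (auto intro: order_trans)
      qed simp
    qed
  qed
  have "has_trace \<Omega> \<Gamma> u w"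
    unfolding has_trace_def
    using smq surf L1_loc_tendsto_compose[OF u fs] L1_loc_tendsto_compose[OF v fs]
    by (intro exI[of _ q]) (simp add: q_def[abs_def])
  then show ?thesis by (rule exI[of "has_trace \<Omega> \<Gamma> u" w])
qed

text \<open>The sequence that witnesses the chosen trace and the given sequence approach each other in
  \<open>W\<^sup>1\<^sup>,\<^sup>1\<close>, hence on the surface by the trace inequality.\<close>

lemma surface_L1_loc_tendsto_trace:
  assumes sm: "\<And>k. smooth (f k)" and u: "L1_loc_tendsto UNIV f u"
    and v: "\<And>i. L1_loc_tendsto UNIV (\<lambda>k. partial i (f k)) (wpartial i u)"
  shows "surface_L1_loc_tendsto \<Omega> \<Gamma> f (trace \<Omega> \<Gamma> u)"
proof -
  let ?v = "trace \<Omega> \<Gamma> u"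
  have "has_trace \<Omega> \<Gamma> u ?v"
    unfolding trace_def using has_trace_exists[OF assms] by (rule someI_ex)
  then obtain q where smq: "\<And>k. smooth (q k)" and qu: "L1_loc_tendsto UNIV q u"
    and qv: "\<And>i. L1_loc_tendsto UNIV (\<lambda>k. partial i (q k)) (wpartial i u)"
    and surf: "surface_L1_loc_tendsto \<Omega> \<Gamma> q ?v" unfolding has_trace_def by blast
  have Lu: "locally_L1 u" "\<And>i. locally_L1 (wpartial i u)"
    using L1_loc_tendsto_locally_L1(1)[OF u] L1_loc_tendsto_locally_L1(1)[OF v] by auto
  show ?thesis
    unfolding surface_L1_loc_tendsto_def L1_loc_tendsto_def
  proof (intro allI impI, elim conjE)
    fix p R g r h and K :: "(real^2) set"
    assume ch: "graph_chart \<Omega> \<Gamma> p R g r h" and K: "compact K" "K \<subseteq> ball 0 r"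
    then have lg: "local_graph \<Omega> p R g r h" by (simp add: graph_chart_def)
    obtain M where M: "\<And>f. smooth f \<Longrightarrow>
       (\<integral>\<^sup>+ y. indicator (ball 0 r) y * ennreal \<bar>f (graph_point p R g y)\<bar> \<partial>lborel) \<le> W11_norm M f"
      using trace_inequality[OF lg] by blast
    let ?g = "graph_point p R g"
    have L: "L1_loc_tendsto (ball 0 r) (\<lambda>k y. q k (?g y)) (\<lambda>y. ?v (?g y))"
      using surf ch unfolding surface_L1_loc_tendsto_def by blast
    have q: "set_integrable lborel K (\<lambda>y. ?v (?g y))" "\<And>k. set_integrable lborel K (\<lambda>y. q k (?g y))"
      "(\<lambda>k. LINT y:K|lborel. \<bar>q k (?g y) - ?v (?g y)\<bar>) \<longlonglongrightarrow> 0"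
      using L K unfolding L1_loc_tendsto_def by blast+
    have c: "continuous_on K (\<lambda>y. f k (?g y))" for k
      by (rule continuous_on_compose2[OF smooth_continuous[OF sm, of UNIV] continuous_on_subset[OF continuous_graph_point[OF lg] K(2)]]) auto
    have fi: "set_integrable lborel K (\<lambda>y. f k (?g y))" for k
      unfolding set_integrable_def by (rule borel_integrable_compact[OF K(1) c])
    let ?E = "\<lambda>k. W11_dist M (f k) u (\<lambda>i. wpartial i u) + W11_dist M (q k) u (\<lambda>i. wpartial i u)"
    have E: "?E \<longlonglongrightarrow> 0"
      using tendsto_add[OF W11_dist_tendsto[where v = "\<lambda>i. wpartial i u", OF u v, of M] W11_dist_tendsto[where v = "\<lambda>i. wpartial i u", OF qu qv, of M]] by simp
    have d: "(LINT y:K|lborel. \<bar>f k (?g y) - q k (?g y)\<bar>) \<le> ?E k" for k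
    proof -
      have "ennreal (LINT y:K|lborel. \<bar>f k (?g y) - q k (?g y)\<bar>) = (\<integral>\<^sup>+ y. ennreal (indicator K y *\<^sub>R \<bar>f k (?g y) - q k (?g y)\<bar>) \<partial>lborel)"
        unfolding set_lebesgue_integral_def using set_integrable_abs_diff[OF fi q(2), of k k]
        by (intro nn_integral_eq_integral[symmetric]) (auto simp: set_integrable_def)
      also have "\<dots> \<le> (\<integral>\<^sup>+ y. indicator (ball 0 r) y * ennreal \<bar>f k (?g y) - q k (?g y)\<bar> \<partial>lborel)"
        using K(2) by (intro nn_integral_mono) (auto simp: indicator_def)
      also have "\<dots> \<le> W11_norm M (\<lambda>x. f k x - q k x)" by (rule M[OF smooth_diff[OF sm smq]])
      also have "\<dots> \<le> ennreal (?E k)" by (rule W11_norm_le[where v = "\<lambda>i. wpartial i u", OF sm smq Lu])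
      finally show ?thesis
        by (subst (asm) ennreal_le_iff) (auto simp: W11_dist_def set_lebesgue_integral_def intro!: add_nonneg_nonneg sum_nonneg)
    qed
    have "(\<lambda>k. LINT y:K|lborel. \<bar>f k (?g y) - ?v (?g y)\<bar>) \<longlonglongrightarrow> 0"
    proof (rule tendsto_sandwich[OF _ _ tendsto_const])
      show "(\<lambda>k. ?E k + (LINT y:K|lborel. \<bar>q k (?g y) - ?v (?g y)\<bar>)) \<longlonglongrightarrow> 0"
        using tendsto_add[OF E q(3)] by simp
      have "(LINT y:K|lborel. \<bar>f k (?g y) - ?v (?g y)\<bar>) \<le> ?E k + (LINT y:K|lborel. \<bar>q k (?g y) - ?v (?g y)\<bar>)" for k
      proof -
        note i1 = set_integrable_abs_diff[OF fi q(2), of k k] and i2 = set_integrable_abs_diff[OF q(2,1), of k]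
        have "(LINT y:K|lborel. \<bar>f k (?g y) - ?v (?g y)\<bar>)
          \<le> (LINT y:K|lborel. \<bar>f k (?g y) - q k (?g y)\<bar> + \<bar>q k (?g y) - ?v (?g y)\<bar>)"
          by (rule set_integral_mono[OF set_integrable_abs_diff[OF fi q(1)] set_integral_add(1)[OF i1 i2]]) auto
        also have "\<dots> = (LINT y:K|lborel. \<bar>f k (?g y) - q k (?g y)\<bar>) + (LINT y:K|lborel. \<bar>q k (?g y) - ?v (?g y)\<bar>)"
          by (rule set_integral_add(2)[OF i1 i2])
        finally show ?thesis using d[of k] by simp
      qed
      then show "\<forall>\<^sub>F k in sequentially. (LINT y:K|lborel. \<bar>f k (?g y) - ?v (?g y)\<bar>) \<le> ?E k + (LINT y:K|lborel. \<bar>q k (?g y) - ?v (?g y)\<bar>)"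
        by simp
    qed (auto simp: set_lebesgue_integral_def)
    with q(1) fi show "set_integrable lborel K (\<lambda>y. ?v (?g y)) \<and> (\<forall>k. set_integrable lborel K (\<lambda>y. f k (?g y)))
       \<and> (\<lambda>k. LINT y:K|lborel. \<bar>f k (?g y) - ?v (?g y)\<bar>) \<longlonglongrightarrow> 0" by blast
  qed
qed

section \<open>The weak product rule and products of limits\<close>

lemma lipschitz_on_cball_bounded:
  fixes f :: "'a::euclidean_space \<Rightarrow> real"
  assumes "C-lipschitz_on (cball 0 \<rho>) f"
  obtains B where "B \<ge> 0" "\<And>x. x \<in> cball 0 \<rho> \<Longrightarrow> \<bar>f x\<bar> \<le> B"
proof -
  have "continuous_on (cball 0 \<rho>) f" by (rule lipschitz_on_continuous_on[OF assms])
  then have "bounded (f ` cball 0 \<rho>)" by (intro compact_imp_bounded compact_continuous_image compact_cball)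
  then obtain B where "B > 0" "\<forall>y\<in>f ` cball 0 \<rho>. norm y \<le> B" unfolding bounded_pos by blast
  then show thesis by (intro that[of B]) auto
qed

lemma lipschitz_on_mult_cball:
  fixes f g :: "'a::euclidean_space \<Rightarrow> real"
  assumes f: "C-lipschitz_on (cball 0 \<rho>) f" and g: "D-lipschitz_on (cball 0 \<rho>) g"
  shows "\<exists>E. E-lipschitz_on (cball 0 \<rho>) (\<lambda>x. f x * g x)"
proof -
  obtain A where A: "A \<ge> 0" "\<And>x. x \<in> cball 0 \<rho> \<Longrightarrow> \<bar>f x\<bar> \<le> A" using lipschitz_on_cball_bounded[OF f] by blast
  obtain B where B: "B \<ge> 0" "\<And>x. x \<in> cball 0 \<rho> \<Longrightarrow> \<bar>g x\<bar> \<le> B" using lipschitz_on_cball_bounded[OF g] by blast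
  have C: "C \<ge> 0" "D \<ge> 0" using f g by (auto dest: lipschitz_on_nonneg)
  have "(A * D + B * C)-lipschitz_on (cball 0 \<rho>) (\<lambda>x. f x * g x)"
  proof (rule lipschitz_onI)
    fix x y :: 'a assume xy: "x \<in> cball 0 \<rho>" "y \<in> cball 0 \<rho>"
    have "f x * g x - f y * g y = f x * (g x - g y) + g y * (f x - f y)" by (simp add: algebra_simps)
    then have "\<bar>f x * g x - f y * g y\<bar> \<le> \<bar>f x\<bar> * \<bar>g x - g y\<bar> + \<bar>g y\<bar> * \<bar>f x - f y\<bar>"
      using abs_triangle_ineq[of "f x * (g x - g y)" "g y * (f x - f y)"] by (simp add: abs_mult)
    also have "\<dots> \<le> A * (D * dist x y) + B * (C * dist x y)"
      using A B C xy lipschitz_onD[OF f xy] lipschitz_onD[OF g xy]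
      by (intro add_mono mult_mono) (auto simp: dist_real_def)
    finally show "dist (f x * g x) (f y * g y) \<le> (A * D + B * C) * dist x y"
      by (simp add: dist_real_def algebra_simps)
  qed (use A B C in auto)
  then show ?thesis ..
qed

lemma box_bump_lipschitz:
  fixes a b :: "real^'n::finite"
  assumes ab: "\<And>j. a $ j < b $ j" "c > 0"
  shows "\<exists>C. C-lipschitz_on (cball 0 \<rho>) (box_bump a b c \<alpha>)"
proof -
  have "\<exists>B\<ge>0. \<forall>x\<in>cball 0 \<rho>. \<bar>box_bump a b c (\<alpha>(i := Suc (\<alpha> i))) x\<bar> \<le> B" for i
  proof -
    have "bounded (box_bump a b c (\<alpha>(i := Suc (\<alpha> i))) ` cball 0 \<rho>)"
      by (intro compact_imp_bounded compact_continuous_image compact_cball continuous_box_bump ab)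
    then obtain B where "B > 0" "\<forall>y\<in>box_bump a b c (\<alpha>(i := Suc (\<alpha> i))) ` cball 0 \<rho>. norm y \<le> B"
      unfolding bounded_pos by blast
    then show ?thesis by (intro exI[of _ B]) auto
  qed
  then obtain B where B: "\<And>i. B i \<ge> 0" "\<And>i x. x \<in> cball 0 \<rho> \<Longrightarrow> \<bar>box_bump a b c (\<alpha>(i := Suc (\<alpha> i))) x\<bar> \<le> B i"
    by metis
  define L where "L = (\<Sum>i\<in>UNIV. B i)"
  have "L-lipschitz_on (cball 0 \<rho>) (box_bump a b c \<alpha>)"
  proof (rule bounded_derivative_imp_lipschitz)
    fix x :: "real^'n" assume x: "x \<in> cball 0 \<rho>"
    show "(box_bump a b c \<alpha> has_derivative (\<lambda>h. \<Sum>i\<in>UNIV. h $ i * box_bump a b c (\<alpha>(i := Suc (\<alpha> i))) x)) (at x within cball 0 \<rho>)"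
      by (rule has_derivative_at_withinI[OF box_bump_has_derivative[OF ab]])
    show "onorm (\<lambda>h. \<Sum>i\<in>UNIV. h $ i * box_bump a b c (\<alpha>(i := Suc (\<alpha> i))) x) \<le> L"
    proof (rule onorm_le)
      fix v :: "real^'n"
      have "\<bar>\<Sum>i\<in>UNIV. v $ i * box_bump a b c (\<alpha>(i := Suc (\<alpha> i))) x\<bar> \<le> (\<Sum>i\<in>UNIV. norm v * B i)"
        using x by (intro order_trans[OF sum_abs] sum_mono) (auto simp: abs_mult intro!: mult_mono component_le_norm_cart B)
      then show "norm (\<Sum>i\<in>UNIV. v $ i * box_bump a b c (\<alpha>(i := Suc (\<alpha> i))) x) \<le> L * norm v"
        by (simp add: L_def sum_distrib_left mult.commute)
    qed
  qed (auto simp: L_def intro!: sum_nonneg B)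
  then show ?thesis ..
qed

lemma box_bump_directional_derivative:
  assumes ab: "\<And>j. a $ j < b $ j" "c > 0"
  shows "((\<lambda>t. box_bump a b c \<alpha> (y + t *\<^sub>R axis l 1)) has_real_derivative box_bump a b c (\<alpha>(l := Suc (\<alpha> l))) y) (at 0)"
proof -
  have "((\<lambda>t. y + t *\<^sub>R axis l (1::real)) has_derivative (\<lambda>t. t *\<^sub>R axis l 1)) (at 0)"
    by (auto intro!: derivative_eq_intros)
  from has_derivative_compose[OF this box_bump_has_derivative[OF ab]]
  show ?thesis unfolding has_field_derivative_def
    by (rule has_derivative_eq_rhs)
      (simp add: fun_eq_iff axis_def if_distrib[where f = "\<lambda>s. s * _"] if_distrib[where f = "\<lambda>s. _ * s"] mult.commute cong: if_cong)
qed

text \<open>Provides the bound on the almost everywhere derivative of a Lipschitz coefficient.\<close>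

lemma directional_derivative_bound:
  fixes N :: "'a::real_normed_vector \<Rightarrow> real"
  assumes N: "C-lipschitz_on S N" and y: "y \<in> interior S" and e: "norm e = 1"
    and d: "((\<lambda>t. N (y + t *\<^sub>R e)) has_real_derivative d) (at 0)"
  shows "\<bar>d\<bar> \<le> C"
proof -
  have lim: "((\<lambda>t. \<bar>(N (y + t *\<^sub>R e) - N y) / t\<bar>) \<longlongrightarrow> \<bar>d\<bar>) (at 0)"
    using d by (intro tendsto_rabs) (simp add: has_field_derivative_iff)
  have "((\<lambda>t. y + t *\<^sub>R e) \<longlongrightarrow> y + 0 *\<^sub>R e) (at 0)" by (intro tendsto_intros)
  then have "\<forall>\<^sub>F t in at 0. y + t *\<^sub>R e \<in> interior S"
    using y by (intro topological_tendstoD) auto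
  then have ev: "\<forall>\<^sub>F t in at 0. \<bar>(N (y + t *\<^sub>R e) - N y) / t\<bar> \<le> C"
    using eventually_neq_at_within[of 0]
  proof eventually_elim
    case (elim t)
    have "y + t *\<^sub>R e \<in> S" "y \<in> S" using elim y interior_subset by blast+
    from lipschitz_onD[OF N this] have "\<bar>N (y + t *\<^sub>R e) - N y\<bar> \<le> C * \<bar>t\<bar>"
      using e by (simp add: dist_real_def dist_norm)
    then show ?case using elim by (simp add: field_simps)
  qed
  show ?thesis by (rule tendsto_upperbound[OF lim ev]) simp
qed

lemma compact_subset_smaller_ball:
  fixes K :: "'a::euclidean_space set"
  assumes "compact K" "K \<subseteq> ball 0 r" "r > 0"
  obtains \<rho> where "0 \<le> \<rho>" "\<rho> < r" "K \<subseteq> cball 0 \<rho>"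
proof (cases "K = {}")
  case True
  then show ?thesis using assms that[of 0] by auto
next
  case False
  then obtain x where x: "x \<in> K" "\<And>y. y \<in> K \<Longrightarrow> norm y \<le> norm x"
    using continuous_attains_sup[OF assms(1) False, of norm] continuous_on_norm_id by blast
  show ?thesis using x assms by (intro that[of "norm x"]) auto
qed

text \<open>The derivative of \<open>\<eta> N F\<^sub>k\<close> along a coordinate direction has integral zero. In the three terms of the product rule the
  factors \<open>\<eta> N\<close>, \<open>\<eta> DN\<close> and \<open>\<eta>' N\<close> are bounded and independent of \<open>k\<close>, so \<open>L\<^sup>1\<close> convergence of \<open>F\<^sub>k\<close>
  and of its derivatives suffices for the limit.\<close>

lemma weak_product_rule:
  fixes N DN G G' :: "real^'n::finite \<Rightarrow> real" and F F' :: "nat \<Rightarrow> real^'n \<Rightarrow> real" and l :: 'n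
  assumes r: "r > 0"
    and N: "\<And>\<rho>. \<rho> < r \<Longrightarrow> \<exists>C. C-lipschitz_on (cball 0 \<rho>) N"
    and N_deriv: "AE y in lborel. y \<in> ball 0 r \<longrightarrow> ((\<lambda>t. N (y + t *\<^sub>R axis l 1)) has_real_derivative DN y) (at 0)"
    and DN: "(\<lambda>y. indicator (ball 0 r) y * DN y) \<in> borel_measurable borel"
    and F: "\<And>k \<rho>. \<rho> < r \<Longrightarrow> \<exists>C. C-lipschitz_on (cball 0 \<rho>) (F k)"
    and F_deriv: "\<And>k y. y \<in> ball 0 r \<Longrightarrow> ((\<lambda>t. F k (y + t *\<^sub>R axis l 1)) has_real_derivative F' k y) (at 0)"
    and FG: "L1_loc_tendsto (ball 0 r) F G" and FG': "L1_loc_tendsto (ball 0 r) F' G'"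
    and sub: "cbox a b \<subseteq> ball 0 r" and ab: "\<And>j. a $ j < b $ j" "c > 0"
  defines "\<eta> \<equiv> box_bump a b c (\<lambda>_. 0)" and "\<eta>' \<equiv> box_bump a b c ((\<lambda>_. 0)(l := Suc 0))"
  shows "set_integrable lborel (cbox a b) (\<lambda>y. (\<eta> y * N y) * G' y)"
    and "set_integrable lborel (cbox a b) (\<lambda>y. (\<eta> y * DN y) * G y)"
    and "set_integrable lborel (cbox a b) (\<lambda>y. (\<eta>' y * N y) * G y)"
    and "(LINT y:cbox a b|lborel. (\<eta> y * N y) * G' y) + (LINT y:cbox a b|lborel. (\<eta> y * DN y) * G y)
       + (LINT y:cbox a b|lborel. (\<eta>' y * N y) * G y) = 0"
proof -
  let ?K = "cbox a b" and ?e = "axis l (1::real)"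
  have ne: "norm ?e = 1" by simp
  obtain r' where r': "0 \<le> r'" "r' < r" "?K \<subseteq> cball 0 r'"
    using compact_subset_smaller_ball[OF compact_cbox sub r] by blast
  \<comment> \<open>room for shifting the support inside the ball, where the Lipschitz bounds hold\<close>
  define \<rho> where "\<rho> = (r' + r) / 2"
  have \<rho>: "r' < \<rho>" "\<rho> < r" using r' by (auto simp: \<rho>_def)
  define \<delta> where "\<delta> = \<rho> - r'"
  have \<delta>: "\<delta> > 0" using \<rho> by (simp add: \<delta>_def)
  have K\<rho>: "?K \<subseteq> cball 0 \<rho>" and Ki: "?K \<subseteq> interior (cball 0 \<rho>)"
    using r' \<rho> by (auto simp: interior_cball)
  obtain CN where CN: "CN-lipschitz_on (cball 0 \<rho>) N" using N[OF \<rho>(2)] by blast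
  obtain C\<eta> where C\<eta>: "C\<eta>-lipschitz_on (cball 0 \<rho>) \<eta>"
    using box_bump_lipschitz[OF ab] unfolding \<eta>_def by blast
  obtain C\<eta>' where C\<eta>': "C\<eta>'-lipschitz_on (cball 0 \<rho>) \<eta>'"
    using box_bump_lipschitz[OF ab] unfolding \<eta>'_def by blast
  obtain BN where BN: "BN \<ge> 0" "\<And>y. y \<in> cball 0 \<rho> \<Longrightarrow> \<bar>N y\<bar> \<le> BN" using lipschitz_on_cball_bounded[OF CN] by blast
  obtain B\<eta> where B\<eta>: "B\<eta> \<ge> 0" "\<And>y. y \<in> cball 0 \<rho> \<Longrightarrow> \<bar>\<eta> y\<bar> \<le> B\<eta>" using lipschitz_on_cball_bounded[OF C\<eta>] by blast
  obtain B\<eta>' where B\<eta>': "B\<eta>' \<ge> 0" "\<And>y. y \<in> cball 0 \<rho> \<Longrightarrow> \<bar>\<eta>' y\<bar> \<le> B\<eta>'" using lipschitz_on_cball_bounded[OF C\<eta>'] by blast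
  have CN0: "CN \<ge> 0" by (rule lipschitz_on_nonneg[OF CN])
  have [measurable]: "\<eta> \<in> borel_measurable borel" "\<eta>' \<in> borel_measurable borel"
    unfolding \<eta>_def \<eta>'_def by (intro borel_measurable_continuous_onI continuous_box_bump ab)+
  have cN: "continuous_on ?K N" by (rule continuous_on_subset[OF lipschitz_on_continuous_on[OF CN] K\<rho>])
  have [measurable]: "(\<lambda>y. indicator ?K y * N y) \<in> borel_measurable borel"
    using borel_measurable_continuous_on_indicator[OF _ cN] by (simp add: mult.commute)
  have [measurable]: "(\<lambda>y. indicator (ball 0 r) y * DN y) \<in> borel_measurable borel" by (rule DN)
  have DNK: "(\<lambda>y. indicator ?K y * DN y) = (\<lambda>y. indicator ?K y * (indicator (ball 0 r) y * DN y))"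
    using sub by (auto simp: fun_eq_iff indicator_def)
  have [measurable]: "(\<lambda>y. indicator ?K y * DN y) \<in> borel_measurable borel"
    unfolding DNK by measurable
  have DNb: "AE y in lborel. y \<in> ?K \<longrightarrow> \<bar>DN y\<bar> \<le> CN"
    using N_deriv
  proof eventually_elim
    case (elim y)
    show ?case using directional_derivative_bound[OF CN _ ne] Ki sub elim by blast
  qed
  define b1 where "b1 y = \<eta> y * (indicator ?K y * N y)" for y
  define b2 where "b2 y = \<eta> y * (indicator ?K y * DN y)" for y
  define b3 where "b3 y = \<eta>' y * (indicator ?K y * N y)" for y
  have m: "b1 \<in> borel_measurable lborel" "b2 \<in> borel_measurable lborel" "b3 \<in> borel_measurable lborel"
    unfolding b1_def b2_def b3_def by measurable
  have bb1: "AE y in lborel. y \<in> ?K \<longrightarrow> \<bar>b1 y\<bar> \<le> B\<eta> * BN"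
    using K\<rho> by (intro AE_I2) (auto simp: b1_def abs_mult intro!: mult_mono B\<eta> BN)
  have bb3: "AE y in lborel. y \<in> ?K \<longrightarrow> \<bar>b3 y\<bar> \<le> B\<eta>' * BN"
    using K\<rho> by (intro AE_I2) (auto simp: b3_def abs_mult intro!: mult_mono B\<eta>' BN)
  have bb2: "AE y in lborel. y \<in> ?K \<longrightarrow> \<bar>b2 y\<bar> \<le> B\<eta> * CN"
    using DNb
  proof eventually_elim
    case (elim y)
    then show ?case using K\<rho> B\<eta> CN0 by (auto simp: b2_def abs_mult intro!: mult_mono)
  qed
  note L = L1_loc_tendsto_onD[OF FG compact_cbox sub]
  note L' = L1_loc_tendsto_onD[OF FG' compact_cbox sub]
  note t1 = tendsto_set_integral_mult_bounded[OF L' m(1) bb1]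
  note t2 = tendsto_set_integral_mult_bounded[OF L m(2) bb2]
  note t3 = tendsto_set_integral_mult_bounded[OF L m(3) bb3]
  define D where "D k y = indicator ?K y * (b1 y * F' k y) + indicator ?K y * (b2 y * F k y) + indicator ?K y * (b3 y * F k y)" for k y
  have iD: "integrable lborel (\<lambda>y. indicator ?K y * (b1 y * F' k y))" "integrable lborel (\<lambda>y. indicator ?K y * (b2 y * F k y))"
      "integrable lborel (\<lambda>y. indicator ?K y * (b3 y * F k y))" for k
    using t1(2)[of k] t2(2)[of k] t3(2)[of k] by (auto simp: set_integrable_def)
  have zero: "(LINT y:?K|lborel. b1 y * F' k y) + (LINT y:?K|lborel. b2 y * F k y) + (LINT y:?K|lborel. b3 y * F k y) = 0" for k
  proof -
    obtain CF where CF: "CF-lipschitz_on (cball 0 \<rho>) (F k)" using F[OF \<rho>(2)] by blast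
    obtain C1 where C1: "C1-lipschitz_on (cball 0 \<rho>) (\<lambda>y. N y * F k y)" using lipschitz_on_mult_cball[OF CN CF] by blast
    define \<Phi> where "\<Phi> y = \<eta> y * (N y * F k y)" for y
    obtain C where C: "C-lipschitz_on (cball 0 \<rho>) \<Phi>" unfolding \<Phi>_def using lipschitz_on_mult_cball[OF C\<eta> C1] by blast
    have out: "\<Phi> y = 0" if "y \<notin> box a b" for y
      using that by (simp add: \<Phi>_def \<eta>_def box_bump_outside)
    have "integrable lborel (\<lambda>y. indicator ?K y *\<^sub>R \<Phi> y)"
      by (rule borel_integrable_compact[OF compact_cbox continuous_on_subset[OF lipschitz_on_continuous_on[OF C] K\<rho>]])
    moreover have "(\<lambda>y. indicator ?K y *\<^sub>R \<Phi> y) = \<Phi>"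
      using out box_subset_cbox[of a b] by (auto simp: fun_eq_iff indicator_def)
    ultimately have i\<Phi>: "integrable lborel \<Phi>" by simp
    have sup: "\<Phi> y = 0" if "norm y > r'" for y
      using that r'(3) box_subset_cbox[of a b] by (intro out) auto
    have "(LINT y|lborel. D k y) = 0"
    proof (rule integral_directional_derivative_eq_0(2)[OF i\<Phi> _ sup \<delta>])
      show "D k \<in> borel_measurable lborel" unfolding D_def using iD by auto
      show "\<bar>\<Phi> (x + t *\<^sub>R ?e) - \<Phi> x\<bar> \<le> C * \<bar>t\<bar>" if t: "\<bar>t\<bar> < \<delta>" for x t
      \<comment> \<open>either both points are in the larger ball or both are outside the support\<close>
      proof (cases "x \<in> cball 0 r' \<or> x + t *\<^sub>R ?e \<in> cball 0 r'")
        case True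
        have "norm (x + t *\<^sub>R ?e) \<le> norm x + \<bar>t\<bar>" using norm_triangle_ineq[of x "t *\<^sub>R ?e"] by simp
        moreover have "norm x \<le> norm (x + t *\<^sub>R ?e) + \<bar>t\<bar>" using norm_triangle_ineq4[of "x + t *\<^sub>R ?e" "t *\<^sub>R ?e"] by simp
        ultimately have "x \<in> cball 0 \<rho>" "x + t *\<^sub>R ?e \<in> cball 0 \<rho>" using True t by (auto simp: \<delta>_def)
        from lipschitz_onD[OF C this(2,1)] show ?thesis by (simp add: dist_real_def dist_norm)
      next
        case False
        then have "\<Phi> (x + t *\<^sub>R ?e) = 0" "\<Phi> x = 0" by (auto intro!: sup)
        then show ?thesis using lipschitz_on_nonneg[OF C] by simp
      qed
      show "AE y in lborel. ((\<lambda>t. \<Phi> (y + t *\<^sub>R ?e)) has_real_derivative D k y) (at 0)"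
        using N_deriv
      proof eventually_elim
        case (elim y)
        show ?case
        proof (cases "y \<in> ?K")
          case True
          then have yb: "y \<in> ball 0 r" using sub by blast
          have "((\<lambda>t. \<Phi> (y + t *\<^sub>R ?e)) has_real_derivative
             (\<eta>' y * (N (y + 0 *\<^sub>R ?e) * F k (y + 0 *\<^sub>R ?e)) + (DN y * F k (y + 0 *\<^sub>R ?e) + F' k y * N (y + 0 *\<^sub>R ?e)) * \<eta> (y + 0 *\<^sub>R ?e))) (at 0)"
            unfolding \<Phi>_def
            by (rule DERIV_mult[OF box_bump_directional_derivative[OF ab, of "\<lambda>_. 0" y l, folded \<eta>_def, simplified, folded \<eta>'_def]
                  DERIV_mult[OF elim[rule_format, OF yb] F_deriv[OF yb]]])
          then show ?thesis
            by (rule DERIV_cong) (use True in \<open>simp add: D_def b1_def b2_def b3_def algebra_simps\<close>)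
        next
          case False
          have "((\<lambda>t. y + t *\<^sub>R ?e) \<longlongrightarrow> y + 0 *\<^sub>R ?e) (nhds 0)" by (intro tendsto_intros filterlim_ident)
          then have "\<forall>\<^sub>F t in nhds 0. y + t *\<^sub>R ?e \<in> - ?K"
            using False by (intro topological_tendstoD) auto
          then have "\<forall>\<^sub>F t in nhds 0. \<Phi> (y + t *\<^sub>R ?e) = 0"
          proof eventually_elim
            case (elim t)
            then show ?case using box_subset_cbox[of a b] by (intro out) blast
          qed
          then have "((\<lambda>t. \<Phi> (y + t *\<^sub>R ?e)) has_real_derivative 0) (at 0)"
            by (subst DERIV_cong_ev[OF refl _ refl]) auto
          then show ?thesis using False by (simp add: D_def)
        qed
      qed
    qed
    then show ?thesis using iD by (simp add: D_def set_lebesgue_integral_def)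
  qed
  have "(\<lambda>k. (LINT y:?K|lborel. b1 y * F' k y) + (LINT y:?K|lborel. b2 y * F k y) + (LINT y:?K|lborel. b3 y * F k y))
     \<longlonglongrightarrow> (LINT y:?K|lborel. b1 y * G' y) + (LINT y:?K|lborel. b2 y * G y) + (LINT y:?K|lborel. b3 y * G y)"
    by (intro tendsto_add t1(3) t2(3) t3(3))
  then have lim0: "(LINT y:?K|lborel. b1 y * G' y) + (LINT y:?K|lborel. b2 y * G y) + (LINT y:?K|lborel. b3 y * G y) = 0"
    unfolding zero using LIMSEQ_unique tendsto_const by blast
  have e: "indicator ?K y *\<^sub>R (b1 y * G' y) = indicator ?K y *\<^sub>R ((\<eta> y * N y) * G' y)"
    "indicator ?K y *\<^sub>R (b2 y * G y) = indicator ?K y *\<^sub>R ((\<eta> y * DN y) * G y)"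
    "indicator ?K y *\<^sub>R (b3 y * G y) = indicator ?K y *\<^sub>R ((\<eta>' y * N y) * G y)" for y
    by (auto simp: b1_def b2_def b3_def indicator_def)
  show "set_integrable lborel ?K (\<lambda>y. (\<eta> y * N y) * G' y)" using t1(1) unfolding set_integrable_def e .
  show "set_integrable lborel ?K (\<lambda>y. (\<eta> y * DN y) * G y)" using t2(1) unfolding set_integrable_def e .
  show "set_integrable lborel ?K (\<lambda>y. (\<eta>' y * N y) * G y)" using t3(1) unfolding set_integrable_def e .
  show "(LINT y:?K|lborel. (\<eta> y * N y) * G' y) + (LINT y:?K|lborel. (\<eta> y * DN y) * G y)
       + (LINT y:?K|lborel. (\<eta>' y * N y) * G y) = 0"
    using lim0 unfolding set_lebesgue_integral_def e .
qed

text \<open>In the sum of the weak product rules the terms with \<open>\<eta>'\<close> contain the factor \<open>\<Sum> N\<^sub>i G\<^sub>i = 0\<close>. What remains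
  is the integral of the asserted sum against every bump.\<close>

lemma differentiated_orthogonality:
  fixes N DN G G' :: "'i::finite \<Rightarrow> real^'n::finite \<Rightarrow> real" and F F' :: "'i \<Rightarrow> nat \<Rightarrow> real^'n \<Rightarrow> real" and l :: 'n
  assumes r: "r > 0"
    and N: "\<And>i \<rho>. \<rho> < r \<Longrightarrow> \<exists>C. C-lipschitz_on (cball 0 \<rho>) (N i)"
    and N_deriv: "\<And>i. AE y in lborel. y \<in> ball 0 r \<longrightarrow> ((\<lambda>t. N i (y + t *\<^sub>R axis l 1)) has_real_derivative DN i y) (at 0)"
    and DN: "\<And>i. (\<lambda>y. indicator (ball 0 r) y * DN i y) \<in> borel_measurable borel"
    and F: "\<And>i k \<rho>. \<rho> < r \<Longrightarrow> \<exists>C. C-lipschitz_on (cball 0 \<rho>) (F i k)"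
    and F_deriv: "\<And>i k y. y \<in> ball 0 r \<Longrightarrow> ((\<lambda>t. F i k (y + t *\<^sub>R axis l 1)) has_real_derivative F' i k y) (at 0)"
    and FG: "\<And>i. L1_loc_tendsto (ball 0 r) (F i) (G i)" and FG': "\<And>i. L1_loc_tendsto (ball 0 r) (F' i) (G' i)"
    and orth: "AE y in lborel. y \<in> ball 0 r \<longrightarrow> (\<Sum>i\<in>UNIV. N i y * G i y) = 0"
  shows "AE y in lborel. y \<in> ball 0 r \<longrightarrow> (\<Sum>i\<in>UNIV. N i y * G' i y + DN i y * G i y) = 0"
proof (rule fundamental_lemma_box_bump)
  show "open (ball (0::real^'n) r)" by simp
  show "set_integrable lborel (cbox a b) (\<lambda>y. \<Sum>i\<in>UNIV. N i y * G' i y + DN i y * G i y)" if sub: "cbox a b \<subseteq> ball 0 r" for a b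
  proof (intro set_integral_finite_sum(1) set_integral_add(1))
    fix i
    let ?K = "cbox a b"
    obtain \<rho> where \<rho>: "0 \<le> \<rho>" "\<rho> < r" "?K \<subseteq> cball 0 \<rho>"
      using compact_subset_smaller_ball[OF compact_cbox sub r] by blast
    define \<sigma> where "\<sigma> = (\<rho> + r) / 2"
    have \<sigma>: "\<sigma> < r" "?K \<subseteq> cball 0 \<sigma>" "?K \<subseteq> interior (cball 0 \<sigma>)" using \<rho> by (auto simp: \<sigma>_def interior_cball)
    obtain CN where CN: "CN-lipschitz_on (cball 0 \<sigma>) (N i)" using N[OF \<sigma>(1)] by blast
    obtain BN where BN: "\<And>y. y \<in> cball 0 \<sigma> \<Longrightarrow> \<bar>N i y\<bar> \<le> BN" using lipschitz_on_cball_bounded[OF CN] by blast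
    have cN: "continuous_on ?K (N i)" by (rule continuous_on_subset[OF lipschitz_on_continuous_on[OF CN] \<sigma>(2)])
    have m1: "(\<lambda>y. indicator ?K y * N i y) \<in> borel_measurable lborel"
      using borel_measurable_continuous_on_indicator[OF _ cN] by (simp add: mult.commute)
    have L: "set_integrable lborel ?K (G i)" "\<And>k. set_integrable lborel ?K (F i k)" "(\<lambda>k. LINT x:?K|lborel. \<bar>F i k x - G i x\<bar>) \<longlonglongrightarrow> 0"
      using FG[of i] sub compact_cbox unfolding L1_loc_tendsto_def by blast+
    have L': "set_integrable lborel ?K (G' i)" "\<And>k. set_integrable lborel ?K (F' i k)" "(\<lambda>k. LINT x:?K|lborel. \<bar>F' i k x - G' i x\<bar>) \<longlonglongrightarrow> 0"
      using FG'[of i] sub compact_cbox unfolding L1_loc_tendsto_def by blast+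
    have "set_integrable lborel ?K (\<lambda>y. (indicator ?K y * N i y) * G' i y)"
      by (rule tendsto_set_integral_mult_bounded(1)[OF L' m1, of BN]) (use \<sigma>(2) BN in \<open>auto intro!: AE_I2\<close>)
    then show "set_integrable lborel ?K (\<lambda>y. N i y * G' i y)"
      unfolding set_integrable_def by (rule Bochner_Integration.integrable_cong[THEN iffD1, rotated -1]) (auto simp: indicator_def)
    have "AE y in lborel. y \<in> ?K \<longrightarrow> \<bar>indicator (ball 0 r) y * DN i y\<bar> \<le> CN"
      using N_deriv[of i]
    proof eventually_elim
      case (elim y)
      have "norm (axis l (1::real)) = 1" by simp
      from directional_derivative_bound[OF CN _ this] show ?case using \<sigma>(3) sub elim by (auto simp: indicator_def)
    qed
    from tendsto_set_integral_mult_bounded(1)[OF L _ this]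
    have "set_integrable lborel ?K (\<lambda>y. (indicator (ball 0 r) y * DN i y) * G i y)" using DN[of i] by simp
    then show "set_integrable lborel ?K (\<lambda>y. DN i y * G i y)"
      unfolding set_integrable_def
      by (rule Bochner_Integration.integrable_cong[THEN iffD1, rotated -1]) (use sub in \<open>auto simp: indicator_def\<close>)
  qed
  fix a b :: "real^'n" and c :: real
  assume sub: "cbox a b \<subseteq> ball 0 r" and ab: "\<And>j. a $ j < b $ j" "c > 0"
  let ?K = "cbox a b"
  define \<eta> where "\<eta> = box_bump a b c (\<lambda>_. 0)"
  define \<eta>' where "\<eta>' = box_bump a b c ((\<lambda>_. 0)(l := Suc 0))"
  note P = weak_product_rule[OF r N N_deriv DN F F_deriv FG FG' sub ab, folded \<eta>_def \<eta>'_def]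
  have i12: "set_integrable lborel ?K (\<lambda>y. (\<eta> y * N i y) * G' i y + (\<eta> y * DN i y) * G i y)" for i
    by (rule set_integral_add(1)[OF P(1,2)])
  have "(LINT y|lborel. (\<Sum>i\<in>UNIV. N i y * G' i y + DN i y * G i y) * \<eta> y)
     = (LINT y:?K|lborel. \<Sum>i\<in>UNIV. (\<eta> y * N i y) * G' i y + (\<eta> y * DN i y) * G i y)"
    unfolding set_lebesgue_integral_def
  proof (intro Bochner_Integration.integral_cong refl)
    fix y
    have "\<eta> y = 0" if "y \<notin> ?K" using that box_subset_cbox[of a b] by (auto simp: \<eta>_def intro!: box_bump_outside)
    then show "(\<Sum>i\<in>UNIV. N i y * G' i y + DN i y * G i y) * \<eta> y
       = indicator ?K y *\<^sub>R (\<Sum>i\<in>UNIV. (\<eta> y * N i y) * G' i y + (\<eta> y * DN i y) * G i y)"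
      by (cases "y \<in> ?K") (auto simp: sum_distrib_left algebra_simps)
  qed
  also have "\<dots> = (\<Sum>i\<in>UNIV. LINT y:?K|lborel. (\<eta> y * N i y) * G' i y + (\<eta> y * DN i y) * G i y)"
    by (rule set_integral_finite_sum(2)[OF i12])
  also have "\<dots> = (\<Sum>i\<in>UNIV. - (LINT y:?K|lborel. (\<eta>' y * N i y) * G i y))"
  proof (rule sum.cong[OF refl])
    fix i
    show "(LINT y:?K|lborel. (\<eta> y * N i y) * G' i y + (\<eta> y * DN i y) * G i y) = - (LINT y:?K|lborel. (\<eta>' y * N i y) * G i y)"
      using P(4)[of i i] set_integral_add(2)[OF P(1,2), of i i i] by simp
  qed
  also have "\<dots> = - (LINT y:?K|lborel. \<Sum>i\<in>UNIV. (\<eta>' y * N i y) * G i y)"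
    unfolding sum_negf by (subst set_integral_finite_sum(2)[OF P(3)]) auto
  also have "(LINT y:?K|lborel. \<Sum>i\<in>UNIV. (\<eta>' y * N i y) * G i y) = (LINT y|(lborel :: (real^'n) measure). 0)"
    unfolding set_lebesgue_integral_def
  proof (rule integral_cong_AE)
    show "(\<lambda>y. indicator ?K y *\<^sub>R (\<Sum>i\<in>UNIV. (\<eta>' y * N i y) * G i y)) \<in> borel_measurable lborel"
    proof -
      have "set_integrable lborel ?K (\<lambda>y. \<Sum>i\<in>UNIV. (\<eta>' y * N i y) * G i y)"
        by (rule set_integral_finite_sum(1)[OF P(3)])
      then show ?thesis by (auto simp: set_integrable_def)
    qed
    show "AE y in lborel. indicator ?K y *\<^sub>R (\<Sum>i\<in>UNIV. (\<eta>' y * N i y) * G i y) = 0"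
      using orth
    proof eventually_elim
      case (elim y)
      have "(\<Sum>i\<in>UNIV. (\<eta>' y * N i y) * G i y) = \<eta>' y * (\<Sum>i\<in>UNIV. N i y * G i y)"
        by (simp add: sum_distrib_left mult.assoc)
      then show ?case using elim sub by (cases "y \<in> ?K") auto
    qed
  qed simp
  finally show "(LINT y|lborel. (\<Sum>i\<in>UNIV. N i y * G' i y + DN i y * G i y) * box_bump a b c (\<lambda>_. 0) y) = 0"
    by (simp add: \<eta>_def)
qed

text \<open>A pointwise limit of difference quotients along a sequence is measurable, and it agrees with the
  derivative wherever that exists.\<close>

lemma measurable_directional_derivative:
  fixes N :: "'a::euclidean_space \<Rightarrow> real"
  assumes U: "open U" and N: "continuous_on U N"
  obtains DN where "DN \<in> borel_measurable borel"
    "\<And>y d. y \<in> U \<Longrightarrow> ((\<lambda>t. N (y + t *\<^sub>R e)) has_real_derivative d) (at 0) \<Longrightarrow> DN y = d"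
proof -
  define M where "M y = indicator U y * N y" for y
  have [measurable]: "M \<in> borel_measurable borel"
    unfolding M_def using borel_measurable_continuous_on_indicator[OF _ N] U by (simp add: mult.commute)
  define t where "t m = inverse (real (Suc m))" for m
  define DN where "DN y = lim (\<lambda>m. (M (y + t m *\<^sub>R e) - M y) / t m)" for y
  have t0: "t \<longlonglongrightarrow> 0" unfolding t_def by (rule LIMSEQ_inverse_real_of_nat)
  have tpos: "t m > 0" for m by (simp add: t_def)
  show thesis
  proof (rule that)
    show "DN \<in> borel_measurable borel" unfolding DN_def by measurable
    fix y d assume y: "y \<in> U" and d: "((\<lambda>t. N (y + t *\<^sub>R e)) has_real_derivative d) (at 0)"
    have "((\<lambda>h. (N (y + h *\<^sub>R e) - N y) / h) \<longlongrightarrow> d) (at 0)"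
      using d by (simp add: has_field_derivative_iff)
    moreover have "filterlim t (at 0) sequentially"
      using t0 tpos by (auto simp: filterlim_at less_imp_neq[symmetric] intro!: always_eventually)
    ultimately have l: "(\<lambda>m. (N (y + t m *\<^sub>R e) - N y) / t m) \<longlonglongrightarrow> d" by (rule filterlim_compose)
    have "(\<lambda>m. y + t m *\<^sub>R e) \<longlonglongrightarrow> y + 0 *\<^sub>R e" by (intro tendsto_intros t0)
    then have "\<forall>\<^sub>F m in sequentially. y + t m *\<^sub>R e \<in> U"
      using U y by (intro topological_tendstoD) auto
    then have "\<forall>\<^sub>F m in sequentially. (N (y + t m *\<^sub>R e) - N y) / t m = (M (y + t m *\<^sub>R e) - M y) / t m"
      by eventually_elim (simp add: M_def y)
    then have "(\<lambda>m. (M (y + t m *\<^sub>R e) - M y) / t m) \<longlonglongrightarrow> d"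
      by (rule Lim_transform_eventually[OF l])
    then show "DN y = d" unfolding DN_def by (rule limI)
  qed
qed

lemma L1_loc_tendsto_mult_continuous:
  fixes b :: "'a::euclidean_space \<Rightarrow> real"
  assumes b: "continuous_on S b" and f: "L1_loc_tendsto S f u"
  shows "L1_loc_tendsto S (\<lambda>k y. b y * f k y) (\<lambda>y. b y * u y)"
  unfolding L1_loc_tendsto_def
proof (intro allI impI, elim conjE)
  fix K assume K: "compact K" "K \<subseteq> S"
  note F = L1_loc_tendsto_onD[OF f K]
  have cb: "continuous_on K b" by (rule continuous_on_subset[OF b K(2)])
  have [measurable]: "K \<in> sets borel" using K by (simp add: compact_imp_closed)
  define b' where "b' y = indicator K y * b y" for y
  have m: "b' \<in> borel_measurable lborel"
    unfolding b'_def using borel_measurable_continuous_on_indicator[OF _ cb] by (simp add: mult.commute)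
  then have m': "(\<lambda>y. \<bar>b' y\<bar>) \<in> borel_measurable lborel" by measurable
  have "bounded (b ` K)" by (intro compact_imp_bounded compact_continuous_image cb K)
  then obtain B where B: "\<forall>y\<in>b ` K. norm y \<le> B" unfolding bounded_pos by blast
  have bd: "AE y in lborel. y \<in> K \<longrightarrow> \<bar>b' y\<bar> \<le> B" using B by (intro AE_I2) (auto simp: b'_def)
  then have bd': "AE y in lborel. y \<in> K \<longrightarrow> \<bar>\<bar>b' y\<bar>\<bar> \<le> B" by simp
  have e: "indicator K y *\<^sub>R (b' y * x) = indicator K y *\<^sub>R (b y * x)" for y x by (auto simp: b'_def indicator_def)
  have z: "set_integrable lborel K (\<lambda>_. 0::real)" by (simp add: set_integrable_def)
  have i: "set_integrable lborel K (\<lambda>y. b y * u y)" "\<And>k. set_integrable lborel K (\<lambda>y. b y * f k y)"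
    using tendsto_set_integral_mult_bounded(1,2)[OF F m bd] unfolding set_integrable_def e by blast+
  have d: "set_integrable lborel K (\<lambda>x. \<bar>f k x - u x\<bar>)" for k by (rule set_integrable_abs_diff[OF F(2,1)])
  have "(\<lambda>k. LINT x:K|lborel. \<bar>b' x\<bar> * \<bar>f k x - u x\<bar>) \<longlonglongrightarrow> (LINT x:K|lborel. \<bar>b' x\<bar> * 0)"
    by (rule tendsto_set_integral_mult_bounded(3)[OF z d _ m' bd']) (use F(3) in simp)
  moreover have "(LINT x:K|lborel. \<bar>b' x\<bar> * \<bar>f k x - u x\<bar>) = (LINT x:K|lborel. \<bar>b x * f k x - b x * u x\<bar>)" for k
    unfolding set_lebesgue_integral_def
    by (intro Bochner_Integration.integral_cong refl) (auto simp: b'_def indicator_def right_diff_distrib[symmetric] abs_mult)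
  ultimately have "(\<lambda>k. LINT x:K|lborel. \<bar>b x * f k x - b x * u x\<bar>) \<longlonglongrightarrow> 0"
    by (simp add: set_lebesgue_integral_def)
  with i show "set_integrable lborel K (\<lambda>y. b y * u y) \<and> (\<forall>k. set_integrable lborel K (\<lambda>y. b y * f k y))
     \<and> (\<lambda>k. LINT x:K|lborel. \<bar>b x * f k x - b x * u x\<bar>) \<longlonglongrightarrow> 0" by blast
qed

lemma L1_loc_tendsto_abs_diff:
  assumes f: "L1_loc_tendsto S f u"
  shows "L1_loc_tendsto S (\<lambda>k y. \<bar>f k y - u y\<bar>) (\<lambda>_. 0)"
  unfolding L1_loc_tendsto_def
proof (intro allI impI, elim conjE)
  fix K assume K: "compact K" "K \<subseteq> S"
  note F = L1_loc_tendsto_onD[OF f K]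
  have "set_integrable lborel K (\<lambda>x. \<bar>f k x - u x\<bar>)" for k by (rule set_integrable_abs_diff[OF F(2,1)])
  with F(3) show "set_integrable lborel K (\<lambda>_. 0 :: real) \<and> (\<forall>k. set_integrable lborel K (\<lambda>y. \<bar>f k y - u y\<bar>))
     \<and> (\<lambda>k. LINT x:K|lborel. \<bar>\<bar>f k x - u x\<bar> - 0\<bar>) \<longlonglongrightarrow> 0"
    by (simp add: set_integrable_def)
qed

lemma L1_loc_tendsto_AE_subseq:
  assumes E: "L1_loc_tendsto S E (\<lambda>_. 0)" and K: "compact K" "K \<subseteq> S"
  obtains s :: "nat \<Rightarrow> nat" where "strict_mono s" "AE y in lborel. y \<in> K \<longrightarrow> (\<lambda>k. E (s k) y) \<longlonglongrightarrow> 0"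
proof -
  have F: "\<And>k. set_integrable lborel K (E k)" "(\<lambda>k. LINT x:K|lborel. \<bar>E k x - 0\<bar>) \<longlonglongrightarrow> 0"
    using E K unfolding L1_loc_tendsto_def by blast+
  have "\<exists>s. strict_mono s \<and> (AE y in lborel. (\<lambda>k. indicator K y *\<^sub>R E (s k) y) \<longlonglongrightarrow> 0)"
  proof (rule tendsto_L1_AE_subseq)
    show "integrable lborel (\<lambda>y. indicator K y *\<^sub>R E n y)" for n using F(1) by (simp add: set_integrable_def)
    show "(\<lambda>n. LINT x|lborel. norm (indicator K x *\<^sub>R E n x)) \<longlonglongrightarrow> 0"
      using F(2) by (simp add: set_lebesgue_integral_def abs_mult)
  qed
  then obtain s where s: "strict_mono s" "AE y in lborel. (\<lambda>k. indicator K y *\<^sub>R E (s k) y) \<longlonglongrightarrow> 0" by blast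
  from s(2) have "AE y in lborel. y \<in> K \<longrightarrow> (\<lambda>k. E (s k) y) \<longlonglongrightarrow> 0" by eventually_elim auto
  with s(1) show thesis by (rule that)
qed

lemma AE_open_if_AE_compact:
  fixes U :: "'a::euclidean_space set"
  assumes U: "open U" and K: "\<And>K. compact K \<Longrightarrow> K \<subseteq> U \<Longrightarrow> AE y in lborel. y \<in> K \<longrightarrow> P y"
  shows "AE y in lborel. y \<in> U \<longrightarrow> P y"
proof -
  obtain D where D: "countable D" "D \<subseteq> Pow U" "\<And>X. X \<in> D \<Longrightarrow> \<exists>a b. X = cbox a b" "\<Union>D = U"
    using open_countable_Union_open_cbox[OF U] by blast
  have "AE x in lborel. \<forall>X\<in>D. x \<in> X \<longrightarrow> P x"
  proof (subst AE_ball_countable[OF D(1)], intro ballI)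
    fix X assume X: "X \<in> D"
    obtain a b where ab: "X = cbox a b" using D(3)[OF X] by auto
    show "AE x in lborel. x \<in> X \<longrightarrow> P x" using X D(2) ab by (intro K) auto
  qed
  then show ?thesis by eventually_elim (use D(4) in auto)
qed

text \<open>Products of \<open>L\<^sup>1\<close> limits need not be \<open>L\<^sup>1\<close> limits, but if the products do converge, the limit can be
  identified pointwise along one subsequence on which all finitely many errors tend to zero almost
  everywhere.\<close>

lemma L1_loc_limit_of_products:
  fixes f g :: "'j::finite \<Rightarrow> nat \<Rightarrow> 'a::euclidean_space \<Rightarrow> real"
  assumes S: "open S" and f: "\<And>j. L1_loc_tendsto S (f j) (u j)" and g: "\<And>j. L1_loc_tendsto S (g j) (v j)"
    and w: "L1_loc_tendsto S (\<lambda>k y. \<Sum>j\<in>UNIV. 2 * f j k y * g j k y) w"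
  shows "AE y in lborel. y \<in> S \<longrightarrow> w y = (\<Sum>j\<in>UNIV. 2 * u j y * v j y)"
proof (rule AE_open_if_AE_compact[OF S])
  fix K assume K: "compact K" "K \<subseteq> S"
  define E where "E k y = \<bar>(\<Sum>j\<in>UNIV. 2 * f j k y * g j k y) - w y\<bar>
      + (\<Sum>j\<in>UNIV. \<bar>f j k y - u j y\<bar> + \<bar>g j k y - v j y\<bar>)" for k y
  have "L1_loc_tendsto S (\<lambda>k y. \<bar>(\<Sum>j\<in>UNIV. 2 * f j k y * g j k y) - w y\<bar>
      + (\<Sum>j\<in>UNIV. \<bar>f j k y - u j y\<bar> + \<bar>g j k y - v j y\<bar>)) (\<lambda>y. 0 + (\<Sum>j\<in>(UNIV::'j set). 0 + 0))"
    by (intro L1_loc_tendsto_add L1_loc_tendsto_sum L1_loc_tendsto_abs_diff f g w) auto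
  then have "L1_loc_tendsto S E (\<lambda>_. 0)" by (simp add: E_def[abs_def])
  then obtain s where s: "strict_mono s" "AE y in lborel. y \<in> K \<longrightarrow> (\<lambda>k. E (s k) y) \<longlonglongrightarrow> 0"
    using L1_loc_tendsto_AE_subseq[OF _ K] by blast
  from s(2) show "AE y in lborel. y \<in> K \<longrightarrow> w y = (\<Sum>j\<in>UNIV. 2 * u j y * v j y)"
  proof eventually_elim
    case (elim y)
    show ?case
    proof
      assume "y \<in> K"
      then have E0: "(\<lambda>k. E (s k) y) \<longlonglongrightarrow> 0" using elim by blast
      have conv0: "X \<longlonglongrightarrow> x" if "\<And>k. \<bar>X k - x\<bar> \<le> E (s k) y" for X :: "nat \<Rightarrow> real" and x
        by (rule LIM_zero_cancel, rule Lim_null_comparison[OF _ E0]) (use that in auto)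
      have s0: "0 \<le> (\<Sum>j\<in>UNIV. \<bar>f j k y - u j y\<bar> + \<bar>g j k y - v j y\<bar>)" for k by (intro sum_nonneg) auto
      have sj: "\<bar>f j k y - u j y\<bar> + \<bar>g j k y - v j y\<bar> \<le> (\<Sum>j\<in>UNIV. \<bar>f j k y - u j y\<bar> + \<bar>g j k y - v j y\<bar>)" for j k
        by (rule member_le_sum) auto
      have le: "\<bar>f j k y - u j y\<bar> \<le> E k y" "\<bar>g j k y - v j y\<bar> \<le> E k y" for j k
        using sj[where j = j and k = k] unfolding E_def by (smt (verit))+
      have fu: "(\<lambda>k. f j (s k) y) \<longlonglongrightarrow> u j y" for j by (rule conv0[OF le(1)])
      have gv: "(\<lambda>k. g j (s k) y) \<longlonglongrightarrow> v j y" for j by (rule conv0[OF le(2)])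
      have w1: "(\<lambda>k. \<Sum>j\<in>UNIV. 2 * f j (s k) y * g j (s k) y) \<longlonglongrightarrow> w y"
        by (rule conv0) (use s0 in \<open>simp add: E_def\<close>)
      have "(\<lambda>k. \<Sum>j\<in>UNIV. 2 * f j (s k) y * g j (s k) y) \<longlonglongrightarrow> (\<Sum>j\<in>UNIV. 2 * u j y * v j y)"
        by (intro tendsto_intros fu gv)
      then show "w y = (\<Sum>j\<in>UNIV. 2 * u j y * v j y)" using w1 LIMSEQ_unique by blast
    qed
  qed
qed

section \<open>Tangent vectors and normals of a graph\<close>

lemma local_graph_gradient:
  assumes "local_graph \<Omega> p R g r h"
  obtains Dg L where "\<And>y. y \<in> ball 0 r \<Longrightarrow> (g has_derivative (\<lambda>c. c \<bullet> Dg y)) (at y)" "L-lipschitz_on (ball 0 r) Dg"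
proof -
  have "C11_on (ball 0 r) g" using assms by (simp add: local_graph_def)
  then obtain G L where "\<forall>y\<in>ball 0 r. GDERIV g y :> G y" "L-lipschitz_on (ball 0 r) G"
    unfolding C11_on_def by blast
  then show thesis by (intro that[of G L]) (auto simp: gderiv_def)
qed

text \<open>The derivative of \<open>graph_point p R g\<close> in direction \<open>c\<close>, where \<open>D\<close> is the gradient of \<open>g\<close>.\<close>

definition tangent_vector :: "(real^3 \<Rightarrow> real^3) \<Rightarrow> real^2 \<Rightarrow> real^2 \<Rightarrow> real^3" where
  "tangent_vector R D c = R (lift c (c \<bullet> D))"

text \<open>The upward normal of the graph, not normalised: it depends affinely on the gradient \<open>D\<close>.\<close>

definition graph_normal :: "(real^3 \<Rightarrow> real^3) \<Rightarrow> real^2 \<Rightarrow> real^3" where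
  "graph_normal R D = R (lift (- D) 1)"

lemma graph_point_has_derivative:
  assumes R: "orthogonal_transformation R" and g: "(g has_derivative (\<lambda>c. c \<bullet> D)) (at y)"
  shows "(graph_point p R g has_derivative tangent_vector R D) (at y)"
proof -
  have lin: "bounded_linear R"
    using orthogonal_transformation_linear[OF R] by (simp add: linear_conv_bounded_linear)
  have "((\<lambda>y. lift y (g y)) has_derivative (\<lambda>c. lift c (c \<bullet> D))) (at y)"
    unfolding lift_eq
    by (auto intro!: derivative_eq_intros g bounded_linear_imp_has_derivative bounded_linear_vec_nth)
  then have "((\<lambda>y. p + R (lift y (g y))) has_derivative (\<lambda>c. 0 + R (lift c (c \<bullet> D)))) (at y)"
    by (intro has_derivative_add has_derivative_const bounded_linear.has_derivative[OF lin])
  then show ?thesis by (simp add: graph_point_def[abs_def] tangent_vector_def[abs_def])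
qed

lemma linear_tangent_vector:
  assumes R: "orthogonal_transformation R"
  shows "linear (tangent_vector R D)"
proof -
  have lin: "linear R" by (rule orthogonal_transformation_linear[OF R])
  show ?thesis
  proof (rule linearI)
    fix x y :: "real^2" and c :: real
    show "tangent_vector R D (x + y) = tangent_vector R D x + tangent_vector R D y"
      unfolding tangent_vector_def by (simp add: inner_add_left lift_add linear_add[OF lin])
    show "tangent_vector R D (c *\<^sub>R x) = c *\<^sub>R tangent_vector R D x"
      unfolding tangent_vector_def by (simp add: lift_scaleR linear_cmul[OF lin])
  qed
qed

text \<open>The chart maps into the frontier of \<open>\<Omega>\<close>, within which the derivative of \<open>\<nu> \<bullet> y\<close> vanishes; compare it
  with the derivative given by the chain rule.\<close>

lemma normal_orthogonal_tangent:
  assumes ch: "graph_chart \<Omega> \<Gamma> p R g r h" and y: "y \<in> ball 0 r"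
    and g: "(g has_derivative (\<lambda>c. c \<bullet> D)) (at y)"
    and \<nu>: "outward_unit_normal \<Omega> (graph_point p R g y) \<nu>"
  shows "\<nu> \<bullet> tangent_vector R D c = 0"
proof -
  have lg: "local_graph \<Omega> p R g r h" using ch by (simp add: graph_chart_def)
  have R: "orthogonal_transformation R" using lg by (simp add: local_graph_def)
  have fr: "graph_point p R g ` ball 0 r \<subseteq> frontier \<Omega>"
    using lg by (auto simp: local_graph_def graph_point_def)
  have d: "(graph_point p R g has_derivative tangent_vector R D) (at y within ball 0 r)"
    by (rule has_derivative_at_withinI[OF graph_point_has_derivative[OF R g]])
  have "((\<lambda>z. \<nu> \<bullet> z) has_derivative (\<lambda>_. 0)) (at (graph_point p R g y) within graph_point p R g ` ball 0 r)"
    using \<nu> fr by (auto simp: outward_unit_normal_def intro: has_derivative_subset)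
  from has_derivative_in_compose[OF d this]
  have 1: "((\<lambda>z. \<nu> \<bullet> graph_point p R g z) has_derivative (\<lambda>c. 0)) (at y)"
    using y by (simp add: at_within_open[OF y])
  have 2: "((\<lambda>z. \<nu> \<bullet> graph_point p R g z) has_derivative (\<lambda>c. \<nu> \<bullet> tangent_vector R D c)) (at y)"
    by (rule has_derivative_inner_right[OF graph_point_has_derivative[OF R g]])
  show ?thesis using has_derivative_unique[OF 1 2] by metis
qed

lemma inner_orthogonal: "orthogonal_transformation R \<Longrightarrow> R x \<bullet> R y = x \<bullet> y"
  by (simp add: orthogonal_transformation_def)

lemma lift_cases:
  fixes \<mu> :: "real^3"
  obtains m t where "\<mu> = lift m t"
  by (rule that[of "vector [\<mu> $ 1, \<mu> $ 2]" "\<mu> $ 3"]) (simp add: vec_eq_iff forall_3 vector_2)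

text \<open>The factor is expressed by \<open>\<nu>\<close> itself as its component along the axis of the graph. In this way the
  relation can be solved for the graph normal and differentiated wherever \<open>\<nu>\<close> is differentiable.\<close>

lemma unit_normal_eq_graph_normal:
  assumes R: "orthogonal_transformation R" and orth: "\<And>c. \<nu> \<bullet> tangent_vector R D c = 0" and n1: "norm \<nu> = 1"
  shows "\<nu> = (\<nu> \<bullet> R (axis 3 1)) *\<^sub>R graph_normal R D" and "\<nu> \<bullet> R (axis 3 1) \<noteq> 0"
proof -
  have lin: "linear R" by (rule orthogonal_transformation_linear[OF R])
  obtain \<mu> where "\<nu> = R \<mu>" using surjD[OF orthogonal_transformation_surj[OF R]] by blast
  then obtain m t where \<mu>: "\<nu> = R (lift m t)" using lift_cases by metis
  have s: "\<nu> \<bullet> R (axis 3 1) = t" by (simp add: \<mu> inner_orthogonal[OF R] inner_axis)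
  have "(m + t *\<^sub>R D) \<bullet> c = 0" for c
    using orth[of c] by (simp add: \<mu> tangent_vector_def inner_orthogonal[OF R] lift_inner inner_add_left inner_commute[of c D])
  then have "m + t *\<^sub>R D = 0" using inner_eq_zero_iff by blast
  then have "m = t *\<^sub>R (- D)" by (simp add: add_eq_0_iff2)
  then have "lift m t = t *\<^sub>R lift (- D) 1" using lift_scaleR[of t "- D" 1] by simp
  then show e: "\<nu> = (\<nu> \<bullet> R (axis 3 1)) *\<^sub>R graph_normal R D"
    unfolding s by (simp add: \<mu> graph_normal_def linear_cmul[OF lin])
  then show "\<nu> \<bullet> R (axis 3 1) \<noteq> 0" using n1 by (metis norm_zero scale_zero_left zero_neq_one)
qed

lemma orthogonal_to_normal_imp_tangent:
  assumes R: "orthogonal_transformation R" and v: "v \<bullet> graph_normal R D = 0"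
  obtains c where "v = tangent_vector R D c"
proof -
  obtain \<mu> where "v = R \<mu>" using surjD[OF orthogonal_transformation_surj[OF R]] by blast
  then obtain m t where \<mu>: "v = R (lift m t)" using lift_cases by metis
  have "t = m \<bullet> D" using v by (simp add: \<mu> graph_normal_def inner_orthogonal[OF R] lift_inner)
  then show thesis using \<mu> by (intro that[of m]) (simp add: tangent_vector_def)
qed

section \<open>Smooth functions and the normal field in a chart\<close>

lemma smooth_on_chart_lipschitz:
  assumes lg: "local_graph \<Omega> p R g r h"
    and g: "\<And>y. y \<in> ball 0 r \<Longrightarrow> (g has_derivative (\<lambda>c. c \<bullet> Dg y)) (at y)" and Dg: "L-lipschitz_on (ball 0 r) Dg"
    and f: "smooth f" and \<rho>: "\<rho> < r"
  shows "\<exists>C. C-lipschitz_on (cball 0 \<rho>) (\<lambda>y. f (graph_point p R g y))"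
proof (cases "\<rho> < 0")
  case True
  then show ?thesis by (intro exI[of _ 0]) (simp add: lipschitz_on_empty_iff)
next
  case False
  have R: "orthogonal_transformation R" using lg by (simp add: local_graph_def)
  have sub: "cball (0::real^2) \<rho> \<subseteq> ball 0 r" using \<rho> by auto
  have "continuous_on (cball 0 \<rho>) Dg"
    by (rule continuous_on_subset[OF lipschitz_on_continuous_on[OF Dg] sub])
  then have "bounded (Dg ` cball 0 \<rho>)" by (intro compact_imp_bounded compact_continuous_image compact_cball)
  then obtain B where B: "B > 0" "\<forall>z\<in>Dg ` cball 0 \<rho>. norm z \<le> B" unfolding bounded_pos by blast
  have tv: "norm (tangent_vector R (Dg y) c) \<le> (1 + B) * norm c" if "y \<in> cball 0 \<rho>" for y c
  proof -
    have "norm (tangent_vector R (Dg y) c) \<le> norm c + \<bar>c \<bullet> Dg y\<bar>"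
      unfolding tangent_vector_def orthogonal_transformation_norm[OF R] by (rule norm_lift)
    also have "\<dots> \<le> norm c + norm c * B"
      using B that by (intro add_left_mono order_trans[OF Cauchy_Schwarz_ineq2] mult_left_mono) auto
    finally show ?thesis by (simp add: algebra_simps)
  qed
  have cg: "continuous_on (cball 0 \<rho>) (graph_point p R g)"
    by (rule continuous_on_subset[OF continuous_graph_point[OF lg] sub])
  have "\<exists>M>0. \<forall>y\<in>cball 0 \<rho>. \<bar>partial j f (graph_point p R g y)\<bar> \<le> M" for j
  proof -
    have "continuous_on (cball 0 \<rho>) (\<lambda>y. partial j f (graph_point p R g y))"
      by (rule continuous_on_compose2[OF smooth_continuous[OF smooth_partial[OF f], of UNIV] cg]) auto
    then have "bounded ((\<lambda>y. partial j f (graph_point p R g y)) ` cball 0 \<rho>)"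
      by (intro compact_imp_bounded compact_continuous_image compact_cball)
    then show ?thesis unfolding bounded_pos by auto
  qed
  then obtain M where M: "\<And>j. M j > 0" "\<And>j y. y \<in> cball 0 \<rho> \<Longrightarrow> \<bar>partial j f (graph_point p R g y)\<bar> \<le> M j" by metis
  define C where "C = (\<Sum>j\<in>UNIV. (1 + B) * M j)"
  have "C-lipschitz_on (cball 0 \<rho>) (\<lambda>y. f (graph_point p R g y))"
  proof (rule bounded_derivative_imp_lipschitz)
    fix y :: "real^2" assume y: "y \<in> cball 0 \<rho>"
    then have yb: "y \<in> ball 0 r" using sub by blast
    show "((\<lambda>y. f (graph_point p R g y)) has_derivative (\<lambda>c. \<Sum>j\<in>UNIV. tangent_vector R (Dg y) c $ j * partial j f (graph_point p R g y))) (at y within cball 0 \<rho>)"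
      by (rule has_derivative_at_withinI[OF has_derivative_compose[OF graph_point_has_derivative[OF R g[OF yb]]
            has_derivative_partial[OF smooth_differentiable[OF f]]]])
    show "onorm (\<lambda>c. \<Sum>j\<in>UNIV. tangent_vector R (Dg y) c $ j * partial j f (graph_point p R g y)) \<le> C"
    proof (rule onorm_le)
      fix c :: "real^2"
      have "\<bar>\<Sum>j\<in>UNIV. tangent_vector R (Dg y) c $ j * partial j f (graph_point p R g y)\<bar> \<le> (\<Sum>j\<in>UNIV. ((1 + B) * norm c) * M j)"
        using y B(1) by (intro order_trans[OF sum_abs] sum_mono)
          (auto simp: abs_mult intro!: mult_mono order_trans[OF component_le_norm_cart tv] M)
      then show "norm (\<Sum>j\<in>UNIV. tangent_vector R (Dg y) c $ j * partial j f (graph_point p R g y)) \<le> C * norm c"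
        by (simp add: C_def sum_distrib_left sum_distrib_right mult_ac)
    qed
  qed (use B(1) in \<open>auto simp: C_def intro!: sum_nonneg mult_nonneg_nonneg less_imp_le[OF M(1)]\<close>)
  then show ?thesis ..
qed

lemma smooth_on_chart_directional_derivative:
  assumes R: "orthogonal_transformation R" and g: "(g has_derivative (\<lambda>c. c \<bullet> D)) (at y)" and f: "smooth f"
  shows "((\<lambda>t. f (graph_point p R g (y + t *\<^sub>R e))) has_real_derivative
     (\<Sum>j\<in>UNIV. tangent_vector R D e $ j * partial j f (graph_point p R g y))) (at 0)"
proof -
  have d1: "((\<lambda>t. y + t *\<^sub>R e) has_derivative (\<lambda>t. t *\<^sub>R e)) (at 0)"
    by (auto intro!: derivative_eq_intros)
  have d2: "((\<lambda>y. f (graph_point p R g y)) has_derivative (\<lambda>c. \<Sum>j\<in>UNIV. tangent_vector R D c $ j * partial j f (graph_point p R g y))) (at (y + 0 *\<^sub>R e))"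
    using has_derivative_compose[OF graph_point_has_derivative[OF R g] has_derivative_partial[OF smooth_differentiable[OF f]]] by simp
  from has_derivative_compose[OF d1 d2] show ?thesis
    unfolding has_field_derivative_def
    by (rule has_derivative_eq_rhs)
      (simp add: fun_eq_iff linear_cmul[OF linear_tangent_vector[OF R]] sum_distrib_left mult_ac)
qed

lemma graph_normal_lipschitz:
  assumes R: "orthogonal_transformation R" and Dg: "L-lipschitz_on S Dg"
  shows "L-lipschitz_on S (\<lambda>y. graph_normal R (Dg y) $ i)"
proof (rule lipschitz_onI)
  have lin: "linear R" by (rule orthogonal_transformation_linear[OF R])
  fix x y assume xy: "x \<in> S" "y \<in> S"
  have "graph_normal R (Dg x) - graph_normal R (Dg y) = R (lift (- (Dg x - Dg y)) 0)"
  proof -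
    have "lift (- Dg x) 1 - lift (- Dg y) 1 = lift (- (Dg x - Dg y)) 0"
      by (simp add: vec_eq_iff forall_3)
    then show ?thesis unfolding graph_normal_def by (metis linear_diff[OF lin])
  qed
  then have "norm (graph_normal R (Dg x) - graph_normal R (Dg y)) \<le> norm (Dg x - Dg y)"
    using norm_lift[of "- (Dg x - Dg y)" 0] orthogonal_transformation_norm[OF R] by (simp add: norm_minus_commute)
  also have "\<dots> \<le> L * dist x y" using lipschitz_onD[OF Dg xy] by (simp add: dist_norm)
  finally show "dist (graph_normal R (Dg x) $ i) (graph_normal R (Dg y) $ i) \<le> L * dist x y"
    using component_le_norm_cart[of "graph_normal R (Dg x) - graph_normal R (Dg y)" i]
    by (simp add: dist_real_def)
qed (rule lipschitz_on_nonneg[OF Dg])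

text \<open>The graph normal is \<open>n\<close> divided by its component along the axis of the graph, so it inherits
  differentiability along \<open>\<Gamma>\<close> from \<open>n\<close>. The derivative is that of \<open>n\<close>, rescaled, plus a multiple of \<open>n\<close>.\<close>

lemma graph_normal_has_derivative:
  assumes ch: "graph_chart \<Omega> \<Gamma> p R g r h"
    and g: "\<And>y. y \<in> ball 0 r \<Longrightarrow> (g has_derivative (\<lambda>c. c \<bullet> Dg y)) (at y)"
    and n: "\<forall>x\<in>\<Gamma>. outward_unit_normal \<Omega> x (n x)"
    and y: "y \<in> ball 0 r" and diff: "n differentiable (at (graph_point p R g y) within \<Gamma>)"
  defines "A \<equiv> frechet_derivative n (at (graph_point p R g y) within \<Gamma>)" and "s \<equiv> n (graph_point p R g y) \<bullet> R (axis 3 1)"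
  shows "((\<lambda>y. graph_normal R (Dg y)) has_derivative
     (\<lambda>c. (1 / s) *\<^sub>R A (tangent_vector R (Dg y) c)
        - ((A (tangent_vector R (Dg y) c) \<bullet> R (axis 3 1)) / s\<^sup>2) *\<^sub>R n (graph_point p R g y))) (at y)"
proof -
  have R: "orthogonal_transformation R" using ch by (simp add: graph_chart_def local_graph_def)
  have in\<Gamma>: "graph_point p R g z \<in> \<Gamma>" if "z \<in> ball 0 r" for z using ch that by (simp add: graph_chart_def)
  let ?e = "R (axis 3 1)" and ?m = "\<lambda>z. n (graph_point p R g z)"
  have orth: "?m z \<bullet> tangent_vector R (Dg z) c = 0" if "z \<in> ball 0 r" for z c
    by (rule normal_orthogonal_tangent[OF ch that g[OF that]]) (use n in\<Gamma>[OF that] in blast)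
  have n1: "norm (?m z) = 1" if "z \<in> ball 0 r" for z
    using n in\<Gamma>[OF that] by (auto simp: outward_unit_normal_def)
  note U = unit_normal_eq_graph_normal[OF R orth n1]
  have eq: "graph_normal R (Dg z) = (1 / (?m z \<bullet> ?e)) *\<^sub>R ?m z" if "z \<in> ball 0 r" for z
  proof -
    have "(1 / (?m z \<bullet> ?e)) *\<^sub>R ?m z = (1 / (?m z \<bullet> ?e)) *\<^sub>R ((?m z \<bullet> ?e) *\<^sub>R graph_normal R (Dg z))"
      using U(1)[OF that that] by simp
    also have "\<dots> = graph_normal R (Dg z)" using U(2)[OF that that] by simp
    finally show ?thesis by simp
  qed
  have s0: "s \<noteq> 0" using U(2)[OF y y] by (simp add: s_def)
  have "(n has_derivative A) (at (graph_point p R g y) within \<Gamma>)"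
    using diff unfolding A_def by (simp add: frechet_derivative_works)
  then have "(n has_derivative A) (at (graph_point p R g y) within graph_point p R g ` ball 0 r)"
    by (rule has_derivative_subset) (use in\<Gamma> in auto)
  from has_derivative_in_compose[OF has_derivative_at_withinI[OF graph_point_has_derivative[OF R g[OF y]]] this]
  have dm: "(?m has_derivative (\<lambda>c. A (tangent_vector R (Dg y) c))) (at y)"
    by (simp add: at_within_open[OF y])
  have ds: "((\<lambda>z. ?m z \<bullet> ?e) has_derivative (\<lambda>c. A (tangent_vector R (Dg y) c) \<bullet> ?e)) (at y)"
    by (rule has_derivative_inner_left[OF dm])
  have di: "((\<lambda>z. inverse (?m z \<bullet> ?e)) has_derivative (\<lambda>c. - (inverse s * (A (tangent_vector R (Dg y) c) \<bullet> ?e) * inverse s))) (at y)"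
    unfolding s_def by (rule Deriv.has_derivative_inverse[OF _ ds]) (use s0 in \<open>simp add: s_def\<close>)
  have "((\<lambda>z. inverse (?m z \<bullet> ?e) *\<^sub>R ?m z) has_derivative
     (\<lambda>c. inverse (?m y \<bullet> ?e) *\<^sub>R A (tangent_vector R (Dg y) c) + (- (inverse s * (A (tangent_vector R (Dg y) c) \<bullet> ?e) * inverse s)) *\<^sub>R ?m y)) (at y)"
    by (rule has_derivative_scaleR[OF di dm])
  then have "((\<lambda>z. inverse (?m z \<bullet> ?e) *\<^sub>R ?m z) has_derivative
     (\<lambda>c. (1 / s) *\<^sub>R A (tangent_vector R (Dg y) c) - ((A (tangent_vector R (Dg y) c) \<bullet> ?e) / s\<^sup>2) *\<^sub>R ?m y)) (at y)"
    by (rule has_derivative_eq_rhs) (simp add: fun_eq_iff s_def[symmetric] inverse_eq_divide power2_eq_square)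
  then show ?thesis
    by (rule has_derivative_transform_within_open[OF _ open_ball y]) (use eq in \<open>simp add: inverse_eq_divide\<close>)
qed

lemma orthonormal_expansion:
  fixes v n d1 d2 :: "real^3"
  assumes "norm n = 1" "norm d1 = 1" "norm d2 = 1" "d1 \<bullet> d2 = 0" "d1 \<bullet> n = 0" "d2 \<bullet> n = 0" "v \<bullet> n = 0"
  shows "v = (d1 \<bullet> v) *\<^sub>R d1 + (d2 \<bullet> v) *\<^sub>R d2"
proof (rule ccontr)
  \<comment> \<open>a nonzero \<open>w\<close> would be a fourth nonzero vector orthogonal to three orthogonal ones\<close>
  define w where "w = v - (d1 \<bullet> v) *\<^sub>R d1 - (d2 \<bullet> v) *\<^sub>R d2"
  assume "\<not> ?thesis"
  then have w0: "w \<noteq> 0" by (simp add: w_def diff_eq_eq add.commute)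
  have nn: "n \<bullet> n = 1" "d1 \<bullet> d1 = 1" "d2 \<bullet> d2 = 1" using assms by (simp_all add: norm_eq_1)
  have o: "w \<bullet> n = 0" "w \<bullet> d1 = 0" "w \<bullet> d2 = 0"
    using assms nn by (simp_all add: w_def inner_diff_left inner_commute[of v d1] inner_commute[of v d2] inner_commute[of d2 d1])
  have "pairwise orthogonal {w, n, d1, d2}"
    using o assms by (auto simp: pairwise_insert orthogonal_def inner_commute)
  moreover have "0 \<notin> {w, n, d1, d2}" using w0 assms by auto
  ultimately have ind: "independent {w, n, d1, d2}" by (rule pairwise_orthogonal_independent)
  have "w \<noteq> n" "w \<noteq> d1" "w \<noteq> d2" "n \<noteq> d1" "n \<noteq> d2" "d1 \<noteq> d2" using o assms nn by (auto simp: inner_commute)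
  then have "card {w, n, d1, d2} = 4" by simp
  moreover have "card {w, n, d1, d2} \<le> DIM(real^3)" using independent_bound[OF ind] by simp
  ultimately show False by simp
qed

text \<open>The vectors \<open>e\<^sub>\<alpha> - n\<^sub>\<alpha> n\<close> in the definition of the Weingarten map are the tangential projections of the
  coordinate vectors, so pairing with \<open>u\<close> evaluates the derivative of \<open>n\<close> at the projection of \<open>u\<close>.\<close>

lemma inner_weingarten:
  assumes n: "n differentiable (at x within \<Gamma>)"
  shows "u \<bullet> (weingarten \<Gamma> n x *v v) = frechet_derivative n (at x within \<Gamma>) (u - (u \<bullet> n x) *\<^sub>R n x) \<bullet> v"
proof -
  let ?A = "frechet_derivative n (at x within \<Gamma>)"
  have lin: "linear ?A" by (rule linear_frechet_derivative[OF n])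
  have "u \<bullet> (weingarten \<Gamma> n x *v v) = (\<Sum>\<alpha>\<in>UNIV. u $ \<alpha> * (?A (axis \<alpha> 1 - (n x $ \<alpha>) *\<^sub>R n x) \<bullet> v))"
    by (simp add: inner_vec_def matrix_vector_mult_def weingarten_def)
  also have "\<dots> = (\<Sum>\<alpha>\<in>UNIV. ?A (u $ \<alpha> *\<^sub>R (axis \<alpha> 1 - (n x $ \<alpha>) *\<^sub>R n x))) \<bullet> v"
    by (simp add: linear_cmul[OF lin] inner_sum_left)
  also have "(\<Sum>\<alpha>\<in>UNIV. ?A (u $ \<alpha> *\<^sub>R (axis \<alpha> 1 - (n x $ \<alpha>) *\<^sub>R n x)))
      = ?A (\<Sum>\<alpha>\<in>UNIV. u $ \<alpha> *\<^sub>R (axis \<alpha> 1 - (n x $ \<alpha>) *\<^sub>R n x))"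
    by (simp add: linear_sum[OF lin])
  also have "(\<Sum>\<alpha>\<in>UNIV. u $ \<alpha> *\<^sub>R (axis \<alpha> 1 - (n x $ \<alpha>) *\<^sub>R n x)) = u - (u \<bullet> n x) *\<^sub>R n x"
  proof -
    have "(\<Sum>\<alpha>\<in>UNIV. u $ \<alpha> *\<^sub>R (axis \<alpha> 1 - (n x $ \<alpha>) *\<^sub>R n x))
        = (\<Sum>\<alpha>\<in>UNIV. u $ \<alpha> *\<^sub>R axis \<alpha> 1) - (\<Sum>\<alpha>\<in>UNIV. (u $ \<alpha> * n x $ \<alpha>) *\<^sub>R n x)"
      by (simp add: scaleR_right_diff_distrib sum_subtractf)
    then show ?thesis by (simp add: sum_axis inner_vec_def scaleR_sum_left)
  qed
  finally show ?thesis .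
qed

section \<open>Differentiating the Neumann condition\<close>

text \<open>In the chart, \<open>n \<bullet> G = 0\<close> says that the graph normal is orthogonal to \<open>G\<close>. Differentiating along the two
  coordinate directions of the chart and combining the results with the coefficients of the tangential vector
  \<open>G\<close> gives the relation in direction \<open>G\<close>. The symmetry of the second derivatives of the
  approximations lets the Hessian appear with the index order in which it enters the derivative of
  \<open>\<bar>\<nabla>\<phi>\<bar>\<^sup>2\<close>.\<close>

lemma differentiated_neumann_condition:
  fixes n :: "real^3 \<Rightarrow> real^3" and H :: "3 \<Rightarrow> 3 \<Rightarrow> real^3 \<Rightarrow> real" and G :: "real^3 \<Rightarrow> real^3"
  assumes ch: "graph_chart \<Omega> \<Gamma> p R g r h"
    and n: "\<forall>x\<in>\<Gamma>. outward_unit_normal \<Omega> x (n x)"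
    and sm: "\<And>k. smooth (\<psi> k)" and sym: "\<And>k i j. partial j (partial i (\<psi> k)) = partial i (partial j (\<psi> k))"
    and G: "\<And>i. surface_L1_loc_tendsto \<Omega> \<Gamma> (\<lambda>k. partial i (\<psi> k)) (\<lambda>x. G x $ i)"
    and H: "\<And>i j. surface_L1_loc_tendsto \<Omega> \<Gamma> (\<lambda>k. partial i (partial j (\<psi> k))) (H i j)"
    and diff: "AE_surface \<Omega> \<Gamma> (\<lambda>x. n differentiable (at x within \<Gamma>))"
    and neumann: "AE_surface \<Omega> \<Gamma> (\<lambda>x. n x \<bullet> G x = 0)"
  shows "AE y in lborel. y \<in> ball 0 r \<longrightarrow> (let x = graph_point p R g y in
     (\<Sum>i\<in>UNIV. n x $ i * (\<Sum>j\<in>UNIV. G x $ j * H i j x))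
       = - (frechet_derivative n (at x within \<Gamma>) (G x) \<bullet> G x))"
proof -
  have lg: "local_graph \<Omega> p R g r h" using ch by (simp add: graph_chart_def)
  have R: "orthogonal_transformation R" and r: "r > 0" using lg by (auto simp: local_graph_def)
  obtain Dg L where g: "\<And>y. y \<in> ball 0 r \<Longrightarrow> (g has_derivative (\<lambda>c. c \<bullet> Dg y)) (at y)"
    and Dg: "L-lipschitz_on (ball 0 r) Dg" using local_graph_gradient[OF lg] by blast
  let ?\<gamma> = "graph_point p R g" and ?U = "ball (0::real^2) r"
  define N where "N i y = graph_normal R (Dg y) $ i" for i y
  have NL: "L-lipschitz_on ?U (N i)" for i unfolding N_def by (rule graph_normal_lipschitz[OF R Dg])
  define \<tau> where "\<tau> l j y = tangent_vector R (Dg y) (axis l 1) $ j" for l j y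
  define A where "A y = frechet_derivative n (at (?\<gamma> y) within \<Gamma>)" for y
  define s where "s y = n (?\<gamma> y) \<bullet> R (axis 3 1)" for y
  define V where "V y c = (1 / s y) *\<^sub>R A y (tangent_vector R (Dg y) c)
        - ((A y (tangent_vector R (Dg y) c) \<bullet> R (axis 3 1)) / (s y)\<^sup>2) *\<^sub>R n (?\<gamma> y)" for y c
  have in\<Gamma>: "?\<gamma> y \<in> \<Gamma>" if "y \<in> ?U" for y using ch that by (simp add: graph_chart_def)
  have orth: "n (?\<gamma> y) \<bullet> tangent_vector R (Dg y) c = 0" if "y \<in> ?U" for y c
    by (rule normal_orthogonal_tangent[OF ch that g[OF that]]) (use n in\<Gamma>[OF that] in blast)
  have n1: "norm (n (?\<gamma> y)) = 1" if "y \<in> ?U" for y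
    using n in\<Gamma>[OF that] by (auto simp: outward_unit_normal_def)
  have nN: "n (?\<gamma> y) = s y *\<^sub>R graph_normal R (Dg y)" "s y \<noteq> 0" if "y \<in> ?U" for y
    using unit_normal_eq_graph_normal[OF R orth[OF that] n1[OF that]] by (simp_all add: s_def)
  have diffc: "AE y in lborel. y \<in> ?U \<longrightarrow> n differentiable (at (?\<gamma> y) within \<Gamma>)"
    using diff ch unfolding AE_surface_def by blast
  have neumannc: "AE y in lborel. y \<in> ?U \<longrightarrow> n (?\<gamma> y) \<bullet> G (?\<gamma> y) = 0"
    using neumann ch unfolding AE_surface_def by blast
  have dirN: "((\<lambda>t. N i (y + t *\<^sub>R axis l 1)) has_real_derivative V y (axis l 1) $ i) (at 0)"
    if y: "y \<in> ?U" and d: "n differentiable (at (?\<gamma> y) within \<Gamma>)" for i l y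
  proof -
    have lin: "linear (A y)" unfolding A_def by (rule linear_frechet_derivative[OF d])
    have Vs: "V y (t *\<^sub>R c) = t *\<^sub>R V y c" for t c
      unfolding V_def
      by (simp add: linear_cmul[OF linear_tangent_vector[OF R]] linear_cmul[OF lin] scaleR_right_diff_distrib)
    have V': "((\<lambda>z. graph_normal R (Dg z)) has_derivative V y) (at (y + 0 *\<^sub>R axis l 1))"
      using graph_normal_has_derivative[OF ch g n y d] unfolding V_def[abs_def] A_def s_def by simp
    have d1: "((\<lambda>t. y + t *\<^sub>R axis l (1::real)) has_derivative (\<lambda>t. t *\<^sub>R axis l 1)) (at 0)"
      by (auto intro!: derivative_eq_intros)
    have "((\<lambda>t. graph_normal R (Dg (y + t *\<^sub>R axis l 1)) $ i) has_derivative (\<lambda>t. V y (t *\<^sub>R axis l 1) $ i)) (at 0)"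
      by (rule bounded_linear.has_derivative[OF bounded_linear_vec_nth has_derivative_compose[OF d1 V']])
    then show ?thesis unfolding N_def has_field_derivative_def
      by (rule has_derivative_eq_rhs) (simp add: fun_eq_iff Vs)
  qed
  have tangential: "AE y in lborel. y \<in> ?U \<longrightarrow>
      (\<Sum>i\<in>UNIV. N i y * (\<Sum>j\<in>UNIV. \<tau> l j y * H i j (?\<gamma> y)) + V y (axis l 1) $ i * G (?\<gamma> y) $ i) = 0" for l
  proof -
    have "\<exists>DN\<in>borel_measurable borel. \<forall>y\<in>?U. \<forall>d. ((\<lambda>t. N i (y + t *\<^sub>R axis l 1)) has_real_derivative d) (at 0) \<longrightarrow> DN y = d" for i
      using measurable_directional_derivative[OF open_ball lipschitz_on_continuous_on[OF NL], of i "axis l 1"] by metis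
    then obtain DN where DN: "\<And>i. DN i \<in> borel_measurable borel"
      "\<And>i y d. y \<in> ?U \<Longrightarrow> ((\<lambda>t. N i (y + t *\<^sub>R axis l 1)) has_real_derivative d) (at 0) \<Longrightarrow> DN i y = d" by metis
    have c\<tau>: "continuous_on ?U (\<tau> l j)" for j
    proof -
      have "continuous_on ?U (\<lambda>y. R (lift (axis l 1) (axis l 1 \<bullet> Dg y)))"
        by (rule linear_continuous_on_compose[OF _ orthogonal_transformation_linear[OF R]])
          (unfold lift_eq, intro continuous_intros lipschitz_on_continuous_on[OF Dg])
      then show ?thesis unfolding \<tau>_def tangent_vector_def by (intro continuous_intros)
    qed
    have "AE y in lborel. y \<in> ?U \<longrightarrow>
      (\<Sum>i\<in>UNIV. N i y * (\<Sum>j\<in>UNIV. \<tau> l j y * H i j (?\<gamma> y)) + DN i y * G (?\<gamma> y) $ i) = 0"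
    proof (rule differentiated_orthogonality[where F = "\<lambda>i k y. partial i (\<psi> k) (?\<gamma> y)" and l = l
          and F' = "\<lambda>i k y. \<Sum>j\<in>UNIV. \<tau> l j y * partial i (partial j (\<psi> k)) (?\<gamma> y)", OF r])
      show "\<exists>C. C-lipschitz_on (cball 0 \<rho>) (N i)" if "\<rho> < r" for i \<rho>
        by (rule exI[of _ L], rule lipschitz_on_subset[OF NL]) (use that in auto)
      show "AE y in lborel. y \<in> ?U \<longrightarrow> ((\<lambda>t. N i (y + t *\<^sub>R axis l 1)) has_real_derivative DN i y) (at 0)" for i
        using diffc
      proof eventually_elim
        case (elim y)
        then show ?case using dirN DN(2) by metis
      qed
      show "(\<lambda>y. indicator ?U y * DN i y) \<in> borel_measurable borel" for i
        by (intro borel_measurable_times borel_measurable_indicator DN(1)) simp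
      show "\<exists>C. C-lipschitz_on (cball 0 \<rho>) (\<lambda>y. partial i (\<psi> k) (?\<gamma> y))" if "\<rho> < r" for i k \<rho>
        by (rule smooth_on_chart_lipschitz[OF lg g Dg smooth_partial[OF sm] that])
      show "((\<lambda>t. partial i (\<psi> k) (?\<gamma> (y + t *\<^sub>R axis l 1))) has_real_derivative
          (\<Sum>j\<in>UNIV. \<tau> l j y * partial i (partial j (\<psi> k)) (?\<gamma> y))) (at 0)" if "y \<in> ?U" for i k y
      proof -
        have "((\<lambda>t. partial i (\<psi> k) (?\<gamma> (y + t *\<^sub>R axis l 1))) has_real_derivative
          (\<Sum>j\<in>UNIV. \<tau> l j y * partial j (partial i (\<psi> k)) (?\<gamma> y))) (at 0)"
          unfolding \<tau>_def by (rule smooth_on_chart_directional_derivative[OF R g[OF that] smooth_partial[OF sm]])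
        moreover have "partial j (partial i (\<psi> k)) = partial i (partial j (\<psi> k))" for j by (rule sym)
        ultimately show ?thesis by (simp only:)
      qed
      show "L1_loc_tendsto ?U (\<lambda>k y. partial i (\<psi> k) (?\<gamma> y)) (\<lambda>y. G (?\<gamma> y) $ i)" for i
        using G ch unfolding surface_L1_loc_tendsto_def by blast
      have "L1_loc_tendsto ?U (\<lambda>k y. partial i (partial j (\<psi> k)) (?\<gamma> y)) (\<lambda>y. H i j (?\<gamma> y))" for i j
        using H ch unfolding surface_L1_loc_tendsto_def by blast
      then show "L1_loc_tendsto ?U (\<lambda>k y. \<Sum>j\<in>UNIV. \<tau> l j y * partial i (partial j (\<psi> k)) (?\<gamma> y))
          (\<lambda>y. \<Sum>j\<in>UNIV. \<tau> l j y * H i j (?\<gamma> y))" for i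
        by (intro L1_loc_tendsto_sum L1_loc_tendsto_mult_continuous c\<tau>) auto
      show "AE y in lborel. y \<in> ?U \<longrightarrow> (\<Sum>i\<in>UNIV. N i y * G (?\<gamma> y) $ i) = 0"
        using neumannc
      proof eventually_elim
        case (elim y)
        show ?case
        proof
          assume y: "y \<in> ?U"
          then have "s y * (graph_normal R (Dg y) \<bullet> G (?\<gamma> y)) = 0" using elim nN(1)[OF y] by (metis inner_scaleR_left)
          then have "graph_normal R (Dg y) \<bullet> G (?\<gamma> y) = 0" using nN(2)[OF y] by simp
          then show "(\<Sum>i\<in>UNIV. N i y * G (?\<gamma> y) $ i) = 0" by (simp add: N_def inner_vec_def)
        qed
      qed
    qed
    then show ?thesis using diffc
    proof eventually_elim
      case (elim y)
      show ?case
      proof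
        assume y: "y \<in> ?U"
        then have "DN i y = V y (axis l 1) $ i" for i using elim dirN DN(2) by blast
        then show "(\<Sum>i\<in>UNIV. N i y * (\<Sum>j\<in>UNIV. \<tau> l j y * H i j (?\<gamma> y)) + V y (axis l 1) $ i * G (?\<gamma> y) $ i) = 0"
          using elim y by simp
      qed
    qed
  qed
  have "AE y in lborel. \<forall>l. y \<in> ?U \<longrightarrow>
      (\<Sum>i\<in>UNIV. N i y * (\<Sum>j\<in>UNIV. \<tau> l j y * H i j (?\<gamma> y)) + V y (axis l 1) $ i * G (?\<gamma> y) $ i) = 0"
    using tangential by (subst AE_all_countable) auto
  then show ?thesis using diffc neumannc
  proof eventually_elim
    case (elim y)
    show ?case
    proof
      assume y: "y \<in> ?U"
      define x where "x = ?\<gamma> y"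
      have nd: "n differentiable (at x within \<Gamma>)" and ne: "n x \<bullet> G x = 0" using elim y by (auto simp: x_def)
      have lin: "linear (A y)" unfolding A_def by (rule linear_frechet_derivative[OF nd[unfolded x_def]])
      have lt: "linear (tangent_vector R (Dg y))" by (rule linear_tangent_vector[OF R])
      have "s y * (graph_normal R (Dg y) \<bullet> G x) = 0" using ne nN(1)[OF y] by (metis inner_scaleR_left x_def)
      then have "G x \<bullet> graph_normal R (Dg y) = 0" using nN(2)[OF y] by (simp add: inner_commute)
      then obtain c where c: "G x = tangent_vector R (Dg y) c" using orthogonal_to_normal_imp_tangent[OF R] by blast
      have c_sum: "c = (\<Sum>l\<in>UNIV. c $ l *\<^sub>R axis l 1)" by (simp add: sum_axis)
      have G\<tau>: "G x $ j = (\<Sum>l\<in>UNIV. c $ l * \<tau> l j y)" for j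
      proof -
        have "G x = (\<Sum>l\<in>UNIV. c $ l *\<^sub>R tangent_vector R (Dg y) (axis l 1))"
          unfolding c by (subst c_sum) (simp add: linear_sum[OF lt] linear_cmul[OF lt])
        then show ?thesis by (simp add: \<tau>_def)
      qed
      have linV: "linear (V y)"
        unfolding V_def by (rule linearI)
          (simp_all add: linear_add[OF lt] linear_add[OF lin] linear_cmul[OF lt] linear_cmul[OF lin]
            inner_add_left add_divide_distrib scaleR_add_right scaleR_add_left scaleR_right_diff_distrib)
      have Vc: "V y c $ i = (\<Sum>l\<in>UNIV. c $ l * V y (axis l 1) $ i)" for i
      proof -
        have "V y c = (\<Sum>l\<in>UNIV. c $ l *\<^sub>R V y (axis l 1))"
          by (subst c_sum) (simp add: linear_sum[OF linV] linear_cmul[OF linV])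
        then show ?thesis by simp
      qed
      have "(\<Sum>i\<in>UNIV. N i y * (\<Sum>j\<in>UNIV. G x $ j * H i j x)) + (\<Sum>i\<in>UNIV. V y c $ i * G x $ i)
          = (\<Sum>l\<in>UNIV. c $ l * (\<Sum>i\<in>UNIV. N i y * (\<Sum>j\<in>UNIV. \<tau> l j y * H i j x) + V y (axis l 1) $ i * G x $ i))"
      proof -
        have 1: "(\<Sum>i\<in>UNIV. N i y * (\<Sum>j\<in>UNIV. G x $ j * H i j x))
            = (\<Sum>l\<in>UNIV. c $ l * (\<Sum>i\<in>UNIV. N i y * (\<Sum>j\<in>UNIV. \<tau> l j y * H i j x)))"
          unfolding G\<tau> by (simp add: sum_2 sum_3 algebra_simps)
        have 2: "(\<Sum>i\<in>UNIV. V y c $ i * G x $ i) = (\<Sum>l\<in>UNIV. c $ l * (\<Sum>i\<in>UNIV. V y (axis l 1) $ i * G x $ i))"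
          unfolding Vc by (simp add: sum_2 sum_3 algebra_simps)
        show ?thesis unfolding 1 2 by (simp add: sum.distrib distrib_left)
      qed
      also have "\<dots> = 0" using elim y by (simp add: x_def)
      finally have *: "(\<Sum>i\<in>UNIV. N i y * (\<Sum>j\<in>UNIV. G x $ j * H i j x)) = - (V y c \<bullet> G x)"
        by (simp add: inner_vec_def)
      \<comment> \<open>the derivative of the scalar factor drops out because \<open>n x\<close> is orthogonal to \<open>G x\<close>\<close>
      have "V y c \<bullet> G x = (1 / s y) * (A y (G x) \<bullet> G x)"
        using ne by (simp add: V_def c[symmetric] inner_diff_left x_def[symmetric])
      then have "s y * (\<Sum>i\<in>UNIV. N i y * (\<Sum>j\<in>UNIV. G x $ j * H i j x)) = - (A y (G x) \<bullet> G x)"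
        unfolding * using nN(2)[OF y] by simp
      moreover have "n x $ i = s y * N i y" for i using nN(1)[OF y] by (simp add: x_def N_def)
      ultimately have "(\<Sum>i\<in>UNIV. n x $ i * (\<Sum>j\<in>UNIV. G x $ j * H i j x)) = - (A y (G x) \<bullet> G x)"
        by (simp add: sum_distrib_left mult.assoc)
      then show "let x = ?\<gamma> y in (\<Sum>i\<in>UNIV. n x $ i * (\<Sum>j\<in>UNIV. G x $ j * H i j x))
       = - (frechet_derivative n (at x within \<Gamma>) (G x) \<bullet> G x)"
        by (simp add: Let_def A_def x_def)
    qed
  qed
qed

text \<open>A vector orthogonal to \<open>n x\<close> is expanded in the principal frame, which diagonalises the
  Weingarten map on the tangent plane.\<close>

lemma curvature_identities_at_point:
  assumes pf: "principal_frame \<Gamma> n x k1 k2 e1 e2" and n1: "norm (n x) = 1" and nG: "n x \<bullet> v = 0"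
    and q: "q = - 2 * (frechet_derivative n (at x within \<Gamma>) v \<bullet> v)"
  shows "v \<bullet> (weingarten \<Gamma> n x *v v) = k1 * (e1 \<bullet> v)\<^sup>2 + k2 * (e2 \<bullet> v)\<^sup>2"
    and "q = - 2 * k1 * (e1 \<bullet> v)\<^sup>2 - 2 * k2 * (e2 \<bullet> v)\<^sup>2"
proof -
  define a b where "a = e1 \<bullet> v" and "b = e2 \<bullet> v"
  have v: "v = a *\<^sub>R e1 + b *\<^sub>R e2"
    unfolding a_def b_def using pf nG n1
    by (intro orthonormal_expansion[of "n x"]) (auto simp: principal_frame_def inner_commute)
  have "weingarten \<Gamma> n x *v v = a *\<^sub>R (weingarten \<Gamma> n x *v e1) + b *\<^sub>R (weingarten \<Gamma> n x *v e2)"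
    by (subst v) (simp add: matrix_vector_right_distrib matrix_vector_mult_scaleR)
  then have Wv: "weingarten \<Gamma> n x *v v = (a * k1) *\<^sub>R e1 + (b * k2) *\<^sub>R e2"
    using pf by (simp add: principal_frame_def)
  show quad: "v \<bullet> (weingarten \<Gamma> n x *v v) = k1 * (e1 \<bullet> v)\<^sup>2 + k2 * (e2 \<bullet> v)\<^sup>2"
    unfolding Wv by (simp add: inner_add_right a_def b_def inner_commute power2_eq_square)
  have "n differentiable (at x within \<Gamma>)" using pf by (simp add: principal_frame_def)
  from inner_weingarten[OF this, of v v]
  have "frechet_derivative n (at x within \<Gamma>) v \<bullet> v = v \<bullet> (weingarten \<Gamma> n x *v v)"
    using nG by (simp add: inner_commute)
  then show "q = - 2 * k1 * (e1 \<bullet> v)\<^sup>2 - 2 * k2 * (e2 \<bullet> v)\<^sup>2"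
    unfolding q quad by (simp add: algebra_simps)
qed

theorem mainTheorem2:
  fixes \<Omega> \<Gamma> :: "(real^3) set"
    and n d1 d2 :: "real^3 \<Rightarrow> real^3"
    and \<phi> \<kappa>1 \<kappa>2 :: "real^3 \<Rightarrow> real"
  assumes "open \<Omega>" and "connected \<Omega>" and "\<Omega> \<noteq> {}"
    and "C11_boundary_part \<Omega> \<Gamma>"
    and "\<forall>x\<in>\<Gamma>. outward_unit_normal \<Omega> x (n x)"
    and "\<phi> \<in> sobolev_H 3"
    and "AE_surface \<Omega> \<Gamma> (\<lambda>x. normal_deriv \<Omega> \<Gamma> n \<phi> x = 0)"
    and "AE_surface \<Omega> \<Gamma> (\<lambda>x. principal_frame \<Gamma> n x (\<kappa>1 x) (\<kappa>2 x) (d1 x) (d2 x))"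
  shows "AE_surface \<Omega> \<Gamma> (\<lambda>x.
      tangential_grad \<Omega> \<Gamma> n \<phi> x \<bullet> (weingarten \<Gamma> n x *v tangential_grad \<Omega> \<Gamma> n \<phi> x)
        = \<kappa>1 x * (d1 x \<bullet> tangential_grad \<Omega> \<Gamma> n \<phi> x)\<^sup>2
          + \<kappa>2 x * (d2 x \<bullet> tangential_grad \<Omega> \<Gamma> n \<phi> x)\<^sup>2
      \<and> normal_deriv \<Omega> \<Gamma> n (\<lambda>z. (norm (wgrad \<phi> z))\<^sup>2) x
        = - 2 * \<kappa>1 x * (d1 x \<bullet> tangential_grad \<Omega> \<Gamma> n \<phi> x)\<^sup>2
          - 2 * \<kappa>2 x * (d2 x \<bullet> tangential_grad \<Omega> \<Gamma> n \<phi> x)\<^sup>2)"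
proof -
  note normal = assms(5) and \<phi> = assms(6) and neumann = assms(7) and frame = assms(8)
  let ?w = "\<lambda>z. (norm (wgrad \<phi> z))\<^sup>2" and ?t = "tangential_grad \<Omega> \<Gamma> n \<phi>"
  let ?P = "\<lambda>x. ?t x \<bullet> (weingarten \<Gamma> n x *v ?t x) = \<kappa>1 x * (d1 x \<bullet> ?t x)\<^sup>2 + \<kappa>2 x * (d2 x \<bullet> ?t x)\<^sup>2
    \<and> normal_deriv \<Omega> \<Gamma> n ?w x = - 2 * \<kappa>1 x * (d1 x \<bullet> ?t x)\<^sup>2 - 2 * \<kappa>2 x * (d2 x \<bullet> ?t x)\<^sup>2"
  obtain \<psi> where sm: "\<And>k. smooth (\<psi> k)"
    and sym: "\<And>k i j. partial j (partial i (\<psi> k)) = partial i (partial j (\<psi> k))"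
    and c1: "\<And>i. L1_loc_tendsto UNIV (\<lambda>k. partial i (\<psi> k)) (wpartial i \<phi>)"
    and c2: "\<And>i j. L1_loc_tendsto UNIV (\<lambda>k. partial j (partial i (\<psi> k))) (wpartial j (wpartial i \<phi>))"
    and c3: "\<And>i j l. L1_loc_tendsto UNIV (\<lambda>k. partial l (partial j (partial i (\<psi> k)))) (wpartial l (wpartial j (wpartial i \<phi>)))"
    and w1: "\<And>i. L1_loc_tendsto UNIV (\<lambda>k x. \<Sum>j\<in>UNIV. 2 * partial j (\<psi> k) x * partial i (partial j (\<psi> k)) x) (wpartial i ?w)"
    and w2: "\<And>i l. L1_loc_tendsto UNIV (\<lambda>k. partial l (\<lambda>x. \<Sum>j\<in>UNIV. 2 * partial j (\<psi> k) x * partial i (partial j (\<psi> k)) x)) (wpartial l (wpartial i ?w))"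
    by (rule sobolev_H3_approximation[OF \<phi>]) (rule that)
  define G where "G = grad_trace \<Omega> \<Gamma> \<phi>"
  define H where "H i j = trace \<Omega> \<Gamma> (wpartial i (wpartial j \<phi>))" for i j
  have sG: "surface_L1_loc_tendsto \<Omega> \<Gamma> (\<lambda>k. partial i (\<psi> k)) (\<lambda>x. G x $ i)" for i
    using surface_L1_loc_tendsto_trace[OF smooth_partial[OF sm] c1 c2] by (simp add: G_def grad_trace_def)
  have sH: "surface_L1_loc_tendsto \<Omega> \<Gamma> (\<lambda>k. partial i (partial j (\<psi> k))) (H i j)" for i j
    unfolding H_def by (rule surface_L1_loc_tendsto_trace[OF smooth_partial[OF smooth_partial[OF sm]] c2 c3])
  have sW: "surface_L1_loc_tendsto \<Omega> \<Gamma> (\<lambda>k x. \<Sum>j\<in>UNIV. 2 * partial j (\<psi> k) x * partial i (partial j (\<psi> k)) x) (trace \<Omega> \<Gamma> (wpartial i ?w))" for i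
    by (rule surface_L1_loc_tendsto_trace[OF _ w1 w2])
      (intro smooth_sum smooth_mult smooth_const smooth_partial sm)
  have diff: "AE_surface \<Omega> \<Gamma> (\<lambda>x. n differentiable (at x within \<Gamma>))"
    unfolding AE_surface_def
  proof (intro allI impI)
    fix p R g r h assume "graph_chart \<Omega> \<Gamma> p R g r h"
    then have "AE y in lborel. y \<in> ball 0 r \<longrightarrow> principal_frame \<Gamma> n (graph_point p R g y) (\<kappa>1 (graph_point p R g y))
       (\<kappa>2 (graph_point p R g y)) (d1 (graph_point p R g y)) (d2 (graph_point p R g y))"
      using frame unfolding AE_surface_def by blast
    then show "AE y in lborel. y \<in> ball 0 r \<longrightarrow> n differentiable (at (graph_point p R g y) within \<Gamma>)"
      by eventually_elim (auto simp: principal_frame_def)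
  qed
  have neumann': "AE_surface \<Omega> \<Gamma> (\<lambda>x. n x \<bullet> G x = 0)"
    using neumann by (simp add: normal_deriv_def G_def)
  show ?thesis
    unfolding AE_surface_def
  proof (intro allI impI)
    fix p R g r h assume ch: "graph_chart \<Omega> \<Gamma> p R g r h"
    let ?\<gamma> = "graph_point p R g" and ?U = "ball (0::real^2) r"
    have W: "AE y in lborel. y \<in> ?U \<longrightarrow> trace \<Omega> \<Gamma> (wpartial i ?w) (?\<gamma> y) = (\<Sum>j\<in>UNIV. 2 * G (?\<gamma> y) $ j * H i j (?\<gamma> y))" for i
      using sG sH sW[of i] ch unfolding surface_L1_loc_tendsto_def
      by (intro L1_loc_limit_of_products[where f = "\<lambda>j k y. partial j (\<psi> k) (?\<gamma> y)" and g = "\<lambda>j k y. partial i (partial j (\<psi> k)) (?\<gamma> y)"]) blast+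
    have W': "AE y in lborel. \<forall>i. y \<in> ?U \<longrightarrow> trace \<Omega> \<Gamma> (wpartial i ?w) (?\<gamma> y) = (\<Sum>j\<in>UNIV. 2 * G (?\<gamma> y) $ j * H i j (?\<gamma> y))"
      using W by (subst AE_all_countable) auto
    have fr: "AE y in lborel. y \<in> ?U \<longrightarrow> principal_frame \<Gamma> n (?\<gamma> y) (\<kappa>1 (?\<gamma> y)) (\<kappa>2 (?\<gamma> y)) (d1 (?\<gamma> y)) (d2 (?\<gamma> y))"
      using frame ch unfolding AE_surface_def by blast
    have ne: "AE y in lborel. y \<in> ?U \<longrightarrow> n (?\<gamma> y) \<bullet> G (?\<gamma> y) = 0"
      using neumann' ch unfolding AE_surface_def by blast
    show "AE y in lborel. y \<in> ?U \<longrightarrow> ?P (?\<gamma> y)"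
      using differentiated_neumann_condition[OF ch normal sm sym sG sH diff neumann'] W' fr ne
    proof eventually_elim
      case (elim y)
      show ?case
      proof
        assume y: "y \<in> ?U"
        define x where "x = ?\<gamma> y"
        have "x \<in> \<Gamma>" using ch y by (simp add: graph_chart_def x_def)
        then have n1: "norm (n x) = 1" using normal by (auto simp: outward_unit_normal_def)
        have nG: "n x \<bullet> G x = 0" using elim y by (simp add: x_def)
        have tg: "tangential_grad \<Omega> \<Gamma> n \<phi> x = G x"
          using nG by (simp add: tangential_grad_def normal_deriv_def G_def)
        have pf: "principal_frame \<Gamma> n x (\<kappa>1 x) (\<kappa>2 x) (d1 x) (d2 x)" using elim y by (simp add: x_def)
        have "normal_deriv \<Omega> \<Gamma> n ?w x = (\<Sum>i\<in>UNIV. n x $ i * (\<Sum>j\<in>UNIV. 2 * G x $ j * H i j x))"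
          using elim y by (simp add: normal_deriv_def grad_trace_def inner_vec_def x_def)
        also have "\<dots> = 2 * (\<Sum>i\<in>UNIV. n x $ i * (\<Sum>j\<in>UNIV. G x $ j * H i j x))"
          by (simp add: sum_distrib_left mult_ac)
        also have "\<dots> = - 2 * (frechet_derivative n (at x within \<Gamma>) (G x) \<bullet> G x)"
          using elim y by (simp add: Let_def x_def)
        finally show "?P (?\<gamma> y)"
          using curvature_identities_at_point[OF pf n1 nG] unfolding x_def[symmetric] tg by blast
      qed
    qed
  qed
qed

end
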